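(* Let $S$ be an oriented two-sphere decomposed as $S=\overleftarrow{D}\cup\overrightarrow{D}$, where $\overleftarrow{D}$ and $\overrightarrow{D}$ are closed discs, oriented from $S$, which intersect only in their common boundary; orient that boundary as the boundary of $\overleftarrow{D}$, and let $\ast\in\partial\overleftarrow{D}$ be a marked point. Let $L$ be an oriented link diagram in $S$ which intersects $\partial\overleftarrow{D}$ transversely, away from its crossings and away from $\ast$, in $2n$ points. Let $T_1=L\cap\overleftarrow{D}$ (an inside tangle) and $T_2=L\cap\overrightarrow{D}$ (an outside tangle). Then the composition $$\mathbb{Z}[q^{1/2},q^{-1/2}]\xrightarrow{\ [\langle\!\langle T_1]\!]]\ }\mathcal{I}_{2n}\xrightarrow{\ [[\![T_2\rangle\!\rangle]\ }\mathbb{Z}[q^{1/2},q^{-1/2}]$$ equals multiplication by the Jones polynomial $J_L(q)$. Here the first map is $f(q)\mapsto f(q)\,[\langle\!\langle T_1]\!]]$ with $[\langle\!\langle T_1]\!]]\in\mathcal{I}_{2n}$ the decategorification of the type A structure of $T_1$, and the second is the linear functional $[[\![T_2\rangle\!\rangle]\in\mathrm{Hom}_{\mathbb{Z}[q^{\pm1/2}]}(\mathcal{I}_{2n},\mathbb{Z}[q^{\pm1/2}])$ which is the decategorification of the type D structure of $T_2$.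
   Context: **Jones polynomial.** For an oriented link diagram $L$ with $n_+(L)$ positive and $n_-(L)$ negative crossings, $$J_L(q)=(-1)^{n_-(L)}q^{\,n_+(L)-2n_-(L)}\widetilde J_L(q).$$ Here $\widetilde J$ is the invariant of unoriented diagrams determined by $\widetilde J_U=q+q^{-1}$ for $U$ a crossingless circle, $\widetilde J_{L\sqcup U}=(q+q^{-1})\widetilde J_L$, and $\widetilde J_L=\widetilde J_{L_0}-q\,\widetilde J_{L_1}$. In the last relation $L_0,L_1$ are obtained from $L$ by replacing a chosen crossing by its $0$-resolution and $1$-resolution. (For the empty diagram $\widetilde J=1$.) Resolutions follow Khovanov's standard convention: the $0$-resolution joins the two regions swept out by rotating the over-strand counterclockwise to the under-strand, the $1$-resolution joins the other two. $J_L(q)$ is the graded Euler characteristic of Khovanov homology. **Decorated cleaved links and $\mathcal{I}_{2n}$.** A *cleaved link* in an oriented sphere $S$ consists of - a smoothly embedded circle $E\subset S$ (the equator) with a marked point $\ast\in E$; - an identification of the two closed discs bounded by $E$ as inside disc $\overleftarrow{D}$ and outside disc $\overrightarrow{D}$, both oriented from $S$, with $E$ oriented as $\partial\overleftarrow{D}$; - a (possibly empty) finite set of pairwise disjoint simple closed curves, each meeting $E$ non-trivially and transversely away from $\ast$. A *decoration* $\sigma$ assigns $+$ or $-$ to each curve. Two decorated cleaved links are equivalent if there is an orientation-preserving diffeomorphism of spheres preserving all of this structure, including the decorations. $\mathcal{CL}_n$ is the set of equivalence classes of decorated cleaved links $(L,\sigma)$ whose curves meet $E$ in exactly $2n$ points.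 $\mathcal{I}_{2n}$ is the free $\mathbb{Z}[q^{1/2},q^{-1/2}]$-module with basis $\{I_{(L,\sigma)}:(L,\sigma)\in\mathcal{CL}_n\}$. **Resolutions of tangles.** Let $T$ be one of the two tangles $T_1\subset\overleftarrow{D}$, $T_2\subset\overrightarrow{D}$, with the orientation inherited from $L$. Let $n_\pm(T)$ be its numbers of positive/negative crossings and $P_T$ its set of $2n$ boundary points. An *APS-resolution* $\rho$ of $T$ is a map from the crossings of $T$ to $\{0,1\}$; $\rho(T)$ is the planar diagram obtained by replacing each crossing $c$ by its $\rho(c)$-resolution. A *decorated resolution* of $T$ is a triple $(\rho,m,s)$ where - $\rho$ is an APS-resolution of $T$; - $m$ is a planar matching (considered up to isotopy) of $P_T$ embedded in the complementary disc, i.e. $m=\overrightarrow{m}$ in $\overrightarrow{D}$ if $T=T_1$, and $m=\overleftarrow{m}$ in $\overleftarrow{D}$ if $T=T_2$; - $s$ assigns $+$ or $-$ to each circle of the diagram in $S$ obtained by gluing $\rho(T)$ to $m$ along $P_T$. Circles meeting $P_T$ are *cut* circles; the others are *free* circles. The gradings are $$h(\rho)=\sum_{c}\rho(c)-n_-(T),$$ $$I(\rho,m,s)=h(\rho)+\sum_{C\ \mathrm{free}}s(C)+\tfrac12\sum_{C\ \mathrm{cut}}s(C)+\big(n_+(T)-n_-(T)\big),$$ where $s(C)=\pm$ is read as $\pm1$. The *boundary* $\partial(\rho,m,s)\in\mathcal{CL}_n$ is the class of the decorated cleaved link with equator $\partial\overleftarrow{D}$, marked point $\ast$, inside disc $\overleftarrow{D}$,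 outside disc $\overrightarrow{D}$, curves the cut circles, and decoration the restriction of $s$ to the cut circles. **Decategorifications.** $$[\langle\!\langle T_1]\!]]=\sum_{(\rho,\overrightarrow{m},s)}(-1)^{h(\rho)}q^{I(\rho,\overrightarrow{m},s)}\,I_{\partial(\rho,\overrightarrow{m},s)}\in\mathcal{I}_{2n},$$ the sum being over all decorated resolutions of $T_1$. The functional $[[\![T_2\rangle\!\rangle]$ is the $\mathbb{Z}[q^{\pm1/2}]$-linear extension of $$[[\![T_2\rangle\!\rangle](I_{(L,\sigma)})=\sum_{\partial(\rho,\overleftarrow{m},s)=(L,\sigma)}(-1)^{h(\rho)}q^{I(\rho,\overleftarrow{m},s)},$$ the sum being over decorated resolutions of $T_2$ with boundary $(L,\sigma)$. *)

theory Defs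
  imports "HOL-Library.Poly_Mapping" "HOL-Library.Disjoint_Sets" "HOL-Combinatorics.Combinatorics"
begin

section \<open>Planar diagrams\<close>

text \<open>
  Diagrams are encoded as combinatorial maps.  A diagram in a sphere or a closed disc is cut into
  finitely many edges by its crossings, its boundary points and some bivalent points on its
  strands (a crossingless circle carries at least one bivalent point).  A dart is one of the two
  ends of an edge:
  \<^item> \<open>edge d\<close> is the other end of the edge with end \<open>d\<close>;
  \<^item> \<open>rot d\<close> is the next end, counterclockwise, at the crossing or bivalent point where \<open>d\<close> sits;
  \<^item> \<open>over\<close> consists of the ends at crossings that belong to over-strands;
  \<^item> \<open>ends\<close> lists the ends at boundary points, in the order in which one meets these points when
    traversing the boundary circle from its marked point.  The list is empty for diagrams in the
    sphere.  The values of \<open>rot\<close> on these ends are irrelevant.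

  The encoding does not record in which region of one connected component another one lies; the
  notions below do not depend on it.
\<close>

record 'd diagram =
  darts :: "'d set"
  edge :: "'d \<Rightarrow> 'd"
  rot :: "'d \<Rightarrow> 'd"
  over :: "'d set"
  ends :: "'d list"

definition diagram :: "'d diagram \<Rightarrow> bool" where
  "diagram T \<longleftrightarrow>
     finite (darts T) \<and> distinct (ends T) \<and> set (ends T) \<subseteq> darts T \<and>
     over T \<subseteq> darts T - set (ends T) \<and>
     (\<forall>d\<in>darts T. edge T d \<in> darts T \<and> edge T d \<noteq> d \<and> edge T (edge T d) = d) \<and>
     (\<forall>d\<in>darts T - set (ends T). rot T d \<in> darts T - set (ends T) \<and>
        (rot T d \<noteq> d \<and> rot T (rot T d) = d \<and> d \<notin> over T \<or>
         rot T (rot T d) \<noteq> d \<and> rot T (rot T (rot T (rot T d))) = d \<and>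
         (rot T d \<in> over T \<longleftrightarrow> d \<notin> over T)))"

definition joined :: "'d diagram \<Rightarrow> ('d \<times> 'd) set" where
  "joined T =
     (let R = {(d, edge T d) |d. d \<in> darts T} \<union> {(d, rot T d) |d. d \<in> darts T - set (ends T)}
      in (R \<union> R\<inverse>)\<^sup>*)"

text \<open>Each connected component is represented by its set of darts.\<close>

definition components :: "'d diagram \<Rightarrow> 'd set set" where
  "components T = darts T // joined T"

definition vertex :: "'d diagram \<Rightarrow> 'd \<Rightarrow> 'd set" where
  "vertex T d = {d, rot T d, rot T (rot T d), rot T (rot T (rot T d))}"

definition crossings :: "'d diagram \<Rightarrow> 'd set set" where
  "crossings T = vertex T ` over T"

subsection \<open>Planarity\<close>

text \<open>Genus zero, by Euler's formula \<open>V - E + F = 2\<close> for each connected component.\<close>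

definition planar_map :: "'d diagram \<Rightarrow> bool" where
  "planar_map M \<longleftrightarrow>
     card (orbit (rot M) ` darts M) + card (orbit (rot M \<circ> edge M) ` darts M) =
     card ((\<lambda>d. {d, edge M d}) ` darts M) + 2 * card (components M)"

datatype side = Inside | Outside

text \<open>
  Collapsing the complementary disc of a tangle to a point yields a map on the sphere with one
  additional vertex, at which all boundary points meet.  The equator is oriented as the boundary
  of the inside disc.  So the boundary points occur counterclockwise around the collapsed inside
  disc (tangle outside), and clockwise around the collapsed outside disc (tangle inside).
\<close>

definition collapse :: "side \<Rightarrow> 'd diagram \<Rightarrow> 'd diagram" where
  "collapse S T = T\<lparr>rot := (\<lambda>d. if d \<in> set (ends T)
       then cycle_of_list (case S of Inside \<Rightarrow> rev (ends T) | Outside \<Rightarrow> ends T) d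
       else rot T d),
     ends := []\<rparr>"

definition tangle :: "side \<Rightarrow> 'd diagram \<Rightarrow> bool" where
  "tangle S T \<longleftrightarrow> diagram T \<and> planar_map (collapse S T)"

definition link_diagram :: "'d diagram \<Rightarrow> bool" where
  "link_diagram L \<longleftrightarrow> diagram L \<and> ends L = [] \<and> planar_map L"

subsection \<open>Orientations\<close>

text \<open>
  An orientation is given by the set of those ends at which the strand leaves the crossing or
  bivalent point and enters the edge.
\<close>

definition orientation :: "'d diagram \<Rightarrow> 'd set \<Rightarrow> bool" where
  "orientation T tails \<longleftrightarrow> tails \<subseteq> darts T \<and>
     (\<forall>d\<in>darts T. d \<in> tails \<longleftrightarrow> edge T d \<notin> tails) \<and>
     (\<forall>d\<in>darts T - set (ends T).
        d \<in> tails \<longleftrightarrow> (if rot T (rot T d) = d then rot T d else rot T (rot T d)) \<notin> tails)"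

text \<open>A crossing is positive if rotating the directed over-strand counterclockwise, by the angle
  less than a half-turn, yields the directed under-strand.\<close>

definition positive :: "'d set \<Rightarrow> 'd diagram \<Rightarrow> 'd set \<Rightarrow> bool" where
  "positive tails T c \<longleftrightarrow> (\<forall>d\<in>c \<inter> over T. d \<in> tails \<longleftrightarrow> rot T d \<in> tails)"

definition n_plus :: "'d set \<Rightarrow> 'd diagram \<Rightarrow> nat" where
  "n_plus tails T = card {c \<in> crossings T. positive tails T c}"

definition n_minus :: "'d set \<Rightarrow> 'd diagram \<Rightarrow> nat" where
  "n_minus tails T = card {c \<in> crossings T. \<not> positive tails T c}"

subsection \<open>Resolutions\<close>

text \<open>
  The crossings in the domain of \<open>\<rho>\<close> are replaced by their \<open>0\<close>- or \<open>1\<close>-resolution, each of which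
  puts two bivalent points in place of the crossing.  Rotating the over-strand counterclockwise
  sweeps out the two corners between an over-end \<open>d\<close> and \<open>rot d\<close>.  The \<open>0\<close>-resolution joins the
  regions in these corners, so its arcs connect each over-end with the preceding under-end; the
  arcs of the \<open>1\<close>-resolution connect each over-end with the following under-end.  At a crossing,
  \<open>rot (rot (rot d))\<close> is the end preceding \<open>d\<close>.
\<close>

definition resolve :: "('d set \<rightharpoonup> nat) \<Rightarrow> 'd diagram \<Rightarrow> 'd diagram" where
  "resolve \<rho> T = T\<lparr>rot := (\<lambda>d. case \<rho> (vertex T d) of
         None \<Rightarrow> rot T d
       | Some k \<Rightarrow> if d \<in> over T \<longleftrightarrow> k = 1 then rot T d else rot T (rot T (rot T d))),
     over := over T - \<Union>(dom \<rho>)\<rparr>"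

section \<open>The Jones polynomial\<close>

text \<open>
  The group ring of the integers is the ring of integral Laurent polynomials in the variable
  \<open>q\<^sup>1\<^sup>/\<^sup>2\<close>.  The monomial \<open>q\<^sup>r\<close>, with \<open>2 * r\<close> an integer, is \<open>q_pow r\<close>.
\<close>

type_synonym laurent = "int \<Rightarrow>\<^sub>0 int"

definition q_pow :: "rat \<Rightarrow> laurent" where
  "q_pow r = Poly_Mapping.single \<lfloor>2 * r\<rfloor> 1"

definition circle :: "'d diagram \<Rightarrow> bool" where
  "circle U \<longleftrightarrow> link_diagram U \<and> crossings U = {} \<and> card (components U) = 1"

definition disjoint_union :: "'d diagram \<Rightarrow> 'd diagram \<Rightarrow> 'd diagram" where
  "disjoint_union K L =
     \<lparr>darts = darts K \<union> darts L,
      edge = (\<lambda>d. if d \<in> darts K then edge K d else edge L d),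
      rot = (\<lambda>d. if d \<in> darts K then rot K d else rot L d),
      over = over K \<union> over L,
      ends = []\<rparr>"

text \<open>The first conjunct only fixes a value outside the intended domain, for uniqueness.\<close>

definition is_unnormalized_jones :: "('d diagram \<Rightarrow> laurent) \<Rightarrow> bool" where
  "is_unnormalized_jones J \<longleftrightarrow>
     (\<forall>L. \<not> link_diagram L \<longrightarrow> J L = 0) \<and>
     (\<forall>L. link_diagram L \<and> darts L = {} \<longrightarrow> J L = 1) \<and>
     (\<forall>U. circle U \<longrightarrow> J U = q_pow 1 + q_pow (- 1)) \<and>
     (\<forall>L U. link_diagram L \<and> circle U \<and> darts L \<inter> darts U = {} \<longrightarrow>
        J (disjoint_union L U) = (q_pow 1 + q_pow (- 1)) * J L) \<and>
     (\<forall>L. \<forall>c\<in>crossings L. link_diagram L \<longrightarrow>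
        J L = J (resolve [c \<mapsto> 0] L) - q_pow 1 * J (resolve [c \<mapsto> 1] L))"

definition unnormalized_jones :: "'d diagram \<Rightarrow> laurent" where
  "unnormalized_jones = (THE J. is_unnormalized_jones J)"

definition jones :: "'d set \<Rightarrow> 'd diagram \<Rightarrow> laurent" where
  "jones tails L =
     (- 1) ^ n_minus tails L * q_pow (of_nat (n_plus tails L) - 2 * of_nat (n_minus tails L)) *
     unnormalized_jones L"

section \<open>Decorated cleaved links\<close>

text \<open>
  A planar matching of boundary points, up to isotopy fixing these points: a crossingless
  partition of them into pairs.
\<close>

definition planar_matching :: "'p list \<Rightarrow> 'p set set \<Rightarrow> bool" where
  "planar_matching ps m \<longleftrightarrow> partition_on (set ps) m \<and> (\<forall>b\<in>m. card b = 2) \<and>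
     \<not> (\<exists>i j k l. i < j \<and> j < k \<and> k < l \<and> l < length ps \<and>
          {ps ! i, ps ! k} \<in> m \<and> {ps ! j, ps ! l} \<in> m)"

text \<open>
  The list \<open>points\<close> consists of the intersections of the curves with the equator, in the order of
  the oriented equator starting from the marked point; \<open>inner\<close> and \<open>outer\<close> are the matchings
  given by the arcs of the curves in the two discs.  A curve is represented by the set of its
  intersections with the equator.
\<close>

record 'p cleaved =
  points :: "'p list"
  inner :: "'p set set"
  outer :: "'p set set"
  decoration :: "'p set \<rightharpoonup> int"

definition curves :: "'p cleaved \<Rightarrow> 'p set set" where
  "curves C = set (points C) //
     {(p, p'). \<exists>b\<in>inner C \<union> outer C. p \<in> b \<and> p' \<in> b}\<^sup>*"

definition cleaved_link :: "nat \<Rightarrow> 'p cleaved \<Rightarrow> bool" where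
  "cleaved_link n C \<longleftrightarrow> distinct (points C) \<and> length (points C) = 2 * n \<and>
     planar_matching (points C) (inner C) \<and> planar_matching (points C) (outer C) \<and>
     dom (decoration C) = curves C \<and> ran (decoration C) \<subseteq> {1, - 1}"

text \<open>
  An orientation-preserving diffeomorphism of spheres that respects the inside and outside discs
  preserves the orientation of the equator; as it also preserves the marked point, it preserves
  the order of the points.
\<close>

definition cleaved_equiv :: "'p cleaved \<Rightarrow> 'p cleaved \<Rightarrow> bool" where
  "cleaved_equiv C C' \<longleftrightarrow>
     (\<exists>f. inj_on f (set (points C)) \<and> points C' = map f (points C) \<and>
        inner C' = (`) f ` inner C \<and> outer C' = (`) f ` outer C \<and>
        (\<forall>c\<in>curves C. decoration C' (f ` c) = decoration C c))"

definition cleaved_class :: "nat \<Rightarrow> 'p cleaved \<Rightarrow> 'p cleaved set" where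
  "cleaved_class n C = {C'. cleaved_link n C' \<and> cleaved_equiv C C'}"

definition CL :: "nat \<Rightarrow> 'p cleaved set set" where
  "CL n = cleaved_class n ` {C. cleaved_link n C}"

definition I_module :: "nat \<Rightarrow> ('p cleaved set \<Rightarrow>\<^sub>0 laurent) set" where
  "I_module n = {v. Poly_Mapping.keys v \<subseteq> CL n}"

section \<open>Decorated resolutions of tangles\<close>

text \<open>The arcs of the matching \<open>m\<close> become bivalent points of the glued diagram.\<close>

definition glue :: "'d diagram \<Rightarrow> 'd set set \<Rightarrow> 'd diagram" where
  "glue T m = T\<lparr>rot := (\<lambda>d. if d \<in> set (ends T) then THE d'. {d, d'} \<in> m else rot T d),
     ends := []\<rparr>"

definition circles :: "'d diagram \<Rightarrow> ('d set \<rightharpoonup> nat) \<Rightarrow> 'd set set \<Rightarrow> 'd set set" where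
  "circles T \<rho> m = components (glue (resolve \<rho> T) m)"

definition cut_circles :: "'d diagram \<Rightarrow> ('d set \<rightharpoonup> nat) \<Rightarrow> 'd set set \<Rightarrow> 'd set set" where
  "cut_circles T \<rho> m = {C \<in> circles T \<rho> m. C \<inter> set (ends T) \<noteq> {}}"

definition free_circles :: "'d diagram \<Rightarrow> ('d set \<rightharpoonup> nat) \<Rightarrow> 'd set set \<Rightarrow> 'd set set" where
  "free_circles T \<rho> m = {C \<in> circles T \<rho> m. C \<inter> set (ends T) = {}}"

type_synonym 'd resolution = "('d set \<rightharpoonup> nat) \<times> 'd set set \<times> ('d set \<rightharpoonup> int)"

definition decorated_resolutions :: "'d diagram \<Rightarrow> 'd resolution set" where
  "decorated_resolutions T = {(\<rho>, m, s).
     dom \<rho> = crossings T \<and> ran \<rho> \<subseteq> {0, 1} \<and> planar_matching (ends T) m \<and>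
     dom s = circles T \<rho> m \<and> ran s \<subseteq> {1, - 1}}"

definition h_grading :: "'d set \<Rightarrow> 'd diagram \<Rightarrow> ('d set \<rightharpoonup> nat) \<Rightarrow> int" where
  "h_grading tails T \<rho> = (\<Sum>c\<in>crossings T. int (the (\<rho> c))) - int (n_minus tails T)"

fun I_grading :: "'d set \<Rightarrow> 'd diagram \<Rightarrow> 'd resolution \<Rightarrow> rat" where
  "I_grading tails T (\<rho>, m, s) =
     of_int (h_grading tails T \<rho>) + (\<Sum>C\<in>free_circles T \<rho> m. of_int (the (s C)))
     + 1 / 2 * (\<Sum>C\<in>cut_circles T \<rho> m. of_int (the (s C)))
     + (of_nat (n_plus tails T) - of_nat (n_minus tails T))"

definition arcs :: "'d diagram \<Rightarrow> 'd set set" where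
  "arcs T = {{a, b} |a b. a \<in> set (ends T) \<and> b \<in> set (ends T) \<and> a \<noteq> b \<and> (a, b) \<in> joined T}"

fun boundary :: "side \<Rightarrow> nat \<Rightarrow> 'd diagram \<Rightarrow> 'd resolution \<Rightarrow> 'd cleaved set" where
  "boundary S n T (\<rho>, m, s) = cleaved_class n
     \<lparr>points = ends T,
      inner = (case S of Inside \<Rightarrow> arcs (resolve \<rho> T) | Outside \<Rightarrow> m),
      outer = (case S of Inside \<Rightarrow> m | Outside \<Rightarrow> arcs (resolve \<rho> T)),
      decoration = (\<lambda>c. if c \<in> (\<lambda>C. C \<inter> set (ends T)) ` cut_circles T \<rho> m
        then s (THE C. C \<in> cut_circles T \<rho> m \<and> C \<inter> set (ends T) = c) else None)\<rparr>"

fun weight :: "'d set \<Rightarrow> 'd diagram \<Rightarrow> 'd resolution \<Rightarrow> laurent" where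
  "weight tails T (\<rho>, m, s) =
     (if even (h_grading tails T \<rho>) then 1 else - 1) * q_pow (I_grading tails T (\<rho>, m, s))"

section \<open>Decategorifications\<close>

definition type_A :: "'d set \<Rightarrow> nat \<Rightarrow> 'd diagram \<Rightarrow> 'd cleaved set \<Rightarrow>\<^sub>0 laurent" where
  "type_A tails n T =
     (\<Sum>r\<in>decorated_resolutions T. Poly_Mapping.single (boundary Inside n T r) (weight tails T r))"

definition type_A_map :: "'d set \<Rightarrow> nat \<Rightarrow> 'd diagram \<Rightarrow> laurent \<Rightarrow> 'd cleaved set \<Rightarrow>\<^sub>0 laurent" where
  "type_A_map tails n T f = Poly_Mapping.map ((*) f) (type_A tails n T)"

definition type_D_basis :: "'d set \<Rightarrow> nat \<Rightarrow> 'd diagram \<Rightarrow> 'd cleaved set \<Rightarrow> laurent" where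
  "type_D_basis tails n T x =
     (\<Sum>r\<in>{r \<in> decorated_resolutions T. boundary Outside n T r = x}. weight tails T r)"

definition type_D :: "'d set \<Rightarrow> nat \<Rightarrow> 'd diagram \<Rightarrow> ('d cleaved set \<Rightarrow>\<^sub>0 laurent) \<Rightarrow> laurent" where
  "type_D tails n T v =
     (\<Sum>x\<in>Poly_Mapping.keys v. Poly_Mapping.lookup v x * type_D_basis tails n T x)"

section \<open>Decomposing a link diagram along an equator\<close>

text \<open>
  The intersections with the equator are bivalent points of \<open>L\<close>.  The set \<open>X\<close> consists of the
  ends inside, and \<open>es\<close> lists the ends directly inside the equator at these points, in the order
  of the equator from its marked point; the ends directly outside are their images under \<open>rot\<close>.
\<close>

definition inside_part :: "'d diagram \<Rightarrow> 'd set \<Rightarrow> 'd list \<Rightarrow> 'd diagram" where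
  "inside_part L X es = L\<lparr>darts := X, over := over L \<inter> X, ends := es\<rparr>"

definition outside_part :: "'d diagram \<Rightarrow> 'd set \<Rightarrow> 'd list \<Rightarrow> 'd diagram" where
  "outside_part L X es =
     L\<lparr>darts := darts L - X, over := over L - X, ends := map (rot L) es\<rparr>"

text \<open>The last conjunct says that \<open>L\<close> and the equator are drawn together in the sphere.\<close>

definition equator :: "'d diagram \<Rightarrow> 'd set \<Rightarrow> 'd list \<Rightarrow> bool" where
  "equator L X es \<longleftrightarrow> X \<subseteq> darts L \<and> distinct es \<and> set es \<subseteq> X \<and>
     (\<forall>d\<in>darts L. edge L d \<in> X \<longleftrightarrow> d \<in> X) \<and>
     (\<forall>d\<in>set es. rot L d \<notin> X \<and> rot L (rot L d) = d) \<and>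
     (\<forall>d\<in>darts L - set es - rot L ` set es. rot L d \<in> X \<longleftrightarrow> d \<in> X) \<and>
     tangle Inside (inside_part L X es) \<and> tangle Outside (outside_part L X es)"

end

theory Submission
  imports Defs
begin

text \<open>
  The unnormalized Jones polynomial is the state sum over all resolutions.  This sum satisfies the
  defining relations because resolving a crossing preserves planarity, and the relations determine
  it because a crossingless diagram is a disjoint union of circles.

  A decoration of the circles of a state expands each factor \<open>q + q\<^sup>-\<^sup>1\<close>.  Cutting a decorated state
  along the equator gives a decorated resolution of each tangle, closed by the arcs of the other
  one.  Conversely, two decorated resolutions with the same boundary fit together: equality of the
  boundaries means exactly that each matching is given by the arcs of the other resolution and that
  the decorations of the cut circles agree.  The weights multiply, the two halves of the
  contribution of a cut circle adding up.

  Planarity enters twice: resolutions have to be planar, and the arcs of a resolved tangle have to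
  form a crossingless matching.  Both follow from one fact on combinatorial maps, a vertex rotation
  \<open>s\<close> and an edge involution \<open>e\<close> on the darts.  Composing \<open>s\<close> with a transposition of two darts at
  one vertex splits this vertex.  This never lowers \<open>V + F - 2 * C\<close>, which is therefore bounded by its
  value for \<open>s = id\<close>, the number of edges.  So splitting preserves genus zero, and it disconnects the
  map if the two corners belong to one face.
\<close>

section \<open>Cycles of permutations and genus\<close>

text \<open>Planarity is available only as a number, so no Jordan curve argument applies: that an
  arc separates has to come out of counting. Vertices, faces and components are all classes of a
  relation on darts, and a transposition of two darts changes each count by at most one. Splitting a
  vertex raises \<open>V\<close> by one. If \<open>F\<close> drops, two faces have merged, and the
  common face still connects both halves of the vertex, so \<open>C\<close> is unchanged. If
  \<open>F\<close> grows, \<open>C\<close> may grow by one. A map that already attains the maximum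
  has no room for a larger value, so in the second case \<open>C\<close> must grow; this replaces
  the separation argument.

  On the algebraic side, the matching that closes a tangle is abstract data, not a part of the link.
  It is pinned down because an equivalence of cleaved links preserves the ordered points of the
  equator, so its action on these points is forced. Half-integral exponents occur only in the
  separate weights of the two tangles. As \<open>q_pow\<close> rounds its exponent, splitting a
  power into a product needs a proof that twice one of the exponents is an integer.\<close>

definition conn :: "('a \<times> 'a) set \<Rightarrow> ('a \<times> 'a) set" where
  "conn G = (G \<union> G\<inverse>)\<^sup>*"

lemma conn_refl [simp]: "(x, x) \<in> conn G"
  by (simp add: conn_def)

lemma conn_sym: "(x, y) \<in> conn G \<Longrightarrow> (y, x) \<in> conn G"
  unfolding conn_def
  by (metis converse_Un converse_converse rtrancl_converseI sup_commute)

lemma conn_trans: "(x, y) \<in> conn G \<Longrightarrow> (y, z) \<in> conn G \<Longrightarrow> (x, z) \<in> conn G"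
  unfolding conn_def by (rule rtrancl_trans)

lemma conn_base: "(x, y) \<in> G \<Longrightarrow> (x, y) \<in> conn G"
  unfolding conn_def by blast

lemma equiv_conn: "equiv UNIV (conn G)"
  by (intro equivI refl_onI symI transI) (auto intro: conn_sym conn_trans)

lemma conn_least:
  assumes "G \<subseteq> conn H"
  shows "conn G \<subseteq> conn H"
proof -
  have "G \<union> G\<inverse> \<subseteq> conn H" using assms by (auto intro: conn_sym)
  then have "(G \<union> G\<inverse>)\<^sup>* \<subseteq> (conn H)\<^sup>*" by (rule rtrancl_mono)
  also have "(conn H)\<^sup>* = conn H" unfolding conn_def by (rule rtrancl_idemp)
  finally show ?thesis by (subst conn_def)
qed

lemma conn_mono: "G \<subseteq> H \<Longrightarrow> conn G \<subseteq> conn H"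
  by (rule conn_least) (auto intro: conn_base)

lemma conn_eqI: "G \<subseteq> conn H \<Longrightarrow> H \<subseteq> conn G \<Longrightarrow> conn G = conn H"
  by (simp add: conn_least subset_antisym)

lemma conn_induct [consumes 1, case_names base fwd bwd]:
  assumes "(x, y) \<in> conn G" "P x"
    and "\<And>y z. P y \<Longrightarrow> (y, z) \<in> G \<Longrightarrow> P z"
    and "\<And>y z. P y \<Longrightarrow> (z, y) \<in> G \<Longrightarrow> P z"
  shows "P y"
  using assms(1) unfolding conn_def
proof (induction rule: rtrancl_induct)
  case base
  show ?case by (rule assms(2))
next
  case (step y z)
  then show ?case using assms(3)[of y z] assms(4)[of y z] by blast
qed

lemma conn_in:
  assumes "(x, y) \<in> conn G" "G \<subseteq> A \<times> A" "x \<in> A"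
  shows "y \<in> A"
  using assms(1) by (induction rule: conn_induct) (use assms in auto)

lemma conn_class_eq_iff: "conn G `` {x} = conn G `` {y} \<longleftrightarrow> (x, y) \<in> conn G"
  by (rule eq_equiv_class_iff[OF equiv_conn UNIV_I UNIV_I])

lemma quotient_eq_image: "A // r = (\<lambda>x. r `` {x}) ` A"
  by (auto simp: quotient_def)

text \<open>A path that uses the new pair reaches \<open>a\<close> or \<open>b\<close> by old steps
  from either end, and between its first and last use nothing else matters. The proof checks that
  the right-hand side survives the extension of a path by one step.\<close>

lemma conn_insert_iff:
  "(x, y) \<in> conn (insert (a, b) G) \<longleftrightarrow>
     (x, y) \<in> conn G \<or> ((x, a) \<in> conn G \<or> (x, b) \<in> conn G) \<and> ((y, a) \<in> conn G \<or> (y, b) \<in> conn G)"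
  (is "_ \<longleftrightarrow> ?R y")
proof
  have step: "?R z" if "?R y" "y = a \<and> z = b \<or> y = b \<and> z = a \<or> (z, y) \<in> conn G" for y z
    using that(2)
  proof (elim disjE conjE)
    assume zy: "(z, y) \<in> conn G"
    from that(1) show ?thesis
    proof (elim disjE)
      assume "(x, y) \<in> conn G"
      then show ?thesis using conn_trans[OF _ conn_sym[OF zy]] by blast
    next
      assume "((x, a) \<in> conn G \<or> (x, b) \<in> conn G) \<and> ((y, a) \<in> conn G \<or> (y, b) \<in> conn G)"
      then show ?thesis using conn_trans[OF zy] by blast
    qed
  qed (use that(1) in auto)
  assume "(x, y) \<in> conn (insert (a, b) G)"
  then show "?R y"
  proof (induction rule: conn_induct)
    case base
    then show ?case by simp
  next
    case (fwd y z)
    show ?case by (rule step[OF fwd(1)]) (use fwd(2) conn_sym[OF conn_base, of y z G] in auto)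
  next
    case (bwd y z)
    show ?case by (rule step[OF bwd(1)]) (use bwd(2) conn_base[of z y G] in auto)
  qed
next
  have sub: "conn G \<subseteq> conn (insert (a, b) G)" by (rule conn_mono) auto
  have ab: "(a, b) \<in> conn (insert (a, b) G)" by (auto intro: conn_base)
  assume "?R y"
  then show "(x, y) \<in> conn (insert (a, b) G)"
  proof (elim disjE conjE)
    have N: "(u, v) \<in> conn (insert (a, b) G)" if "(u, v) \<in> conn G" for u v using sub that by blast
    note I = N N[THEN conn_sym] ab conn_sym[OF ab]
    show "(x, y) \<in> conn (insert (a, b) G)" if "(x, y) \<in> conn G" using that by (rule N)
    show "(x, y) \<in> conn (insert (a, b) G)" if "(x, a) \<in> conn G" "(y, a) \<in> conn G"
      using that by (meson I conn_trans)
    show "(x, y) \<in> conn (insert (a, b) G)" if "(x, a) \<in> conn G" "(y, b) \<in> conn G"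
      using that by (meson I conn_trans)
    show "(x, y) \<in> conn (insert (a, b) G)" if "(x, b) \<in> conn G" "(y, a) \<in> conn G"
      using that by (meson I conn_trans)
    show "(x, y) \<in> conn (insert (a, b) G)" if "(x, b) \<in> conn G" "(y, b) \<in> conn G"
      using that by (meson I conn_trans)
  qed
qed

text \<open>The new pair merges the classes of \<open>a\<close> and \<open>b\<close> and leaves
  every other class as it is. All later changes of the numbers of vertices, faces and components are
  obtained from this count.\<close>

lemma card_quotient_insert:
  assumes "finite A" "a \<in> A" "b \<in> A"
  shows "card (A // conn G) = card (A // conn (insert (a, b) G)) + (if (a, b) \<in> conn G then 0 else 1)"
proof (cases "(a, b) \<in> conn G")
  case True
  then have "conn (insert (a, b) G) = conn G"
    by (intro conn_eqI) (auto intro: conn_base)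
  with True show ?thesis by simp
next
  case False
  let ?C = "\<lambda>x. conn G `` {x}" and ?N = "\<lambda>x. conn (insert (a, b) G) `` {x}"
  have N: "?N x = (if x \<in> ?C a \<union> ?C b then ?C a \<union> ?C b else ?C x)" for x
    by (auto simp: conn_insert_iff intro: conn_sym conn_trans)
  have img: "A // conn (insert (a, b) G) = insert (?C a \<union> ?C b) (A // conn G - {?C a, ?C b})"
  proof (intro equalityI subsetI)
    fix X assume "X \<in> A // conn (insert (a, b) G)"
    then obtain x where x: "x \<in> A" "X = ?N x" by (auto simp: quotient_eq_image)
    show "X \<in> insert (?C a \<union> ?C b) (A // conn G - {?C a, ?C b})"
    proof (cases "x \<in> ?C a \<union> ?C b")
      case True
      then show ?thesis using N[of x] x by simp
    next
      case F: False
      then have "X = ?C x" using N[of x] x by simp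
      moreover have "?C x \<noteq> ?C a" "?C x \<noteq> ?C b"
        using F by (auto simp: conn_class_eq_iff intro: conn_sym)
      ultimately show ?thesis using x by (auto simp: quotient_eq_image)
    qed
  next
    fix X assume "X \<in> insert (?C a \<union> ?C b) (A // conn G - {?C a, ?C b})"
    then consider "X = ?C a \<union> ?C b" | x where "x \<in> A" "X = ?C x" "?C x \<noteq> ?C a" "?C x \<noteq> ?C b"
      by (auto simp: quotient_eq_image)
    then show "X \<in> A // conn (insert (a, b) G)"
    proof cases
      case 1
      then have "X = ?N a" using N[of a] by simp
      then show ?thesis using assms by (auto simp: quotient_eq_image)
    next
      case 2
      then have "x \<notin> ?C a \<union> ?C b" by (auto simp: conn_class_eq_iff intro: conn_sym)
      then have "X = ?N x" using 2 N[of x] by simp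
      then show ?thesis using 2 by (auto simp: quotient_eq_image)
    qed
  qed
  have notin: "?C a \<union> ?C b \<notin> A // conn G - {?C a, ?C b}"
  proof
    assume "?C a \<union> ?C b \<in> A // conn G - {?C a, ?C b}"
    then have "?C a \<union> ?C b \<in> ?C ` A" and ne: "?C a \<union> ?C b \<noteq> ?C a"
      unfolding quotient_eq_image by blast+
    then obtain x where x: "?C a \<union> ?C b = ?C x" by (elim imageE)
    have "a \<in> ?C a \<union> ?C b" by simp
    then have "a \<in> ?C x" by (simp only: x)
    moreover have "?C x \<noteq> ?C a" using ne unfolding x .
    ultimately
show False by (simp add: conn_class_eq_iff)
  qed
  have fin: "finite (A // conn G)" using assms by (simp add: quotient_eq_image)
  have sub: "{?C a, ?C b} \<subseteq> A // conn G" using assms by (auto simp: quotient_eq_image)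
  have ne: "?C a \<noteq> ?C b" using False by (simp add: conn_class_eq_iff)
  have "card (A // conn G) \<ge> 2" using card_mono[OF fin sub] ne by simp
  then show ?thesis
    using False fin sub ne notin by (simp add: img card_Diff_subset)
qed

section \<open>Cycles of a permutation as classes, and the effect of a transposition\<close>

definition gr :: "('a \<Rightarrow> 'a) \<Rightarrow> 'a set \<Rightarrow> ('a \<times> 'a) set" where
  "gr f A = {(x, f x) |x. x \<in> A}"

text \<open>For a permutation of \<open>A\<close> this is the number of its cycles. Counting classes
  instead of orbits lets \<open>card_quotient_insert\<close> apply to cycles and components
  alike.\<close>

definition cyc :: "('a \<Rightarrow> 'a) \<Rightarrow> 'a set \<Rightarrow> nat" where
  "cyc f A = card (A // conn (gr f A))"

lemma gr_base: "x \<in> A \<Longrightarrow> (x, f x) \<in> conn (gr f A)"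
  by (auto simp: gr_def intro: conn_base)

lemma gr_cong: "(\<And>x. x \<in> A \<Longrightarrow> f x = g x) \<Longrightarrow> gr f A = gr g A"
  by (auto simp: gr_def)

lemma cyc_cong: "(\<And>x. x \<in> A \<Longrightarrow> f x = g x) \<Longrightarrow> cyc f A = cyc g A"
  using gr_cong[of A f g] by (simp add: cyc_def)

text \<open>Backward steps cause no trouble: an injective map that sends a finite set into itself
  permutes it, so the preimage of a point of \<open>Q\<close> lies in \<open>Q\<close> as
  well.\<close>

lemma conn_gr_closed:
  assumes "(x, y) \<in> conn (gr f A)" "x \<in> Q" "Q \<subseteq> A" "finite Q" "inj_on f A" "f ` Q \<subseteq> Q"
  shows "y \<in> Q"
  using assms(1)
proof (induction rule: conn_induct)
  case base
  then show ?case using assms by simp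
next
  case (fwd y z)
  then show ?case using assms by (auto simp: gr_def)
next
  case (bwd y z)
  have "f ` Q = Q" using assms by (meson card_seteq card_image card_mono inj_on_subset endo_inj_surj)
  then show ?case using bwd assms by (auto simp: gr_def dest: inj_onD)
qed

lemma orbit_subset: "bij_betw f A A \<Longrightarrow> x \<in> A \<Longrightarrow> orbit f x \<subseteq> A"
proof
  fix y assume f: "bij_betw f A A" "x \<in> A" and "y \<in> orbit f x"
  from this(3) show "y \<in> A" by induction (use f bij_betwE in blast)+
qed

lemma orbit_eq_conn:
  assumes "bij_betw f A A" "finite A" "x \<in> A"
  shows "orbit f x = conn (gr f A) `` {x}"
proof -
  have sub: "orbit f x \<subseteq> A" by (rule orbit_subset[OF assms(1,3)])
  have closed: "f ` orbit f x \<subseteq> orbit f x" by (auto intro: orbit.step)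
  \<comment> \<open>\<open>orbit f x\<close> is generated from \<open>f x\<close>, not from
    \<open>x\<close>; hence the start at \<open>f x\<close>, and one extra step from
    \<open>x\<close> later.\<close>
  have *: "y \<in> orbit f x" if "(f x, y) \<in> conn (gr f A)" for y
    using conn_gr_closed[OF that _ sub finite_subset[OF sub assms(2)] _ closed] assms
    by (auto intro: orbit.base simp: bij_betw_def)
  have "y \<in> conn (gr f A) `` {x}" if "y \<in> orbit f x" for y
    using that
  proof induction
    case base
    then show ?case using gr_base assms(3) by auto
  next
    case (step y)
    have "y \<in> A" using step sub by auto
    then show ?case using step.IH gr_base[of y A f] conn_trans by fastforce
  qed
  moreover have "y \<in> orbit f x" if "y \<in> conn (gr f A) `` {x}" for y
    using * that gr_base[OF assms(3), of f] by (auto intro: conn_trans conn_sym)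
  ultimately show ?thesis by blast
qed

lemma card_orbits:
  assumes "bij_betw f A A" "finite A"
  shows "card (orbit f ` A) = cyc f A"
proof -
  have "orbit f ` A = A // conn (gr f A)"
    using orbit_eq_conn[OF assms] by (auto simp: quotient_eq_image)
  then show ?thesis by (simp add: cyc_def)
qed

lemma bij_betw_transpose:
  assumes "bij_betw f A A" "a \<in> A" "b \<in> A"
  shows "bij_betw (f \<circ> transpose a b) A A"
proof (rule bij_betw_trans[OF _ assms(1)])
  show "bij_betw (transpose a b) A A"
    by (rule permutes_imp_bij[OF permutes_swap_id[OF assms(2,3)]])
qed

text \<open>Composing with the transposition exchanges the successors of \<open>a\<close> and
  \<open>b\<close>. If both lie on one cycle, it falls apart into two; if they lie on different
  cycles, these are joined. One direction exhibits a set closed under the new map that separates the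
  points, the other is a pigeonhole argument.\<close>

lemma conn_transpose_xor:
  assumes f: "bij_betw f A A" and fin: "finite A" and ab: "a \<in> A" "b \<in> A" "a \<noteq> b"
  shows "(a, b) \<in> conn (gr (f \<circ> transpose a b) A) \<longleftrightarrow> (a, b) \<notin> conn (gr f A)"
proof
  let ?g = "f \<circ> transpose a b"
  have g: "bij_betw ?g A A" using bij_betw_transpose assms by metis
  have injf: "inj_on f A" and injg: "inj_on ?g A" using f g by (auto simp: bij_betw_def)
  have fA: "f x \<in> A" if "x \<in> A" for x using f that bij_betwE by blast
  have gA: "?g x \<in> A" if "x \<in> A" for x using g that bij_betwE by blast
  {
    assume cg: "(a, b) \<in> conn (gr ?g A)"
    show "(a, b) \<notin> conn (gr f A)"
    proof
      assume "(a, b) \<in> conn (gr f A)"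
      then have "b \<in> orbit f a" using orbit_eq_conn[OF f fin ab(1)] by simp
      then have "\<exists>n. (f ^^ n) a = b" by (auto simp: orbit_altdef)
      then obtain k where k: "(f ^^ k) a = b" "\<And>j. j < k \<Longrightarrow> (f ^^ j) a \<noteq> b"
        using LeastI_ex[of "\<lambda>n. (f ^^ n) a = b"] not_less_Least[of _ "\<lambda>n. (f ^^ n) a = b"] by blast
      have "k \<noteq> 0" using k(1) ab(3) by (intro notI) simp
      \<comment> \<open>The piece of the cycle after \<open>a\<close> up to and including
        \<open>b\<close>. The new map sends \<open>b\<close> to \<open>f a\<close>, so it closes
        this piece up without reaching \<open>a\<close>; minimality of \<open>k\<close> keeps
        \<open>a\<close> out of it.\<close>
      define Q where "Q = {(f ^^ j) a |j. 1 \<le> j \<and> j \<le> k}"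
      have itA: "(f ^^ j) a \<in> A" for j by (induction j) (use ab fA in auto)
      have QA: "Q \<subseteq> A" using itA by (auto simp: Q_def)
      have aQ: "a \<notin> Q"
      proof
        assume "a \<in> Q"
        then obtain j where j: "(f ^^ j) a = a" "1 \<le> j" "j \<le> k" unfolding Q_def by force
        then have "(f ^^ (k - j)) a = (f ^^ (k - j)) ((f ^^ j) a)" by simp
        also have "\<dots> = b" using k(1) j(3)
          by (metis comp_apply funpow_add le_add_diff_inverse2)
        finally show False using k(2)[of "k - j"] j \<open>k \<noteq> 0\<close> by simp
      qed
      have bQ: "b \<in> Q" using k(1) \<open>k \<noteq> 0\<close> by (auto simp: Q_def intro!: exI[of _ k])
      have "?g ` Q \<subseteq> Q"
      proof
        fix y assume "y \<in> ?g ` Q"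
        then obtain j where j: "y = ?g ((f ^^ j) a)" "1 \<le> j" "j \<le> k" by (auto simp: Q_def)
        show "y \<in> Q"
        proof (cases "j = k")
          case True
          then have "y = (f ^^ 1) a" using j k(1) by simp
          moreover have "1 \<le> k" using \<open>k \<noteq> 0\<close> by simp
          ultimately show ?thesis unfolding Q_def by blast
        next
          case False
          then have "(f ^^ j) a \<noteq> b" using k(2)[of j] j(3) by simp
          moreover have "(f ^^ j) a \<noteq> a" using aQ j(2,3) by (auto simp: Q_def)
          ultimately have "y = (f ^^ (Suc j)) a" using j(1) by simp
          moreover have "1 \<le> Suc j" "Suc j \<le> k" using j(3) False by simp_all
          ultimately show ?thesis unfolding Q_def by blast
        qed
      qed
      then have "a \<in> Q"
        using conn_gr_closed[OF conn_sym[OF cg] bQ QA finite_subset[OF QA fin] injg] by blast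
      with aQ show False by simp
    qed
  }
  {
    assume cf: "(a, b) \<notin> conn (gr f A)"
    show "(a, b) \<in> conn (gr ?g A)"
    proof (rule ccontr)
      assume cg: "(a, b) \<notin> conn (gr ?g A)"
      \<comment> \<open>If \<open>a\<close> and \<open>b\<close> were separated by both maps, the
        new map would send \<open>b\<close> and all of \<open>Q\<close> into \<open>Q\<close>,
        although \<open>b\<close> is not in \<open>Q\<close>. For an injective map on a finite set
        this is impossible.\<close>
      define Q where "Q = A \<inter> conn (gr f A) `` {a} \<inter> conn (gr ?g A) `` {b}"
      have bQ: "b \<notin> Q" using cf by (auto simp: Q_def)
      have aQ: "a \<notin> Q" using cg by (auto simp: Q_def intro: conn_sym)
      have cl: "?g x \<in> Q" if "x \<in> insert b Q" for x
      proof (cases "x = b")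
        case True
        then have "?g x = f a" by simp
        moreover have "(b, ?g b) \<in> conn (gr ?g A)" by (rule gr_base[OF ab(2)])
        moreover have "(a, f a) \<in> conn (gr f A)" by (rule gr_base[OF ab(1)])
        ultimately show ?thesis using True fA[OF ab(1)] by (simp add: Q_def)
      next
        case False
        then have x: "x \<in> Q" using that by simp
        then have xA: "x \<in> A" and "x \<noteq> a" using aQ by (auto simp: Q_def)
        then have "?g x = f x" using False by simp
        moreover have "(x, ?g x) \<in> conn (gr ?g A)" "(x, f x) \<in> conn (gr f A)"
          by (rule gr_base[OF xA])+
        ultimately show ?thesis using x gA[OF xA] by (auto simp: Q_def intro: conn_trans)
      qed
      have finQ: "finite Q" using fin by (simp add: Q_def)
      have inj: "inj_on ?g (insert b Q)" 
        by (rule inj_on_subset[OF injg]) (simp add: Q_def ab(2) le_infI1)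
      have "card (insert b Q) \<le> card Q" 
        by (rule card_inj_on_le[OF inj image_subsetI finQ]) (rule cl)
      then show False using bQ finQ by simp
    qed
  }
qed

text \<open>Once \<open>a\<close> and \<open>b\<close> are identified, exchanging their successors
  changes nothing. The extra relation \<open>H\<close> leaves room for the edges, so that the same
  fact serves cycles and components.\<close>

lemma conn_transpose_insert:
  assumes "a \<in> A" "b \<in> A"
  shows "conn (insert (a, b) (gr (f \<circ> transpose a b) A \<union> H)) = conn (insert (a, b) (gr f A \<union> H))"
    (is "conn ?G' = conn ?G")
proof -
  have *: "gr g A \<subseteq> conn (insert (a, b) (gr h A \<union> H))"
    if gh: "\<And>x. x \<in> A \<Longrightarrow> g x = h (transpose a b x)" for g h
  proof
    fix p assume "p \<in> gr g A"
    then obtain x where x: "x \<in> A" "p = (x, h (transpose a b x))" using gh by (auto simp: gr_def)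
    have ab: "(a, b) \<in> conn (insert (a, b) (gr h A \<union> H))" by (auto intro: conn_base)
    then have "(x, transpose a b x) \<in> conn (insert (a, b) (gr h A \<union> H))"
      by (cases "x = a"; cases "x = b") (auto intro: conn_sym)
    moreover have "transpose a b x \<in> A" using x(1) assms by (auto simp: transpose_def)
    then have "(transpose a b x, h (transpose a b x)) \<in> conn (insert (a, b) (gr h A \<union> H))"
      by (intro conn_base) (auto simp: gr_def)
    ultimately show "p \<in> conn (insert (a, b) (gr h A \<union> H))" using x(2) conn_trans by metis
  qed
  have rest: "insert (a, b) H \<subseteq> conn (insert (a, b) (gr h A \<union> H))" for h
    by (auto intro: conn_base)
  show ?thesis
    by (rule conn_eqI) (use *[of "f \<circ> transpose a b" f] *[of f "f \<circ> transpose a b"] rest[of f]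
        rest[of "f \<circ> transpose a b"] in \<open>auto simp: o_def\<close>)
qed

text \<open>After adding the pair \<open>(a, b)\<close> both permutations have the same classes, and
  in exactly one of them the pair was already connected.\<close>

lemma cyc_transpose:
  assumes f: "bij_betw f A A" and fin: "finite A" and ab: "a \<in> A" "b \<in> A" "a \<noteq> b"
  shows "int (cyc (f \<circ> transpose a b) A) = int (cyc f A) + (if (a, b) \<in> conn (gr f A) then 1 else - 1)"
  using card_quotient_insert[OF fin ab(1,2), of "gr f A"]
    card_quotient_insert[OF fin ab(1,2), of "gr (f \<circ> transpose a b) A"]
    conn_transpose_insert[OF ab(1,2), of f "{}"] conn_transpose_xor[OF assms]
  by (simp add: cyc_def)

text \<open>For a map with vertex rotation \<open>s\<close> and edge involution \<open>e\<close> this is \<open>V + F - 2 * C\<close>, where \<open>C\<close>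
  counts the components; it is at most the number of edges, with equality for genus zero.\<close>

definition excess :: "('a \<Rightarrow> 'a) \<Rightarrow> ('a \<Rightarrow> 'a) \<Rightarrow> 'a set \<Rightarrow> int" where
  "excess s e A = int (cyc s A) + int (cyc (s \<circ> e) A) - 2 * int (card (A // conn (gr s A \<union> gr e A)))"

text \<open>\<open>V\<close> grows by one and \<open>F\<close> changes by one in either direction. A
  loss in \<open>F\<close> forces \<open>C\<close> to stay the same, so the excess is unchanged; a
  gain in \<open>F\<close> leaves an increase by 2, which is cancelled exactly if \<open>C\<close>
  grows.\<close>

lemma split_vertex:
  assumes s: "bij_betw s A A" and e: "bij_betw e A A" and fin: "finite A"
    and ab: "a \<in> A" "b \<in> A" "a \<noteq> b" and same: "(a, b) \<in> conn (gr s A)"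
  defines "s' \<equiv> s \<circ> transpose a b"
  shows "excess s e A \<le> excess s' e A"
    and "excess s' e A \<le> excess s e A \<Longrightarrow> (s a, s b) \<in> conn (gr (s \<circ> e) A) \<Longrightarrow>
      (a, b) \<notin> conn (gr s' A \<union> gr e A)"
proof -
  obtain a' b' where a': "a' \<in> A" "e a' = a" and b': "b' \<in> A" "e b' = b"
    using e ab by (metis bij_betw_imp_surj_on imageE)
  have ne: "a' \<noteq> b'" using a' b' ab by auto
  have inj: "inj_on e A" using e by (simp add: bij_betw_def)
  have face: "bij_betw (s \<circ> e) A A" using bij_betw_trans[OF e s] .
  \<comment> \<open>Transposing \<open>a\<close> and \<open>b\<close> at the vertex is, for the face
    permutation, transposing the opposite ends \<open>a'\<close> and \<open>b'\<close> of their
    edges.\<close>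
  have eq: "(s' \<circ> e) x = ((s \<circ> e) \<circ> transpose a' b') x" if "x \<in> A" for x
    using that a' b' inj ne ab(3) by (auto simp: s'_def transpose_def dest: inj_onD)
  have cong: "gr (s' \<circ> e) A = gr ((s \<circ> e) \<circ> transpose a' b') A" by (rule gr_cong) (rule eq)
  have V: "int (cyc s' A) = int (cyc s A) + 1"
    using cyc_transpose[OF s fin ab] same by (simp add: s'_def)
  have F: "int (cyc (s' \<circ> e) A) = int (cyc (s \<circ> e) A) + (if (a', b') \<in> conn (gr (s \<circ> e) A) then 1 else - 1)"
    using cyc_transpose[OF face fin a'(1) b'(1) ne] by (simp add: cyc_def cong)
  have ins: "conn (insert (a, b) (gr s' A \<union> gr e A)) = conn (gr s A \<union> gr e A)"
  proof -
    have "conn (insert (a, b) (gr s' A \<union> gr e A)) = conn (insert (a, b) (gr s A \<union> gr e A))"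
      unfolding s'_def by (rule conn_transpose_insert[OF ab(1,2)])
    also have "\<dots> = conn (gr s A \<union> gr e A)"
      using same conn_mono[of "gr s A" "gr s A \<union> gr e A"]
      by (intro conn_eqI) (auto intro: conn_base)
    finally show ?thesis .
  qed
  have C: "card (A // conn (gr s' A \<union> gr e A)) = card (A // conn (gr s A \<union> gr e A)) +
      (if (a, b) \<in> conn (gr s' A \<union> gr e A) then 0 else 1)"
    using card_quotient_insert[OF fin ab(1,2), of "gr s' A \<union> gr e A"] by (simp add: ins)
  \<comment> \<open>Here two faces merge. Their common face passes through \<open>a'\<close> and
    \<open>b'\<close>, and walking along it uses only edges and the new rotation, so
    \<open>a\<close> and \<open>b\<close> remain connected.\<close>
  have sep: "(a, b) \<in> conn (gr s' A \<union> gr e A)" if "(a', b') \<notin> conn (gr (s \<circ> e) A)"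
  proof -
    have "(a', b') \<in> conn (gr (s' \<circ> e) A)"
      using conn_transpose_xor[OF face fin a'(1) b'(1) ne] that by (simp add: cong)
    moreover have "gr (s' \<circ> e) A \<subseteq> conn (gr s' A \<union> gr e A)"
    proof
      fix p assume "p \<in> gr (s' \<circ> e) A"
      then obtain x where x: "x \<in> A" "p = (x, s' (e x))" by (auto simp: gr_def)
      have "e x \<in> A" using x e bij_betwE by blast
      then have "(x, e x) \<in> conn (gr s' A \<union> gr e A)" "(e x, s' (e x)) \<in> conn (gr s' A \<union> gr e A)"
        using x by (auto simp: gr_def intro!: conn_base)
      then show "p \<in> conn (gr s' A \<union> gr e A)" using x conn_trans by metis
    qed
    ultimately have "(a', b') \<in> conn (gr s' A \<union> gr e A)" using conn_least by blast
    moreover have "(a', a) \<in> conn (gr s' A \<union> gr e A)" "(b', b) \<in> conn (gr s' A \<union> gr e A)"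
      using a' b' by (auto simp: gr_def intro!: conn_base)
    ultimately show ?thesis by (meson conn_sym conn_trans)
  qed
  show "excess s e A \<le> excess s' e A"
    using V F C sep by (auto simp: excess_def split: if_splits)
  \<comment> \<open>\<open>s a\<close> and \<open>s b\<close> are the successors of
    \<open>a'\<close> and \<open>b'\<close> on their faces. So the two darts share a face, which the
    splitting cuts in two; only a new component can then keep the excess from growing.\<close>
  assume le: "excess s' e A \<le> excess s e A" and "(s a, s b) \<in> conn (gr (s \<circ> e) A)"
  moreover have "(a', s a) \<in> conn (gr (s \<circ> e) A)" "(b', s b) \<in> conn (gr (s \<circ> e) A)"
    using a' b' gr_base[of a' A "s \<circ> e"] gr_base[of b' A "s \<circ> e"] by auto
  ultimately have "(a', b') \<in> conn (gr (s \<circ> e) A)" by (meson conn_sym conn_trans)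
  then show "(a, b) \<notin> conn (gr s' A \<union> gr e A)"
    using V F C le by (auto simp: excess_def split: if_splits)
qed

lemma cyc_le_card: "finite A \<Longrightarrow> cyc f A \<le> card A"
  unfolding cyc_def quotient_eq_image by (rule card_image_le)

lemma conn_Id: "G \<subseteq> Id \<Longrightarrow> conn G = Id"
proof -
  assume G: "G \<subseteq> Id"
  have "x = y" if "(x, y) \<in> conn G" for x y
    using that by (induction rule: conn_induct) (use G in auto)
  then show ?thesis by auto
qed

text \<open>Vertices are split until every dart is a vertex of its own, and the excess never
  decreases on the way. For \<open>s = id\<close> there are \<open>card A\<close> vertices, while
  faces and components are both the cycles of \<open>e\<close>.\<close>

theorem excess_le:
  assumes s: "bij_betw s A A" and e: "bij_betw e A A" and fin: "finite A"
  shows "excess s e A \<le> int (card A) - int (cyc e A)"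
  using s
proof (induction "card A - cyc s A" arbitrary: s rule: less_induct)
  case less
  show ?case
  proof (cases "\<forall>x\<in>A. s x = x")
    case True
    have "gr s A \<subseteq> Id" using True by (auto simp: gr_def)
    then have "conn (gr s A) = Id" and "conn (gr s A \<union> gr e A) = conn (gr e A)"
      by (auto intro!: conn_Id conn_eqI intro: conn_base)
    moreover have "cyc (s \<circ> e) A = cyc e A"
      by (rule cyc_cong) (use True e bij_betwE in fastforce)
    moreover have "card (A // Id) = card A"
      by (auto simp: quotient_eq_image intro!: card_image inj_onI)
    ultimately show ?thesis by (simp add: excess_def cyc_def)
  next
    case False
    then obtain a where a: "a \<in> A" "s a \<noteq> a" by blast
    have sa: "s a \<in> A" using less.prems a bij_betwE by blast
    have same: "(a, s a) \<in> conn (gr s A)" by (rule gr_base[OF a(1)])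
    \<comment> \<open>This makes \<open>s a\<close> a fixed point and shortens the cycle of
      \<open>a\<close> by one dart.\<close>
    let ?s = "s \<circ> transpose a (s a)"
    have bij: "bij_betw ?s A A" using bij_betw_transpose[OF less.prems a(1) sa] .
    have "int (cyc ?s A) = int (cyc s A) + 1"
      using cyc_transpose[OF less.prems fin a(1) sa] a same by auto
    moreover have "cyc ?s A \<le> card A" by (rule cyc_le_card[OF fin])
    ultimately have "card A - cyc ?s A < card A - cyc s A" by linarith
    from less.hyps[OF this bij] show ?thesis
      using split_vertex(1)[OF less.prems e fin a(1) sa _ same] a(2) by (auto simp: eq_commute)
  qed
qed

section \<open>Diagrams as combinatorial maps\<close>

lemma joined_eq_conn:
  "joined T = conn (gr (edge T) (darts T) \<union> gr (rot T) (darts T - set (ends T)))"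
  by (simp add: joined_def conn_def gr_def Let_def)

text \<open>\<open>diagram\<close> allows only bivalent and four-valent vertices away from the
  boundary. A collapsed tangle has a vertex of another valency in general, so only bijectivity of
  the rotation is kept.\<close>

definition combinatorial_map :: "'d diagram \<Rightarrow> bool" where
  "combinatorial_map M \<longleftrightarrow> finite (darts M) \<and> ends M = [] \<and>
     bij_betw (rot M) (darts M) (darts M) \<and>
     (\<forall>d\<in>darts M. edge M d \<in> darts M \<and> edge M d \<noteq> d \<and> edge M (edge M d) = d)"

definition edges :: "'d diagram \<Rightarrow> 'd set set" where
  "edges M = (\<lambda>d. {d, edge M d}) ` darts M"

lemma bij_betw_edge:
  assumes "\<forall>d\<in>darts M. edge M d \<in> darts M \<and> edge M d \<noteq> d \<and> edge M (edge M d) = d"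
  shows "bij_betw (edge M) (darts M) (darts M)"
  by (rule bij_betw_byWitness[where f' = "edge M"]) (use assms in auto)

text \<open>The cycles of \<open>edge\<close> are the edges, each with two darts. The bound
  \<open>card A - cyc e A\<close> from \<open>excess_le\<close> thus becomes
  \<open>2 * E - E = E\<close>.\<close>

lemma card_darts_eq:
  assumes "combinatorial_map M"
  shows "card (darts M) = 2 * card (edges M)" and "cyc (edge M) (darts M) = card (edges M)"
proof -
  have e: "edge M d \<in> darts M" "edge M d \<noteq> d" "edge M (edge M d) = d" if "d \<in> darts M" for d
    using assms that by (auto simp: combinatorial_map_def)
  have fin: "finite (darts M)" using assms by (simp add: combinatorial_map_def)
  have U: "\<Union> (edges M) = darts M" using e(1) by (auto simp: edges_def)
  have "2 * card (edges M) = card (\<Union> (edges M))"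
  proof (rule card_partition)
    show "finite (edges M)" using fin by (simp add: edges_def)
    show "finite (\<Union> (edges M))" using fin U by simp
    show "card c = 2" if "c \<in> edges M" for c
    proof -
      obtain d where "d \<in> darts M" "c = {d, edge M d}" using \<open>c \<in> edges M\<close> by (auto simp: edges_def)
      then show ?thesis using e(2)[of d] by auto
    qed
    show "c \<inter> c' = {}" if c: "c \<in> edges M" and c': "c' \<in> edges M" and ne: "c \<noteq> c'" for c c'
    proof (rule ccontr)
      assume "c \<inter> c' \<noteq> {}"
      obtain d d' where d: "d \<in> darts M" "c = {d, edge M d}" "d' \<in> darts M" "c' = {d', edge M d'}"
        using c c' by (auto simp: edges_def)
      then have "d = d' \<or> d = edge M d' \<or> edge M d = d' \<or> edge M d = edge M d'"
        using \<open>c \<inter> c' \<noteq> {}\<close> by auto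
      then have "d = d' \<or> d = edge M d'" using e(3)[OF d(1)] e(3)[OF d(3)] by metis
      then have "c = c'" using e(3)[OF d(3)] unfolding d(2,4) by auto
      with ne show False by simp
    qed
  qed
  then show "card (darts M) = 2 * card (edges M)" using U by simp
  have orb: "orbit (edge M) d = {d, edge M d}" if d: "d \<in> darts M" for d
  proof
    show "orbit (edge M) d \<subseteq> {d, edge M d}"
    proof
      fix x assume "x \<in> orbit (edge M) d"
      then show "x \<in> {d, edge M d}" by induction (use e(3)[OF d] in auto)
    qed
    have "edge M d \<in> orbit (edge M) d" by (rule orbit.base)
    moreover from orbit.step[OF this] have "d \<in> orbit (edge M) d" using e(3)[OF d] by simp
    ultimately show "{d, edge M d} \<subseteq> orbit (edge M) d" by simp
  qed
  have bij: "bij_betw (edge M) (darts M) (darts M)" by (rule bij_betw_edge) (use e in blast)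
  have "orbit (edge M) ` darts M = edges M" unfolding edges_def by (rule image_cong[OF refl orb])
  then show "cyc (edge M) (darts M) = card (edges M)" using card_orbits[OF bij fin] by simp
qed

lemma planar_map_iff:
  assumes "combinatorial_map M"
  shows "planar_map M \<longleftrightarrow> excess (rot M) (edge M) (darts M) = int (card (edges M))"
proof -
  have r: "bij_betw (rot M) (darts M) (darts M)" and fin: "finite (darts M)" and "ends M = []"
    using assms by (auto simp: combinatorial_map_def)
  have e: "bij_betw (edge M) (darts M) (darts M)"
    using assms by (intro bij_betw_edge) (simp add: combinatorial_map_def)
  have "components M = darts M // conn (gr (rot M) (darts M) \<union> gr (edge M) (darts M))"
    using \<open>ends M = []\<close> by (simp add: components_def joined_eq_conn Un_commute)
  then show ?thesis
    using card_orbits[OF r fin] card_orbits[OF bij_betw_trans[OF e r] fin]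
    by (auto simp: planar_map_def excess_def edges_def)
qed

lemma excess_le_edges:
  assumes "combinatorial_map M"
  shows "excess (rot M) (edge M) (darts M) \<le> int (card (edges M))"
proof -
  have "bij_betw (edge M) (darts M) (darts M)"
    using assms by (intro bij_betw_edge) (simp add: combinatorial_map_def)
  then show ?thesis
    using excess_le[of "rot M" "darts M" "edge M"] card_darts_eq[OF assms] assms
    by (simp add: combinatorial_map_def)
qed

text \<open>Genus zero means that the excess has its largest possible value, the number of edges,
  and splitting does not change the edges. So the excess cannot grow, which gives both conclusions.
  The new rotation is prescribed on darts only, since the resolved diagrams need not agree with it
  elsewhere.\<close>

lemma planar_split:
  assumes M: "combinatorial_map M" "planar_map M"
    and ab: "a \<in> darts M" "b \<in> darts M" "a \<noteq> b" and same: "(a, b) \<in> conn (gr (rot M) (darts M))"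
    and M': "darts M' = darts M" "edge M' = edge M" "ends M' = []"
      "\<And>d. d \<in> darts M \<Longrightarrow> rot M' d = rot M (transpose a b d)"
  shows "planar_map M'"
    and "(rot M a, rot M b) \<in> conn (gr (rot M \<circ> edge M) (darts M)) \<Longrightarrow> (a, b) \<notin> joined M'"
proof -
  have r: "bij_betw (rot M) (darts M) (darts M)" and fin: "finite (darts M)"
    using M by (auto simp: combinatorial_map_def)
  have e: "bij_betw (edge M) (darts M) (darts M)"
    using M by (intro bij_betw_edge) (simp add: combinatorial_map_def)
  have rM': "rot M' d = (rot M \<circ> transpose a b) d" if "d \<in> darts M" for d using M'(4)[OF that] by simp
  have "bij_betw (rot M \<circ> transpose a b) (darts M) (darts M)" by (rule bij_betw_transpose[OF r ab(1,2)])
  also have "bij_betw (rot M \<circ> transpose a b) (darts M) (darts M) \<longleftrightarrow> bij_betw (rot M') (darts M) (darts M)"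
    by (rule bij_betw_cong) (rule rM'[symmetric])
  finally have "bij_betw (rot M') (darts M) (darts M)" .
  then have cM': "combinatorial_map M'" using M(1) M' by (auto simp: combinatorial_map_def)
  have E: "edges M' = edges M" using M' by (simp add: edges_def)
  have gr: "gr (rot M') (darts M) = gr (rot M \<circ> transpose a b) (darts M)" by (rule gr_cong) (rule rM')
  have "cyc (rot M' \<circ> edge M) (darts M) = cyc (rot M \<circ> transpose a b \<circ> edge M) (darts M)"
    by (rule cyc_cong) (use rM' M(1) in \<open>simp add: combinatorial_map_def\<close>)
  then have X: "excess (rot M') (edge M') (darts M') = excess (rot M \<circ> transpose a b) (edge M) (darts M)"
    by (simp add: excess_def cyc_def gr M')
  note split = split_vertex[OF r e fin ab same]
  have P: "excess (rot M) (edge M) (darts M) = int (card (edges M))"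
    using M planar_map_iff by blast
  have le: "excess (rot M') (edge M') (darts M') \<le> excess (rot M) (edge M) (darts M)"
    using excess_le_edges[OF cM'] P E by simp
  then show "planar_map M'"
    using split(1) X P E planar_map_iff[OF cM'] by simp
  assume "(rot M a, rot M b) \<in> conn (gr (rot M \<circ> edge M) (darts M))"
  from split(2)[OF _ this] show "(a, b) \<notin> joined M'"
    using le X by (simp add: joined_eq_conn M' gr Un_commute)
qed

section \<open>Rotation at crossings and bivalent points\<close>

lemma diagramD:
  assumes "diagram T"
  shows "finite (darts T)" "distinct (ends T)" "set (ends T) \<subseteq> darts T"
    "over T \<subseteq> darts T - set (ends T)"
    "d \<in> darts T \<Longrightarrow> edge T d \<in> darts T" "d \<in> darts T \<Longrightarrow> edge T d \<noteq> d"
    "d \<in> darts T \<Longrightarrow> edge T (edge T d) = d"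
  using assms by (auto simp: diagram_def)

lemma diagram_rot:
  assumes "diagram T" "d \<in> darts T - set (ends T)"
  shows "rot T d \<in> darts T - set (ends T)" "rot T d \<noteq> d"
    "rot T (rot T (rot T (rot T d))) = d"
    "rot T (rot T d) \<noteq> d \<Longrightarrow> rot T d \<in> over T \<longleftrightarrow> d \<notin> over T"
    "rot T (rot T d) = d \<Longrightarrow> d \<notin> over T"
proof -
  note * = assms(1)[unfolded diagram_def, THEN conjunct2, THEN conjunct2, THEN conjunct2, THEN conjunct2,
      THEN conjunct2, rule_format, OF assms(2)]
  show "rot T d \<in> darts T - set (ends T)" "rot T d \<noteq> d"
    "rot T (rot T (rot T (rot T d))) = d"
    "rot T (rot T d) \<noteq> d \<Longrightarrow> rot T d \<in> over T \<longleftrightarrow> d \<notin> over T"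
    "rot T (rot T d) = d \<Longrightarrow> d \<notin> over T"
    using * by auto
qed

lemma bij_betw_rot:
  assumes "diagram T"
  shows "bij_betw (rot T) (darts T - set (ends T)) (darts T - set (ends T))"
proof (rule bij_betw_byWitness[where f' = "\<lambda>d. rot T (rot T (rot T d))"])
  show "rot T ` (darts T - set (ends T)) \<subseteq> darts T - set (ends T)"
    using diagram_rot(1)[OF assms] by blast
  show "(\<lambda>d. rot T (rot T (rot T d))) ` (darts T - set (ends T)) \<subseteq> darts T - set (ends T)"
    using diagram_rot(1)[OF assms] by blast
qed (use diagram_rot(3)[OF assms] in blast)+

lemma vertex_eq:
  assumes "diagram T" "d \<in> darts T - set (ends T)" "e \<in> vertex T d"
  shows "vertex T e = vertex T d"
  using assms(3) diagram_rot(3)[OF assms(1,2)] unfolding vertex_def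
  by (elim insertE emptyE) (simp_all add: insert_commute)

lemma self_in_vertex [simp]: "d \<in> vertex T d"
  by (simp add: vertex_def)

lemma crossingE:
  assumes "diagram T" "c \<in> crossings T"
  obtains x where "c = {x, rot T x, rot T (rot T x), rot T (rot T (rot T x))}"
    "x \<in> darts T - set (ends T)" "rot T (rot T x) \<noteq> x"
    "x \<in> over T" "rot T x \<notin> over T" "rot T (rot T x) \<in> over T" "rot T (rot T (rot T x)) \<notin> over T"
proof -
  obtain x where x: "x \<in> over T" "c = vertex T x" using assms(2) by (auto simp: crossings_def)
  have x1: "x \<in> darts T - set (ends T)" using diagramD(4)[OF assms(1)] x by blast
  note x2 = diagram_rot(1)[OF assms(1) x1] note x3 = diagram_rot(1)[OF assms(1) x2]
  have n1: "rot T (rot T x) \<noteq> x" using diagram_rot(5)[OF assms(1) x1] x(1) by blast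
  have n2: "rot T (rot T (rot T x)) \<noteq> rot T x" using n1 diagram_rot(3)[OF assms(1) x1] by metis
  have n3: "rot T (rot T (rot T (rot T x))) \<noteq> rot T (rot T x)" using n1 diagram_rot(3)[OF assms(1) x1] by metis
  show thesis
    using that[of x] x(2) x1 n1 x(1) diagram_rot(4)[OF assms(1) x1 n1] diagram_rot(4)[OF assms(1) x2 n2]
      diagram_rot(4)[OF assms(1) x3 n3] by (simp add: vertex_def)
qed

lemma vertex_crossing:
  assumes "diagram T" "c \<in> crossings T" "d \<in> c"
  shows "vertex T d = c"
proof -
  obtain x where "x \<in> over T" "c = vertex T x" using assms(2) by (auto simp: crossings_def)
  then show ?thesis using vertex_eq[OF assms(1) _, of x d] diagramD(4)[OF assms(1)] assms(3) by blast
qed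

lemma vertex_eq_crossing_iff:
  assumes "diagram T" "c \<in> crossings T"
  shows "vertex T d = c \<longleftrightarrow> d \<in> c"
  using vertex_crossing[OF assms] self_in_vertex[of d T] by blast

lemma crossing_subset:
  assumes "diagram T" "c \<in> crossings T"
  shows "c \<subseteq> darts T - set (ends T)"
proof -
  obtain x where x: "c = {x, rot T x, rot T (rot T x), rot T (rot T (rot T x))}"
    "x \<in> darts T - set (ends T)" using crossingE[OF assms] by metis
  then show ?thesis using diagram_rot(1)[OF assms(1)] by (metis empty_subsetI insert_subset)
qed

lemma crossing_rot:
  assumes "diagram T" "c \<in> crossings T" "d \<in> c"
  shows "rot T d \<in> c" "rot T d \<in> over T \<longleftrightarrow> d \<notin> over T" "rot T (rot T d) \<noteq> d"
    "rot T (rot T (rot T (rot T d))) = d" "rot T d \<noteq> d" "d \<in> darts T - set (ends T)"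
proof -
  show d: "d \<in> darts T - set (ends T)" using crossing_subset[OF assms(1,2)] assms(3) by blast
  obtain x where x: "c = {x, rot T x, rot T (rot T x), rot T (rot T (rot T x))}"
    "x \<in> darts T - set (ends T)" "rot T (rot T x) \<noteq> x"
    "x \<in> over T" "rot T x \<notin> over T" "rot T (rot T x) \<in> over T" "rot T (rot T (rot T x)) \<notin> over T"
    using crossingE[OF assms(1,2)] by metis
  have r4: "rot T (rot T (rot T (rot T x))) = x" by (rule diagram_rot(3)[OF assms(1) x(2)])
  show "rot T d \<in> c" using assms(3) r4 unfolding x(1) by auto
  show "rot T d \<in> over T \<longleftrightarrow> d \<notin> over T" using assms(3) r4 x(4-7) unfolding x(1) by auto
  show "rot T (rot T d) \<noteq> d" using assms(3) r4 x(3) unfolding x(1) by auto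
  show "rot T (rot T (rot T (rot T d))) = d" "rot T d \<noteq> d"
    using diagram_rot[OF assms(1) d] by simp_all
qed

text \<open>At a four-valent vertex over and under alternate, so \<open>d\<close> or its successor
  belongs to \<open>over\<close>. Crossings can therefore be recognized from \<open>rot\<close>
  alone, which is convenient for comparing a diagram with its parts.\<close>

lemma vertex_in_crossings_iff:
  assumes "diagram T"
  shows "vertex T d \<in> crossings T \<longleftrightarrow> d \<in> darts T - set (ends T) \<and> rot T (rot T d) \<noteq> d"
proof
  assume "vertex T d \<in> crossings T"
  then show "d \<in> darts T - set (ends T) \<and> rot T (rot T d) \<noteq> d"
    using crossing_rot(3,6)[OF assms _ self_in_vertex] by blast
next
  assume d: "d \<in> darts T - set (ends T) \<and> rot T (rot T d) \<noteq> d"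
  then consider "d \<in> over T" | "rot T d \<in> over T" using diagram_rot(4)[OF assms] by blast
  then show "vertex T d \<in> crossings T"
  proof cases
    case 2
    have "vertex T (rot T d) = vertex T d"
      using vertex_eq[OF assms, of d "rot T d"] d by (auto simp: vertex_def)
    with 2 show ?thesis by (auto simp: crossings_def)
  qed (auto simp: crossings_def)
qed

lemma over_in_crossing:
  assumes "diagram T" "d \<in> over T"
  shows "vertex T d \<in> crossings T"
  using assms by (auto simp: crossings_def)

lemma finite_crossings: "diagram T \<Longrightarrow> finite (crossings T)"
  using finite_subset[OF diagramD(4)] diagramD(1) by (auto simp: crossings_def)

section \<open>Smoothing crossings\<close>

lemma resolve_simps [simp]:
  "darts (resolve \<rho> T) = darts T" "edge (resolve \<rho> T) = edge T" "ends (resolve \<rho> T) = ends T"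
  "over (resolve \<rho> T) = over T - \<Union> (dom \<rho>)"
  by (simp_all add: resolve_def)

lemma rot_resolve_None: "\<rho> (vertex T d) = None \<Longrightarrow> rot (resolve \<rho> T) d = rot T d"
  by (simp add: resolve_def)

lemma rot_resolve_Some:
  "\<rho> (vertex T d) = Some k \<Longrightarrow>
     rot (resolve \<rho> T) d = (if d \<in> over T \<longleftrightarrow> k = 1 then rot T d else rot T (rot T (rot T d)))"
  by (simp add: resolve_def)

lemma resolve_empty [simp]: "resolve Map.empty T = T"
  by (simp add: resolve_def)

lemma vertex_rot:
  assumes "diagram T" "d \<in> darts T - set (ends T)"
  shows "vertex T (rot T d) = vertex T d"
  using vertex_eq[OF assms, of "rot T d"] by (simp add: vertex_def)

text \<open>\<open>vertex\<close> is the same set for all ends at one vertex, so \<rho> treats these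
  ends alike: either the whole vertex is kept, or each of its ends is paired with a neighbouring
  one.\<close>

lemma rot_resolve_cases:
  assumes "diagram T" "dom \<rho> \<subseteq> crossings T" "d \<in> darts T - set (ends T)"
  obtains (kept) "vertex T d \<notin> dom \<rho>" "rot (resolve \<rho> T) d = rot T d" "vertex (resolve \<rho> T) d = vertex T d"
      "rot (resolve \<rho> T) (rot T d) = rot T (rot T d)"
      "rot (resolve \<rho> T) (rot T (rot T d)) = rot T (rot T (rot T d))"
      "rot (resolve \<rho> T) (rot T (rot T (rot T d))) = d"
  | (smoothed) "vertex T d \<in> dom \<rho>" "rot (resolve \<rho> T) (rot (resolve \<rho> T) d) = d"
      "rot (resolve \<rho> T) d \<in> vertex T d" "rot (resolve \<rho> T) d \<noteq> d"
proof (cases "\<rho> (vertex T d)")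
  case None
  note d1 = diagram_rot(1)[OF assms(1,3)] note d2 = diagram_rot(1)[OF assms(1) d1]
  note d3 = diagram_rot(1)[OF assms(1) d2]
  have "vertex T (rot T d) = vertex T d" "vertex T (rot T (rot T d)) = vertex T d"
    "vertex T (rot T (rot T (rot T d))) = vertex T d"
    using vertex_rot[OF assms(1,3)] vertex_rot[OF assms(1) d1] vertex_rot[OF assms(1) d2] by simp_all
  then have N: "\<rho> (vertex T (rot T d)) = None" "\<rho> (vertex T (rot T (rot T d))) = None"
    "\<rho> (vertex T (rot T (rot T (rot T d)))) = None"
    using None by simp_all
  have k: "rot (resolve \<rho> T) d = rot T d" "rot (resolve \<rho> T) (rot T d) = rot T (rot T d)"
    "rot (resolve \<rho> T) (rot T (rot T d)) = rot T (rot T (rot T d))"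
    "rot (resolve \<rho> T) (rot T (rot T (rot T d))) = d"
    by (rule rot_resolve_None[of \<rho> T, OF None], rule rot_resolve_None[of \<rho> T, OF N(1)],
        rule rot_resolve_None[of \<rho> T, OF N(2)],
        rule trans[OF rot_resolve_None[of \<rho> T, OF N(3)] diagram_rot(3)[OF assms(1,3)]])
  then have "vertex (resolve \<rho> T) d = vertex T d" by (simp add: vertex_def)
  with None k show thesis by (intro kept) auto
next
  case (Some k)
  then have c: "vertex T d \<in> crossings T" using assms(2) by blast
  note r = crossing_rot[OF assms(1) c]
  have d: "d \<in> vertex T d" by simp
  note d1 = r(1)[OF d] note d2 = r(1)[OF d1] note d3 = r(1)[OF d2]
  have v: "\<rho> (vertex T (rot T d)) = Some k" "\<rho> (vertex T (rot T (rot T (rot T d)))) = Some k"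
    using vertex_crossing[OF assms(1) c d1] vertex_crossing[OF assms(1) c d3] Some by simp_all
  have ne: "rot T (rot T (rot T d)) \<noteq> d" using r(4)[OF d] r(5)[OF d] by metis
  show thesis
  \<comment> \<open>If \<open>d\<close> moves to its successor, the successor has the other
    over-under status and moves three steps on, that is, back to \<open>d\<close>. The other case is
    the mirror image.\<close>
  proof (cases "d \<in> over T \<longleftrightarrow> k = 1")
    case True
    then have "rot (resolve \<rho> T) d = rot T d" using Some by (simp add: rot_resolve_Some)
    moreover have "rot (resolve \<rho> T) (rot T d) = rot T (rot T (rot T (rot T d)))"
      using v(1) r(2)[OF d] True by (auto simp: rot_resolve_Some)
    ultimately show thesis using smoothed Some r(4)[OF d] r(5)[OF d] d1 by auto
  next
    case False
    then have "rot (resolve \<rho> T) d = rot T (rot T (rot T d))" using Some by (auto simp: rot_resolve_Some)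
    moreover have "rot (resolve \<rho> T) (rot T (rot T (rot T d))) = rot T (rot T (rot T (rot T d)))"
      using v(2) r(2)[OF d] r(2)[OF d1] r(2)[OF d2] False by (auto simp: rot_resolve_Some)
    ultimately show thesis using smoothed Some r(4)[OF d] ne d3 by auto
  qed
qed

lemma over_resolve_iff:
  assumes "diagram T" "dom \<rho> \<subseteq> crossings T"
  shows "d \<in> over (resolve \<rho> T) \<longleftrightarrow> d \<in> over T \<and> vertex T d \<notin> dom \<rho>"
proof -
  have "d \<in> \<Union> (dom \<rho>) \<longleftrightarrow> vertex T d \<in> dom \<rho>"
    using vertex_crossing[OF assms(1)] assms(2) self_in_vertex[of d T] by blast
  then show ?thesis by simp
qed

lemma diagram_resolve:
  assumes T: "diagram T" and \<rho>: "dom \<rho> \<subseteq> crossings T"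
  shows "diagram (resolve \<rho> T)"
proof -
  let ?T = "resolve \<rho> T"
  have "rot ?T d \<in> darts T - set (ends T) \<and>
      (rot ?T d \<noteq> d \<and> rot ?T (rot ?T d) = d \<and> d \<notin> over ?T \<or>
       rot ?T (rot ?T d) \<noteq> d \<and> rot ?T (rot ?T (rot ?T (rot ?T d))) = d \<and>
       (rot ?T d \<in> over ?T \<longleftrightarrow> d \<notin> over ?T))" if d: "d \<in> darts T - set (ends T)" for d
    using T \<rho> d
  proof (cases rule: rot_resolve_cases)
    case kept
    note r = diagram_rot[OF T d]
    have v: "vertex T (rot T d) = vertex T d" by (rule vertex_rot[OF T d])
    show ?thesis
    proof (cases "rot T (rot T d) = d")
      case True
      then show ?thesis using kept r by (simp add: over_resolve_iff[OF T \<rho>] del: resolve_simps)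
    next
      case False
      then show ?thesis
        using kept r v by (simp add: over_resolve_iff[OF T \<rho>] del: resolve_simps)
    qed
  next
    case smoothed
    then have "vertex T d \<in> crossings T" using \<rho> by blast
    then have "rot ?T d \<in> darts T - set (ends T)" using crossing_subset[OF T] smoothed(3) by blast
    then show ?thesis using smoothed by (simp add: over_resolve_iff[OF T \<rho>] del: resolve_simps(4))
  qed
  then show ?thesis using T unfolding diagram_def by auto
qed

lemma crossings_resolve:
  assumes T: "diagram T" and \<rho>: "dom \<rho> \<subseteq> crossings T"
  shows "crossings (resolve \<rho> T) = crossings T - dom \<rho>"
proof -
  have "vertex (resolve \<rho> T) d = vertex T d" if "d \<in> over T" "vertex T d \<notin> dom \<rho>" for d
  proof -
    have "d \<in> darts T - set (ends T)" using that diagramD(4)[OF T] by blast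
    with T \<rho> show ?thesis by (cases rule: rot_resolve_cases) (use that in auto)
  qed
  moreover have "crossings (resolve \<rho> T) = vertex (resolve \<rho> T) ` {d \<in> over T. vertex T d \<notin> dom \<rho>}"
    unfolding crossings_def by (rule arg_cong[where f = "image _"]) (use over_resolve_iff[OF T \<rho>] in blast)
  ultimately have "crossings (resolve \<rho> T) = vertex T ` {d \<in> over T. vertex T d \<notin> dom \<rho>}"
    by simp
  then show ?thesis by (auto simp: crossings_def)
qed

text \<open>This is an equality of records, so the rotations have to agree on every element of the
  type. It works because \<open>resolve\<close> is controlled by \<open>vertex T d\<close>, and a
  set that is a crossing contains only darts of that crossing.\<close>

lemma resolve_resolve:
  assumes T: "diagram T" and c: "c \<in> crossings T" and \<rho>: "dom \<rho> \<subseteq> crossings T - {c}"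
  shows "resolve \<rho> (resolve [c \<mapsto> k] T) = resolve (\<rho>(c \<mapsto> k)) T"
proof -
  let ?T = "resolve [c \<mapsto> k] T"
  have \<rho>': "dom \<rho> \<subseteq> crossings T" and c': "dom [c \<mapsto> k] \<subseteq> crossings T" using \<rho> c by auto
  have rot: "rot (resolve \<rho> ?T) d = rot (resolve (\<rho>(c \<mapsto> k)) T) d" for d
  proof (cases "vertex T d = c")
    case True
    \<comment> \<open>A crossing in the domain of \<rho> that equals this set would contain
      \<open>d\<close>, hence coincide with \<open>c\<close>, which the domain avoids.\<close>
    then have "vertex ?T d \<notin> dom \<rho>"
      using \<rho> vertex_eq_crossing_iff[OF T] self_in_vertex[of d ?T] by blast
    then have "rot (resolve \<rho> ?T) d = rot ?T d" by (auto intro: rot_resolve_None)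
    then show ?thesis using True by (simp add: rot_resolve_Some)
  next
    case ne: False
    show ?thesis
    proof (cases "\<rho> (vertex T d)")
      case None
      have "vertex ?T d \<notin> dom \<rho>"
      proof
        assume *: "vertex ?T d \<in> dom \<rho>"
        then have "vertex T d = vertex ?T d"
          using \<rho>' vertex_eq_crossing_iff[OF T] self_in_vertex[of d ?T] by blast
        with * None show False by auto
      qed
      then have "rot (resolve \<rho> ?T) d = rot ?T d" by (auto intro: rot_resolve_None)
      also have "\<dots> = rot T d" using ne by (simp add: rot_resolve_None)
      finally show ?thesis using None ne by (simp add: rot_resolve_None)
    next
      case (Some l)
      then have v: "vertex T d \<in> crossings T" using \<rho>' by blast
      then have d: "d \<in> darts T - set (ends T)" using crossing_rot(6)[OF T v] by simp
      from T c' d show ?thesis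
      proof (cases rule: rot_resolve_cases)
        case kept
        have "d \<in> over ?T \<longleftrightarrow> d \<in> over T" using ne over_resolve_iff[OF T c'] by simp
        then show ?thesis using kept Some ne by (simp add: rot_resolve_Some del: resolve_simps(4))
      next
        case smoothed
        then show ?thesis using ne by simp
      qed
    qed
  qed
  have "over T - c - \<Union> (dom \<rho>) = over T - \<Union> (dom (\<rho>(c \<mapsto> k)))" by auto
  moreover have "rot (resolve \<rho> ?T) = rot (resolve (\<rho>(c \<mapsto> k)) T)" using rot by (rule ext)
  moreover have "diagram.more (resolve \<rho> ?T) = diagram.more (resolve (\<rho>(c \<mapsto> k)) T)" by simp
  ultimately show ?thesis by (intro diagram.equality) auto
qed

section \<open>Smoothing preserves planarity of tangles\<close>

lemma collapse_simps [simp]: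
  "darts (collapse S T) = darts T" "edge (collapse S T) = edge T" "ends (collapse S T) = []"
  "d \<notin> set (ends T) \<Longrightarrow> rot (collapse S T) d = rot T d"
  by (simp_all add: collapse_def)

lemma combinatorial_map_collapse:
  assumes "diagram T"
  shows "combinatorial_map (collapse S T)"
proof -
  let ?E = "set (ends T)" and ?M = "collapse S T"
  define ps where "ps = (case S of Inside \<Rightarrow> rev (ends T) | Outside \<Rightarrow> ends T)"
  have ps: "set ps = ?E" "\<And>d. d \<in> ?E \<Longrightarrow> rot ?M d = cycle_of_list ps d"
    by (cases S; simp add: ps_def) (simp add: collapse_def ps_def)
  have "bij_betw (rot ?M) ?E ?E"
    using permutes_imp_bij[OF cycle_permutes[of ps]] bij_betw_cong[of ?E "rot ?M", OF ps(2)] ps(1) by metis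
  moreover have "bij_betw (rot ?M) (darts T - ?E) (darts T - ?E)"
    using bij_betw_rot[OF assms] bij_betw_cong[of "darts T - ?E" "rot ?M" "rot T"] by simp
  ultimately have "bij_betw (rot ?M) (?E \<union> (darts T - ?E)) (?E \<union> (darts T - ?E))"
    by (rule bij_betw_combine) auto
  moreover have "?E \<union> (darts T - ?E) = darts T" using diagramD(3)[OF assms] by auto
  ultimately show ?thesis using diagramD[OF assms] by (simp add: combinatorial_map_def)
qed

text \<open>Smoothing splits the four-valent vertex into two bivalent ones: the new rotation is the
  old one composed with the transposition of two opposite ends. Thus \<open>planar_split\<close>
  applies to the collapsed map.\<close>

lemma tangle_smooth:
  assumes "tangle S T" and c: "c \<in> crossings T"
  shows "tangle S (resolve [c \<mapsto> k] T)"
proof -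
  let ?T = "resolve [c \<mapsto> k] T" and ?M = "collapse S T"
  have T: "diagram T" and pl: "planar_map ?M" using assms(1) by (auto simp: tangle_def)
  have dom: "dom [c \<mapsto> k] \<subseteq> crossings T" using c by simp
  \<comment> \<open>The opposite ends to be exchanged are those that the resolution connects with
    the preceding end: the under-ends for \<open>k = 1\<close>, the over-ends otherwise. Indeed
    \<open>rot\<close> of the opposite end is three steps on.\<close>
  obtain x where x: "x \<in> c" "x \<in> over T \<longleftrightarrow> k \<noteq> 1"
    using crossingE[OF T c] by (metis insertCI)
  note r = crossing_rot[OF T c]
  define y where "y = rot T (rot T x)"
  note x1 = r(1)[OF x(1)] note x2 = r(1)[OF x1]
  have y: "y \<in> c" "y \<in> over T \<longleftrightarrow> k \<noteq> 1" "rot T (rot T y) = x"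
    using x x2 r(2)[OF x(1)] r(2)[OF x1] r(4)[OF x(1)] by (auto simp: y_def)
  have xy: "x \<in> darts T" "y \<in> darts T" "x \<noteq> y" "x \<notin> set (ends T)" "rot T x \<notin> set (ends T)" "rot T x \<in> darts T"
    using r(6)[OF x(1)] r(6)[OF y(1)] r(3)[OF x(1)] r(6)[OF x1] by (auto simp: y_def)
  have same: "(x, y) \<in> conn (gr (rot ?M) (darts ?M))"
  proof (rule conn_trans)
    show "(x, rot T x) \<in> conn (gr (rot ?M) (darts ?M))"
      using gr_base[of x "darts ?M" "rot ?M"] xy by simp
    show "(rot T x, y) \<in> conn (gr (rot ?M) (darts ?M))"
      using gr_base[of "rot T x" "darts ?M" "rot ?M"] xy by (simp add: y_def)
  qed
  have rM: "rot (collapse S ?T) d = rot ?M (transpose x y d)" if d: "d \<in> darts ?M" for d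
  proof (cases "d \<in> set (ends T)")
    case True
    then have "d \<noteq> x" "d \<noteq> y" using r(6)[OF x(1)] r(6)[OF y(1)] by auto
    then show ?thesis using True by (cases S) (simp_all add: collapse_def)
  next
    case False
    show ?thesis
    proof (cases "d \<in> c")
      case True
      then have "vertex T d = c" by (rule vertex_crossing[OF T c])
      then have rd: "rot ?T d = (if d \<in> over T \<longleftrightarrow> k = 1 then rot T d else rot T (rot T (rot T d)))"
        by (simp add: rot_resolve_Some)
      have "c = vertex T x" using vertex_crossing[OF T c x(1)] by simp
      then consider "d = x" | "d = y" | "d = rot T x" | "d = rot T y"
        using True by (auto simp: vertex_def y_def)
      then show ?thesis
      proof cases
        case 1
        then show ?thesis using rd x(2) xy(3) r(6)[OF y(1)] False by (auto simp: y_def)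
      next
        case 2
        then show ?thesis using rd y(2,3) xy(3,4) False by auto
      next
        case 3
        then have "d \<noteq> x" "d \<noteq> y" using r(5)[OF x(1)] r(5)[OF x1] by (auto simp: y_def)
        then show ?thesis using 3 rd r(2)[OF x(1)] x(2) False by auto
      next
        case 4
        then have "d \<noteq> x" "d \<noteq> y" using r(5)[OF y(1)] r(5)[OF r(1)[OF y(1)]] y(3) by auto
        then show ?thesis using 4 rd r(2)[OF y(1)] y(2) False by auto
      qed
    next
      case F: False
      then have "d \<noteq> x" "d \<noteq> y" using x y by auto
      moreover have "rot ?T d = rot T d"
        by (rule rot_resolve_None) (use vertex_eq_crossing_iff[OF T c] F in simp)
      ultimately show ?thesis using False by simp
    qed
  qed
  have "planar_map (collapse S ?T)"
    by (rule planar_split(1)[OF combinatorial_map_collapse[OF T] pl _ _ xy(3) same]) (use xy rM in auto)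
  then show ?thesis using diagram_resolve[OF T dom] by (simp add: tangle_def)
qed

lemma tangle_resolve:
  assumes "tangle S T" "dom \<rho> \<subseteq> crossings T"
  shows "tangle S (resolve \<rho> T)"
  using assms
proof (induction "card (dom \<rho>)" arbitrary: \<rho> T)
  case 0
  have "finite (dom \<rho>)" using finite_subset[OF 0(3) finite_crossings] 0(2) by (simp add: tangle_def)
  then have "\<rho> = Map.empty" using 0(1) by simp
  then show ?case using 0(2) by simp
next
  case (Suc n)
  have T: "diagram T" using Suc.prems by (simp add: tangle_def)
  have fin: "finite (dom \<rho>)" using finite_subset[OF Suc.prems(2) finite_crossings[OF T]] .
  have "dom \<rho> \<noteq> {}" using Suc.hyps(2) by auto
  then obtain c k where c: "\<rho> c = Some k" by blast
  then have cT: "c \<in> crossings T" and cd: "c \<in> dom \<rho>" using Suc.prems(2) by blast+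
  let ?\<rho> = "\<rho>(c := None)"
  have d: "dom ?\<rho> = dom \<rho> - {c}" by simp
  have dc: "dom [c \<mapsto> k] \<subseteq> crossings T" using cT by simp
  have "tangle S (resolve ?\<rho> (resolve [c \<mapsto> k] T))"
  proof (rule Suc.hyps(1))
    show "n = card (dom ?\<rho>)" using d fin cd Suc.hyps(2) by simp
    show "tangle S (resolve [c \<mapsto> k] T)" by (rule tangle_smooth[OF Suc.prems(1) cT])
    show "dom ?\<rho> \<subseteq> crossings (resolve [c \<mapsto> k] T)"
      unfolding crossings_resolve[OF T dc] d using Suc.prems(2) by auto
  qed
  moreover have "resolve ?\<rho> (resolve [c \<mapsto> k] T) = resolve (?\<rho>(c \<mapsto> k)) T"
    by (rule resolve_resolve[OF T cT]) (use Suc.prems(2) d in blast)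
  moreover have "?\<rho>(c \<mapsto> k) = \<rho>" using c by (simp add: fun_upd_idem)
  ultimately show ?case by simp
qed

section \<open>The state sum\<close>

lemma conn_Un_separate:
  assumes "G \<subseteq> A \<times> A" "H \<subseteq> B \<times> B" "A \<inter> B = {}" "x \<in> A"
  shows "conn (G \<union> H) `` {x} = conn G `` {x}"
proof -
  have "(x, y) \<in> conn G \<and> y \<in> A" if "(x, y) \<in> conn (G \<union> H)" for y
    using that
  proof (induction rule: conn_induct)
    case base
    then show ?case using assms(4) by simp
  next
    case (fwd y z)
    then have "(y, z) \<in> G" using assms by auto
    then show ?case using fwd(1) conn_base[of y z G] assms(1) by (auto intro: conn_trans)
  next
    case (bwd y z)
    then have "(z, y) \<in> G" using assms by auto
    then show ?case using bwd(1) conn_sym[OF conn_base[of z y G]] assms(1) by (auto intro: conn_trans)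
  qed
  moreover have "conn G \<subseteq> conn (G \<union> H)" by (rule conn_mono) simp
  ultimately show ?thesis by auto
qed

lemma quotient_Un_separate:
  assumes "G \<subseteq> A \<times> A" "H \<subseteq> B \<times> B" "A \<inter> B = {}"
  shows "(A \<union> B) // conn (G \<union> H) = A // conn G \<union> B // conn H"
    and "A // conn G \<inter> B // conn H = {}"
proof -
  have A: "conn (G \<union> H) `` {x} = conn G `` {x}" if "x \<in> A" for x
    by (rule conn_Un_separate[OF assms that])
  have B: "conn (G \<union> H) `` {x} = conn H `` {x}" if "x \<in> B" for x
    using conn_Un_separate[OF assms(2,1) _ that] assms(3) by (simp add: Un_commute Int_commute)
  show "(A \<union> B) // conn (G \<union> H) = A // conn G \<union> B // conn H"
    by (simp add: quotient_eq_image image_Un A B)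
  show "A // conn G \<inter> B // conn H = {}"
  proof (rule ccontr)
    assume "A // conn G \<inter> B // conn H \<noteq> {}"
    then obtain x y where xy: "x \<in> A" "y \<in> B" "conn G `` {x} = conn H `` {y}"
      unfolding quotient_eq_image by blast
    have "x \<in> conn G `` {x}" by simp
    then have "(y, x) \<in> conn H" unfolding xy(3) by simp
    then have "x \<in> B" using conn_in[OF _ assms(2) xy(2)] by blast
    then show False using xy(1) assms(3) by blast
  qed
qed

lemma card_quotient_Un_separate:
  assumes "G \<subseteq> A \<times> A" "H \<subseteq> B \<times> B" "A \<inter> B = {}" "finite A" "finite B"
  shows "card ((A \<union> B) // conn (G \<union> H)) = card (A // conn G) + card (B // conn H)"
  unfolding quotient_Un_separate(1)[OF assms(1-3)]
  by (rule card_Un_disjoint[OF _ _ quotient_Un_separate(2)[OF assms(1-3)]])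
    (simp_all add: quotient_eq_image assms)

lemma gr_Un: "gr f (A \<union> B) = gr f A \<union> gr f B"
  by (auto simp: gr_def)

lemma gr_subset: "f ` A \<subseteq> A \<Longrightarrow> gr f A \<subseteq> A \<times> A"
  by (auto simp: gr_def)

lemma combinatorial_map_link:
  assumes "diagram L" "ends L = []"
  shows "combinatorial_map L"
  using bij_betw_rot[OF assms(1)] assms diagramD[OF assms(1)] by (simp add: combinatorial_map_def)

text \<open>All terms of Euler's formula are additive. The formula for the union alone still yields
  it for both parts, because each excess is bounded by the number of edges of its part.\<close>

lemma planar_map_Un:
  assumes K: "combinatorial_map K" and L: "combinatorial_map L" and disj: "darts K \<inter> darts L = {}"
    and M: "darts M = darts K \<union> darts L" "ends M = []"
      "\<And>d. d \<in> darts K \<Longrightarrow> edge M d = edge K d \<and> rot M d = rot K d"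
      "\<And>d. d \<in> darts L \<Longrightarrow> edge M d = edge L d \<and> rot M d = rot L d"
  shows "planar_map M \<longleftrightarrow> planar_map K \<and> planar_map L"
    and "components M = components K \<union> components L"
    and "components K \<inter> components L = {}"
proof -
  have fin: "finite (darts K)" "finite (darts L)" and ends: "ends K = []" "ends L = []"
    using K L by (auto simp: combinatorial_map_def)
  have rK: "bij_betw (rot K) (darts K) (darts K)" and rL: "bij_betw (rot L) (darts L) (darts L)"
    using K L by (auto simp: combinatorial_map_def)
  have eK: "bij_betw (edge K) (darts K) (darts K)" and eL: "bij_betw (edge L) (darts L) (darts L)"
    using K L by (auto intro!: bij_betw_edge simp: combinatorial_map_def)
  have cong: "bij_betw (rot M) (darts K) (darts K)" "bij_betw (rot M) (darts L) (darts L)"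
    using rK rL bij_betw_cong[of "darts K" "rot M" "rot K"] bij_betw_cong[of "darts L" "rot M" "rot L"] M(3,4)
    by auto
  have rM: "bij_betw (rot M) (darts M) (darts M)"
    unfolding M(1) by (rule bij_betw_combine[OF cong disj])
  have eM: "edge M d \<in> darts M" "edge M d \<noteq> d" "edge M (edge M d) = d" if "d \<in> darts M" for d
    using that M K L by (auto simp: combinatorial_map_def)
  have cM: "combinatorial_map M"
    using rM eM fin M(1,2) by (simp add: combinatorial_map_def)
  note sub = bij_betw_imp_surj_on[THEN equalityD1]
  have sK: "gr (rot K) (darts K) \<subseteq> darts K \<times> darts K" "gr (edge K) (darts K) \<subseteq> darts K \<times> darts K"
      "gr (rot K \<circ> edge K) (darts K) \<subseteq> darts K \<times> darts K"
    by (rule gr_subset, rule sub, rule rK eK bij_betw_trans[OF eK rK])+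
  have sL: "gr (rot L) (darts L) \<subseteq> darts L \<times> darts L" "gr (edge L) (darts L) \<subseteq> darts L \<times> darts L"
      "gr (rot L \<circ> edge L) (darts L) \<subseteq> darts L \<times> darts L"
    by (rule gr_subset, rule sub, rule rL eL bij_betw_trans[OF eL rL])+
  have gM: "gr (rot M) (darts M) = gr (rot K) (darts K) \<union> gr (rot L) (darts L)"
      "gr (edge M) (darts M) = gr (edge K) (darts K) \<union> gr (edge L) (darts L)"
    unfolding M(1) gr_Un using M(3,4) by (auto simp: gr_def)
  have eK': "edge K d \<in> darts K" if "d \<in> darts K" for d using eK that bij_betwE by blast
  have eL': "edge L d \<in> darts L" if "d \<in> darts L" for d using eL that bij_betwE by blast
  have gM3: "gr (rot M \<circ> edge M) (darts M) = gr (rot K \<circ> edge K) (darts K) \<union> gr (rot L \<circ> edge L) (darts L)"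
  proof -
    have "gr (rot M \<circ> edge M) (darts K) = gr (rot K \<circ> edge K) (darts K)"
      by (rule gr_cong) (use M(3) eK' in simp)
    moreover have "gr (rot M \<circ> edge M) (darts L) = gr (rot L \<circ> edge L) (darts L)"
      by (rule gr_cong) (use M(4) eL' in simp)
    ultimately show ?thesis unfolding M(1) gr_Un by simp
  qed
  have V: "cyc (rot M) (darts M) = cyc (rot K) (darts K) + cyc (rot L) (darts L)"
    unfolding cyc_def unfolding gM unfolding M(1) by (rule card_quotient_Un_separate[OF sK(1) sL(1) disj fin])
  have F: "cyc (rot M \<circ> edge M) (darts M) = cyc (rot K \<circ> edge K) (darts K) + cyc (rot L \<circ> edge L) (darts L)"
    unfolding cyc_def unfolding gM3 unfolding M(1) by (rule card_quotient_Un_separate[OF sK(3) sL(3) disj fin])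
  let ?GK = "gr (rot K) (darts K) \<union> gr (edge K) (darts K)" and ?GL = "gr (rot L) (darts L) \<union> gr (edge L) (darts L)"
  have G: "gr (rot M) (darts M) \<union> gr (edge M) (darts M) = ?GK \<union> ?GL" unfolding gM by auto
  have GK: "?GK \<subseteq> darts K \<times> darts K" and GL: "?GL \<subseteq> darts L \<times> darts L" using sK sL by auto
  have C: "card (darts M // conn (gr (rot M) (darts M) \<union> gr (edge M) (darts M))) =
      card (darts K // conn ?GK) + card (darts L // conn ?GL)"
    unfolding G unfolding M(1) by (rule card_quotient_Un_separate[OF GK GL disj fin])
  have "edges M = edges K \<union> edges L" using M by (auto simp: edges_def)
  moreover have "edges K \<inter> edges L = {}"
  proof -
    have "c \<noteq> {} \<and> c \<subseteq> darts K" if "c \<in> edges K" for c using that eK' by (auto simp: edges_def)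
    moreover have "c \<subseteq> darts L" if "c \<in> edges L" for c using that eL' by (auto simp: edges_def)
    ultimately show ?thesis using disj by blast
  qed
  ultimately have E: "card (edges M) = card (edges K) + card (edges L)"
    using fin by (auto simp: edges_def card_Un_disjoint)
  show "planar_map M \<longleftrightarrow> planar_map K \<and> planar_map L"
    unfolding planar_map_iff[OF cM] planar_map_iff[OF K] planar_map_iff[OF L]
    using excess_le_edges[OF K] excess_le_edges[OF L] V F C E by (auto simp: excess_def)
  have "components M = (darts K \<union> darts L) // conn (?GK \<union> ?GL)"
    using M(2) G M(1) by (simp add: components_def joined_eq_conn Un_commute)
  then show "components M = components K \<union> components L"
    using quotient_Un_separate(1)[OF GK GL disj] ends by (simp add: components_def joined_eq_conn Un_commute)
  show "components K \<inter> components L = {}"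
    using quotient_Un_separate(2)[OF GK GL disj] ends by (simp add: components_def joined_eq_conn Un_commute)
qed

section \<open>States and their sum\<close>

definition maps :: "'a set \<Rightarrow> 'b set \<Rightarrow> ('a \<rightharpoonup> 'b) set" where
  "maps A B = {\<rho>. dom \<rho> = A \<and> ran \<rho> \<subseteq> B}"

lemma maps_empty [simp]: "maps {} B = {Map.empty}"
  by (auto simp: maps_def)

lemma finite_maps: "finite A \<Longrightarrow> finite B \<Longrightarrow> finite (maps A B)"
  unfolding maps_def by (rule finite_set_of_finite_maps)

lemma sum_maps_insert:
  assumes "finite A" "c \<notin> A" "x \<noteq> y"
  shows "sum f (maps (insert c A) {x, y}) = (\<Sum>\<rho>\<in>maps A {x, y}. f (\<rho>(c \<mapsto> x)) + f (\<rho>(c \<mapsto> y)))"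
proof -
  let ?M = "maps A {x, y}" and ?u = "\<lambda>k \<rho>. \<rho>(c \<mapsto> k)"
  have fin: "finite ?M" using assms by (simp add: finite_maps)
  have inj: "inj_on (?u k) ?M" for k
  proof (rule inj_onI)
    fix \<rho> \<rho>' assume *: "\<rho> \<in> ?M" "\<rho>' \<in> ?M" "?u k \<rho> = ?u k \<rho>'"
    have "\<rho> c = None" "\<rho>' c = None" using *(1,2) assms(2) by (auto simp: maps_def)
    with *(3) show "\<rho> = \<rho>'" by (metis fun_upd_triv fun_upd_upd)
  qed
  have "maps (insert c A) {x, y} = ?u x ` ?M \<union> ?u y ` ?M"
  proof (intro equalityI subsetI)
    fix \<rho> assume \<rho>: "\<rho> \<in> maps (insert c A) {x, y}"
    then obtain k where k: "\<rho> c = Some k" by (auto simp: maps_def)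
    then have "k \<in> {x, y}" using \<rho> by (auto simp: maps_def ran_def)
    moreover have "\<rho>(c := None) \<in> ?M" using \<rho> assms(2) by (auto simp: maps_def ran_def)
    moreover have "\<rho> = ?u k (\<rho>(c := None))" using k by (simp add: fun_upd_idem)
    ultimately show "\<rho> \<in> ?u x ` ?M \<union> ?u y ` ?M" by blast
  next
    fix \<rho> assume "\<rho> \<in> ?u x ` ?M \<union> ?u y ` ?M"
    then show "\<rho> \<in> maps (insert c A) {x, y}"
      by (fastforce simp: maps_def ran_def split: if_splits)
  qed
  moreover have "?u x ` ?M \<inter> ?u y ` ?M = {}" using assms(3) by (auto simp: fun_eq_iff) (metis option.inject)
  ultimately have "sum f (maps (insert c A) {x, y}) = sum f (?u x ` ?M) + sum f (?u y ` ?M)"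
    using fin by (simp add: sum.union_disjoint)
  then show ?thesis using inj by (simp add: sum.reindex sum.distrib)
qed

text \<open>The Kauffman state expansion in Khovanov's normalization: every component of a
  completely resolved diagram is a circle and contributes \<open>q + 1/q\<close>, every 1-resolution
  contributes \<open>-q\<close>.\<close>

definition state_sum :: "'d diagram \<Rightarrow> laurent" where
  "state_sum L = (\<Sum>\<rho>\<in>maps (crossings L) {0, 1}. (- q_pow 1) ^ (\<Sum>c\<in>crossings L. the (\<rho> c)) *
     (q_pow 1 + q_pow (- 1)) ^ card (components (resolve \<rho> L)))"

lemma collapse_link: "ends L = [] \<Longrightarrow> collapse S L = L"
  by (cases S) (simp_all add: collapse_def)

text \<open>Without boundary points collapsing does nothing, so a link diagram counts as a tangle on
  either side and inherits the results on resolved tangles.\<close>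

lemma link_diagram_iff: "link_diagram L \<longleftrightarrow> tangle S L \<and> ends L = []"
  by (auto simp: link_diagram_def tangle_def collapse_link)

lemma link_diagram_resolve:
  "link_diagram L \<Longrightarrow> dom \<rho> \<subseteq> crossings L \<Longrightarrow> link_diagram (resolve \<rho> L)"
  by (simp add: link_diagram_iff[where S = Inside] tangle_resolve)

lemma over_empty: "crossings L = {} \<Longrightarrow> over L = {}"
  by (simp add: crossings_def)

lemma state_sum_crossingless:
  assumes "crossings L = {}"
  shows "state_sum L = (q_pow 1 + q_pow (- 1)) ^ card (components L)"
  by (simp add: state_sum_def assms)

text \<open>States are grouped by their value at \<open>c\<close>. By \<open>resolve_resolve\<close>
  the remaining choices are the states of the diagram with \<open>c\<close> already
  resolved.\<close>

lemma state_sum_skein: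
  assumes "diagram L" and c: "c \<in> crossings L"
  shows "state_sum L = state_sum (resolve [c \<mapsto> 0] L) - q_pow 1 * state_sum (resolve [c \<mapsto> 1] L)"
proof -
  define A where "A = crossings L - {c}"
  have A: "crossings L = insert c A" "c \<notin> A" and fin: "finite A"
    using c finite_crossings[OF assms(1)] by (auto simp: A_def)
  have cr: "crossings (resolve [c \<mapsto> k] L) = A" for k
    using crossings_resolve[OF assms(1), of "[c \<mapsto> k]"] c by (simp add: A_def)
  define w where "w \<rho> = (- q_pow 1) ^ (\<Sum>c\<in>crossings L. the (\<rho> c)) *
     (q_pow 1 + q_pow (- 1)) ^ card (components (resolve \<rho> L))" for \<rho>
  have w: "w (\<rho>(c \<mapsto> k)) = (- q_pow 1) ^ k * ((- q_pow 1) ^ (\<Sum>c\<in>A. the (\<rho> c)) *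
     (q_pow 1 + q_pow (- 1)) ^ card (components (resolve \<rho> (resolve [c \<mapsto> k] L))))"
    if "\<rho> \<in> maps A {0, 1}" for \<rho> k
  proof -
    have "(\<Sum>c'\<in>crossings L. the ((\<rho>(c \<mapsto> k)) c')) = k + (\<Sum>c\<in>A. the (\<rho> c))"
    proof -
      have "(\<Sum>c'\<in>A. the ((\<rho>(c \<mapsto> k)) c')) = (\<Sum>c\<in>A. the (\<rho> c))"
        by (rule sum.cong) (use A(2) in auto)
      then show ?thesis unfolding A(1) sum.insert[OF fin A(2)] by simp
    qed
    moreover have "resolve \<rho> (resolve [c \<mapsto> k] L) = resolve (\<rho>(c \<mapsto> k)) L"
      by (rule resolve_resolve[OF assms]) (use that in \<open>auto simp: maps_def A_def\<close>)
    ultimately show ?thesis by (simp add: w_def power_add mult.assoc)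
  qed
  have "state_sum L = (\<Sum>\<rho>\<in>maps A {0, 1}. w (\<rho>(c \<mapsto> 0)) + w (\<rho>(c \<mapsto> 1)))"
    unfolding state_sum_def w_def[symmetric] unfolding A(1) by (rule sum_maps_insert[OF fin A(2)]) simp
  also have "\<dots> = state_sum (resolve [c \<mapsto> 0] L) + (- q_pow 1) * state_sum (resolve [c \<mapsto> 1] L)"
    unfolding state_sum_def cr sum_distrib_left sum.distrib[symmetric]
    by (rule sum.cong[OF refl]) (simp only: w, simp)
  finally show ?thesis by simp
qed

section \<open>Adding a disjoint circle\<close>

lemma disjoint_union_simps [simp]:
  "darts (disjoint_union K L) = darts K \<union> darts L" "ends (disjoint_union K L) = []"
  "over (disjoint_union K L) = over K \<union> over L"
  "d \<in> darts K \<Longrightarrow> edge (disjoint_union K L) d = edge K d"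
  "d \<in> darts K \<Longrightarrow> rot (disjoint_union K L) d = rot K d"
  "d \<notin> darts K \<Longrightarrow> edge (disjoint_union K L) d = edge L d"
  "d \<notin> darts K \<Longrightarrow> rot (disjoint_union K L) d = rot L d"
  by (simp_all add: disjoint_union_def)

lemma edge_disjoint_union:
  "edge (disjoint_union K L) = (\<lambda>d. if d \<in> darts K then edge K d else edge L d)"
  by (simp add: disjoint_union_def)

lemma link_disjoint_union:
  assumes K: "link_diagram K" and L: "link_diagram L" and disj: "darts K \<inter> darts L = {}"
  shows "link_diagram (disjoint_union K L)"
    and "card (components (disjoint_union K L)) = card (components K) + card (components L)"
proof -
  let ?M = "disjoint_union K L"
  have dK: "diagram K" "ends K = []" "planar_map K" and dL: "diagram L" "ends L = []" "planar_map L"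
    using K L by (auto simp: link_diagram_def)
  have inL: "d \<notin> darts K" if "d \<in> darts L" for d using that disj by blast
  note U = planar_map_Un[OF combinatorial_map_link[OF dK(1,2)] combinatorial_map_link[OF dL(1,2)] disj,
      of ?M]
  have K': "edge ?M d = edge K d \<and> rot ?M d = rot K d" if "d \<in> darts K" for d using that by simp
  have L': "edge ?M d = edge L d \<and> rot ?M d = rot L d" if "d \<in> darts L" for d using inL[OF that] by simp
  have "planar_map ?M" using U(1)[OF _ _ K' L'] dK(3) dL(3) by simp
  moreover have "diagram ?M"
    unfolding diagram_def
  proof (intro conjI ballI)
    show "finite (darts ?M)" using diagramD(1)[OF dK(1)] diagramD(1)[OF dL(1)] by simp
    show "over ?M \<subseteq> darts ?M - set (ends ?M)" using diagramD(4)[OF dK(1)] diagramD(4)[OF dL(1)] by auto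
    have ovK: "d \<in> over K \<Longrightarrow> d \<in> darts K" and ovL: "d \<in> over L \<Longrightarrow> d \<in> darts L" for d
      using diagramD(4)[OF dK(1)] diagramD(4)[OF dL(1)] by auto
    fix d
    show "edge ?M d \<in> darts ?M" "edge ?M d \<noteq> d" "edge ?M (edge ?M d) = d" if "d \<in> darts ?M"
    proof -
      show "edge ?M d \<in> darts ?M" "edge ?M d \<noteq> d" "edge ?M (edge ?M d) = d"
        using that diagramD(5-7)[OF dK(1), of d] diagramD(5-7)[OF dL(1), of d]
          inL[of d] inL[of "edge L d"] by auto
    qed
    assume "d \<in> darts ?M - set (ends ?M)"
    then consider (K) "d \<in> darts K" | (L) "d \<in> darts L" by auto
    then have "rot ?M d \<in> darts ?M \<and>
       (rot ?M d \<noteq> d \<and> rot ?M (rot ?M d) = d \<and> d \<notin> over ?M \<or>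
        rot ?M (rot ?M d) \<noteq> d \<and> rot ?M (rot ?M (rot ?M (rot ?M d))) = d \<and>
        (rot ?M d \<in> over ?M \<longleftrightarrow> d \<notin> over ?M))"
    proof cases
      case K
      have r: "rot K d \<in> darts K" if "d \<in> darts K" for d using diagram_rot(1)[OF dK(1)] that dK(2) by simp
      have "d \<notin> over L" if "d \<in> darts K" for d using that inL ovL by blast
      moreover have "rot K d \<noteq> d \<and> rot K (rot K d) = d \<and> d \<notin> over K \<or>
          rot K (rot K d) \<noteq> d \<and> rot K (rot K (rot K (rot K d))) = d \<and> (rot K d \<in> over K \<longleftrightarrow> d \<notin> over K)"
        using diagram_rot(2-5)[OF dK(1), of d] K dK(2) by (cases "rot K (rot K d) = d") simp_all
      ultimately show ?thesis using K r[of d] r[of "rot K d"] r[of "rot K (rot K d)"] by auto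
    next
      case L
      have r: "rot L d \<in> darts L" if "d \<in> darts L" for d using diagram_rot(1)[OF dL(1)] that dL(2) by simp
      have "d \<notin> over K" if "d \<in> darts L" for d using that inL ovK by blast
      moreover have "rot L d \<noteq> d \<and> rot L (rot L d) = d \<and> d \<notin> over L \<or>
          rot L (rot L d) \<noteq> d \<and> rot L (rot L (rot L (rot L d))) = d \<and> (rot L d \<in> over L \<longleftrightarrow> d \<notin> over L)"
        using diagram_rot(2-5)[OF dL(1), of d] L dL(2) by (cases "rot L (rot L d) = d") simp_all
      ultimately show ?thesis using L r[of d] r[of "rot L d"] r[of "rot L (rot L d)"]
          inL[of d] inL[of "rot L d"] inL[of "rot L (rot L d)"] inL[of "rot L (rot L (rot L d))"] by auto
    qed
    then show "rot ?M d \<in> darts ?M - set (ends ?M)"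
      "rot ?M d \<noteq> d \<and> rot ?M (rot ?M d) = d \<and> d \<notin> over ?M \<or>
        rot ?M (rot ?M d) \<noteq> d \<and> rot ?M (rot ?M (rot ?M (rot ?M d))) = d \<and>
        (rot ?M d \<in> over ?M \<longleftrightarrow> d \<notin> over ?M)" by simp_all
  qed (simp_all)
  ultimately show "link_diagram ?M" by (simp add: link_diagram_def)
  have "finite (components K)" "finite (components L)"
    using diagramD(1)[OF dK(1)] diagramD(1)[OF dL(1)] by (simp_all add: components_def quotient_eq_image)
  then show "card (components ?M) = card (components K) + card (components L)"
    using U(2,3)[OF _ _ K' L'] by (simp add: card_Un_disjoint)
qed

lemma vertex_disjoint_union:
  assumes "diagram K" "ends K = []" "d \<in> darts K"
  shows "vertex (disjoint_union K L) d = vertex K d"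
proof -
  have r: "rot K d \<in> darts K" if "d \<in> darts K" for d using diagram_rot(1)[OF assms(1)] that assms(2) by simp
  show ?thesis using assms(3) r[of d] r[of "rot K d"] by (simp add: vertex_def)
qed

lemma crossings_disjoint_union:
  assumes "diagram K" "ends K = []" "crossings L = {}"
  shows "crossings (disjoint_union K L) = crossings K"
proof -
  have "over K \<subseteq> darts K" using diagramD(4)[OF assms(1)] by auto
  then have "vertex (disjoint_union K L) ` over K = vertex K ` over K"
    by (intro image_cong refl vertex_disjoint_union[OF assms(1,2)]) blast
  then show ?thesis using over_empty[OF assms(3)] by (simp add: crossings_def)
qed

lemma resolve_disjoint_union:
  assumes "diagram K" "ends K = []" "crossings L = {}" "dom \<rho> \<subseteq> crossings K"
  shows "resolve \<rho> (disjoint_union K L) = disjoint_union (resolve \<rho> K) L"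
proof (rule diagram.equality)
  let ?M = "disjoint_union K L"
  have r: "rot K d \<in> darts K" if "d \<in> darts K" for d using diagram_rot(1)[OF assms(1)] that assms(2) by simp
  show "rot (resolve \<rho> ?M) = rot (disjoint_union (resolve \<rho> K) L)"
  proof
    fix d
    show "rot (resolve \<rho> ?M) d = rot (disjoint_union (resolve \<rho> K) L) d"
    proof (cases "d \<in> darts K")
      case True
      then have v: "vertex ?M d = vertex K d" using vertex_disjoint_union[OF assms(1,2)] by blast
      have o: "d \<in> over ?M \<longleftrightarrow> d \<in> over K" using over_empty[OF assms(3)] by simp
      have r3: "rot ?M (rot ?M (rot ?M d)) = rot K (rot K (rot K d))"
        using True r[of d] r[of "rot K d"] by simp
      have "rot (resolve \<rho> ?M) d = rot (resolve \<rho> K) d"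
      proof (cases "\<rho> (vertex K d)")
        case None
        then show ?thesis using True v by (simp add: rot_resolve_None)
      next
        case (Some k)
        then show ?thesis using True v o r3 by (simp add: rot_resolve_Some over_empty[OF assms(3)])
      qed
      then show ?thesis using True by simp
    next
      case False
      then have "vertex ?M d \<notin> dom \<rho>"
        using assms(4) crossing_subset[OF assms(1)] self_in_vertex[of d ?M] by blast
      then have "rot (resolve \<rho> ?M) d = rot ?M d" by (auto intro: rot_resolve_None)
      then show ?thesis using False by simp
    qed
  qed
qed (simp_all add: edge_disjoint_union over_empty[OF assms(3)] cong: if_cong)

lemma state_sum_disjoint_circle:
  assumes L: "link_diagram L" and U: "circle U" and disj: "darts L \<inter> darts U = {}"
  shows "state_sum (disjoint_union L U) = (q_pow 1 + q_pow (- 1)) * state_sum L"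
proof -
  have dL: "diagram L" "ends L = []" using L by (auto simp: link_diagram_def)
  have U': "link_diagram U" "crossings U = {}" "card (components U) = 1" using U by (auto simp: circle_def)
  have "card (components (resolve \<rho> (disjoint_union L U))) = Suc (card (components (resolve \<rho> L)))"
    if "\<rho> \<in> maps (crossings L) {0, 1}" for \<rho>
  proof -
    have dom: "dom \<rho> \<subseteq> crossings L" using that by (simp add: maps_def)
    show ?thesis
      using link_disjoint_union(2)[OF link_diagram_resolve[OF L dom] U'(1)] disj U'(3)
      by (simp add: resolve_disjoint_union[OF dL U'(2) dom])
  qed
  then show ?thesis
    unfolding state_sum_def crossings_disjoint_union[OF dL U'(2)] sum_distrib_left
    by (intro sum.cong) simp_all
qed

lemma is_unnormalized_jones_state_sum:
  "is_unnormalized_jones (\<lambda>L. if link_diagram L then state_sum L else 0)"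
  unfolding is_unnormalized_jones_def
proof (intro conjI allI impI ballI)
  fix L :: "'d diagram"
  assume L: "link_diagram L \<and> darts L = {}"
  then have "over L = {}" by (auto simp: link_diagram_def diagram_def)
  then have "crossings L = {}" by (simp add: crossings_def)
  then show "(if link_diagram L then state_sum L else 0) = 1"
    using L by (simp add: state_sum_crossingless components_def quotient_eq_image)
next
  fix U :: "'d diagram"
  assume "circle U"
  then show "(if link_diagram U then state_sum U else 0) = q_pow 1 + q_pow (- 1)"
    by (simp add: circle_def state_sum_crossingless)
next
  fix L U :: "'d diagram"
  assume "link_diagram L \<and> circle U \<and> darts L \<inter> darts U = {}"
  then show "(if link_diagram (disjoint_union L U) then state_sum (disjoint_union L U) else 0) =
      (q_pow 1 + q_pow (- 1)) * (if link_diagram L then state_sum L else 0)"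
    using link_disjoint_union(1)[of L U] state_sum_disjoint_circle[of L U] by (auto simp: circle_def)
next
  fix L :: "'d diagram" and c
  assume c: "c \<in> crossings L" and L: "link_diagram L"
  have "link_diagram (resolve [c \<mapsto> k] L)" for k
    by (rule link_diagram_resolve[OF L]) (use c in simp)
  then show "(if link_diagram L then state_sum L else 0) =
      (if link_diagram (resolve [c \<mapsto> 0] L) then state_sum (resolve [c \<mapsto> 0] L) else 0) -
      q_pow 1 * (if link_diagram (resolve [c \<mapsto> 1] L) then state_sum (resolve [c \<mapsto> 1] L) else 0)"
    using state_sum_skein[OF _ c] L by (simp add: link_diagram_def)
qed simp

section \<open>The defining relations determine the polynomial\<close>

lemma split_off_circle:
  assumes L: "link_diagram L" and cr: "crossings L = {}" and d: "d \<in> darts L"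
  obtains K U where "link_diagram K" "circle U" "crossings K = {}" "darts K \<inter> darts U = {}"
    "L = disjoint_union K U" "card (darts K) < card (darts L)"
proof -
  have dL: "diagram L" "ends L = []" "planar_map L" using L by (auto simp: link_diagram_def)
  define C where "C = joined L `` {d}"
  define K where "K = L\<lparr>darts := darts L - C\<rparr>"
  define U where "U = L\<lparr>darts := C\<rparr>"
  have ov: "over L = {}" using over_empty[OF cr] .
  have j: "joined L = conn (gr (edge L) (darts L) \<union> gr (rot L) (darts L))"
    using dL(2) by (simp add: joined_eq_conn)
  have e: "edge L x \<in> darts L" "edge L x \<noteq> x" "edge L (edge L x) = x" if "x \<in> darts L" for x
    using diagramD(5-7)[OF dL(1) that] .
  have r: "rot L x \<in> darts L" "rot L x \<noteq> x" "rot L (rot L x) = x" if "x \<in> darts L" for x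
  proof -
    have x: "x \<in> darts L - set (ends L)" using that dL(2) by simp
    show "rot L x \<in> darts L" "rot L x \<noteq> x" using diagram_rot(1,2)[OF dL(1) x] by auto
    show "rot L (rot L x) = x" using diagram_rot(4)[OF dL(1) x] ov by blast
  qed
  have "gr (edge L) (darts L) \<union> gr (rot L) (darts L) \<subseteq> darts L \<times> darts L"
    using e(1) r(1) by (auto simp: gr_def)
  then have CD: "C \<subseteq> darts L" using conn_in[OF _ _ d] by (auto simp: C_def j)
  have step: "(x, edge L x) \<in> joined L" "(x, rot L x) \<in> joined L" if "x \<in> darts L" for x
    unfolding j using that by (auto simp: gr_def intro!: conn_base)
  have Ce: "edge L x \<in> C \<longleftrightarrow> x \<in> C" and Cr: "rot L x \<in> C \<longleftrightarrow> x \<in> C" if "x \<in> darts L" for x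
    using step[OF that] unfolding C_def j by (auto intro: conn_trans conn_sym)
  have sub: "diagram (L\<lparr>darts := A\<rparr>)" if "A \<subseteq> darts L" "\<And>x. x \<in> A \<Longrightarrow> edge L x \<in> A \<and> rot L x \<in> A" for A
    unfolding diagram_def using that e r ov dL(2) diagramD(1)[OF dL(1)] by (auto intro: finite_subset)
  have dK: "diagram K" unfolding K_def by (rule sub) (use e r Ce Cr in auto)
  have dU: "diagram U" unfolding U_def by (rule sub) (use CD Ce Cr in auto)
  have ends: "ends K = []" "ends U = []" using dL(2) by (auto simp: K_def U_def)
  have disj: "darts K \<inter> darts U = {}" by (auto simp: K_def U_def)
  have "planar_map K \<and> planar_map U"
    using planar_map_Un(1)[OF combinatorial_map_link[OF dK ends(1)] combinatorial_map_link[OF dU ends(2)] disj, of L]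
      CD dL(2,3) by (auto simp: K_def U_def)
  then have lK: "link_diagram K" and lU: "link_diagram U" using dK dU ends by (auto simp: link_diagram_def)
  have dC: "d \<in> C" by (simp add: C_def j)
  have "components U = {C}"
  proof -
    have jU: "joined U = conn (gr (edge L) C \<union> gr (rot L) C)"
      using ends by (simp add: joined_eq_conn U_def)
    have "joined U `` {x} = C" if "x \<in> C" for x
    proof -
      have "gr (edge L) (darts L) \<union> gr (rot L) (darts L) =
          (gr (edge L) C \<union> gr (rot L) C) \<union> (gr (edge L) (darts L - C) \<union> gr (rot L) (darts L - C))"
        using CD by (auto simp: gr_def)
      moreover have "conn ((gr (edge L) C \<union> gr (rot L) C) \<union> (gr (edge L) (darts L - C) \<union> gr (rot L) (darts L - C))) `` {x} =
          conn (gr (edge L) C \<union> gr (rot L) C) `` {x}"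
        by (rule conn_Un_separate[of _ C _ "darts L - C"]) (use that e r Ce Cr CD in \<open>auto simp: gr_def\<close>)
      ultimately have "joined U `` {x} = joined L `` {x}" by (simp add: j jU)
      also have "\<dots> = C" using that conn_class_eq_iff unfolding C_def j by (auto intro: conn_sym conn_trans)
      finally show ?thesis .
    qed
    then have "components U = (\<lambda>x. C) ` C"
      unfolding components_def quotient_eq_image by (intro image_cong) (auto simp: U_def)
    then show ?thesis using dC by auto
  qed
  then have "circle U" using lU ov by (simp add: circle_def crossings_def U_def)
  \<comment> \<open>Both parts keep the functions of \<open>L\<close> and only shrink the set of
    darts. So the records are equal also off the darts, and no change of the dart type or renaming
    is involved.\<close>
  moreover have "L = disjoint_union K U"
    using ov dL(2) CD by (intro diagram.equality) (auto simp: disjoint_union_def K_def U_def)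
  moreover have "card (darts K) < card (darts L)"
    unfolding K_def using dC d diagramD(1)[OF dL(1)] by (auto intro!: psubset_card_mono)
  moreover have "crossings K = {}" using ov by (simp add: crossings_def K_def)
  ultimately show thesis using that lK disj by blast
qed

text \<open>Two nested inductions: the skein relation lowers the number of crossings, and for a
  crossingless diagram splitting off a circle lowers the number of darts. Off the link diagrams both
  functions are 0.\<close>

lemma unnormalized_jones_unique:
  assumes J: "is_unnormalized_jones J" and J': "is_unnormalized_jones J'"
  shows "J L = J' L"
proof (cases "link_diagram L")
  case False
  then show ?thesis using J J' by (simp add: is_unnormalized_jones_def)
next
  case True
  have crossingless: "J L = J' L" if "link_diagram L" "crossings L = {}" for L
    using that
  proof (induction "card (darts L)" arbitrary: L rule: less_induct)
    case less
    show ?case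
    proof (cases "darts L = {}")
      case True
      then show ?thesis using less.prems J J' by (simp add: is_unnormalized_jones_def)
    next
      case False
      then obtain d where "d \<in> darts L" by blast
      then obtain K U where K: "link_diagram K" "circle U" "crossings K = {}" "darts K \<inter> darts U = {}"
          "L = disjoint_union K U" "card (darts K) < card (darts L)"
        using split_off_circle[OF less.prems] by metis
      have "J K = J' K" using less.hyps[OF K(6,1,3)] .
      then show ?thesis using K J J' by (simp add: is_unnormalized_jones_def)
    qed
  qed
  show ?thesis using True
  proof (induction "card (crossings L)" arbitrary: L)
    case 0
    then have "crossings L = {}" using finite_crossings[of L] by (simp add: link_diagram_def)
    then show ?case using crossingless 0 by blast
  next
    case (Suc n)
    then obtain c where c: "c \<in> crossings L" by (metis all_not_in_conv card.empty nat.distinct(1))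
    have dL: "diagram L" using Suc.prems by (simp add: link_diagram_def)
    have dom: "dom [c \<mapsto> k] \<subseteq> crossings L" for k :: nat using c by simp
    have "J (resolve [c \<mapsto> k] L) = J' (resolve [c \<mapsto> k] L)" for k
    proof (rule Suc.hyps(1))
      show "n = card (crossings (resolve [c \<mapsto> k] L))"
        using crossings_resolve[OF dL dom] c finite_crossings[OF dL] Suc.hyps(2) by simp
      show "link_diagram (resolve [c \<mapsto> k] L)" by (rule link_diagram_resolve[OF Suc.prems dom])
    qed
    then show ?case using J J' c Suc.prems by (simp add: is_unnormalized_jones_def)
  qed
qed

text \<open>The definite description needs existence as well as uniqueness. The state sum is
  extended by 0 beyond link diagrams, as the first conjunct of \<open>is_unnormalized_jones\<close>
  demands.\<close>

lemma unnormalized_jones_eq: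
  fixes L :: "'d diagram"
  assumes "link_diagram L"
  shows "unnormalized_jones L = state_sum L"
proof -
  let ?J = "\<lambda>L :: 'd diagram. if link_diagram L then state_sum L else 0"
  have "unnormalized_jones = ?J"
    unfolding unnormalized_jones_def
  proof (rule the_equality)
    show "is_unnormalized_jones ?J" by (rule is_unnormalized_jones_state_sum)
    show "J = ?J" if "is_unnormalized_jones J" for J :: "'d diagram \<Rightarrow> laurent"
      by (rule ext) (rule unnormalized_jones_unique[OF that is_unnormalized_jones_state_sum])
  qed
  from fun_cong[OF this, of L] show ?thesis using assms by simp
qed

section \<open>The arcs of a crossingless tangle\<close>

lemma crossingless_rot:
  assumes "diagram T" "crossings T = {}" "d \<in> darts T - set (ends T)"
  shows "rot T d \<in> darts T - set (ends T)" "rot T d \<noteq> d" "rot T (rot T d) = d"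
  using diagram_rot(1,2,4)[OF assms(1,3)] over_empty[OF assms(2)] by auto

lemma joined_step:
  assumes "d \<in> darts T"
  shows "(d, edge T d) \<in> joined T" "d \<notin> set (ends T) \<Longrightarrow> (d, rot T d) \<in> joined T"
  unfolding joined_eq_conn using assms by (auto simp: gr_def intro!: conn_base)

lemma joined_sym: "(x, y) \<in> joined T \<Longrightarrow> (y, x) \<in> joined T"
  unfolding joined_eq_conn by (rule conn_sym)

lemma joined_trans: "(x, y) \<in> joined T \<Longrightarrow> (y, z) \<in> joined T \<Longrightarrow> (x, z) \<in> joined T"
  unfolding joined_eq_conn by (rule conn_trans)

lemma joined_refl [simp]: "(x, x) \<in> joined T"
  unfolding joined_eq_conn by simp

lemma joined_closed:
  assumes "(x, y) \<in> joined T" "x \<in> Q"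
    and "\<And>d. d \<in> darts T \<Longrightarrow> edge T d \<in> Q \<longleftrightarrow> d \<in> Q"
    and "\<And>d. d \<in> darts T - set (ends T) \<Longrightarrow> rot T d \<in> Q \<longleftrightarrow> d \<in> Q"
  shows "y \<in> Q"
  using assms(1) unfolding joined_eq_conn
proof (induction rule: conn_induct)
  case base
  show ?case by (rule assms(2))
next
  case (fwd y z)
  then show ?case using assms(3)[of y] assms(4)[of y] by (auto simp: gr_def)
next
  case (bwd y z)
  then show ?case using assms(3)[of z] assms(4)[of z] by (auto simp: gr_def)
qed

text \<open>The strand through a boundary point \<open>p\<close> is an orbit of the dihedral group generated by the
  involutions \<open>edge\<close> and \<open>s\<close>, where \<open>s\<close> is \<open>rot\<close>, except that it fixes the boundary points.  Since
  \<open>edge\<close> has no fixed points, the orbit contains exactly two fixed points of \<open>s\<close>, at opposite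
  positions.\<close>

lemma strand:
  assumes T: "diagram T" and cl: "crossings T = {}" and p: "p \<in> set (ends T)"
  obtains q where "q \<in> set (ends T)" "q \<noteq> p" "(p, q) \<in> joined T"
    "\<And>x. x \<in> set (ends T) \<Longrightarrow> (p, x) \<in> joined T \<Longrightarrow> x = p \<or> x = q"
    "(p, rot (collapse S T) q) \<in> conn (gr (rot (collapse S T) \<circ> edge T) (darts T))"
proof -
  let ?E = "set (ends T)" and ?D = "darts T" and ?e = "edge T"
  define s where "s d = (if d \<in> ?E then d else rot T d)" for d
  have e: "?e d \<in> ?D" "?e d \<noteq> d" "?e (?e d) = d" if "d \<in> ?D" for d using diagramD(5-7)[OF T that] .
  have ED: "?E \<subseteq> ?D" by (rule diagramD(3)[OF T])
  have s: "s d \<in> ?D" "s (s d) = d" "s d = d \<longleftrightarrow> d \<in> ?E" if "d \<in> ?D" for d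
    using crossingless_rot[OF T cl, of d] that by (auto simp: s_def)
  define g where "g d = s (?e d)" for d
  have gD: "g d \<in> ?D" if "d \<in> ?D" for d using e(1)[OF that] s(1) by (simp add: g_def)
  have g_inv: "?e (s (g d)) = d" if "d \<in> ?D" for d using e[OF that] s(2) by (simp add: g_def)
  have bij: "bij_betw g ?D ?D"
  proof (rule bij_betw_byWitness[where f' = "\<lambda>d. ?e (s d)"])
    show "\<forall>d\<in>?D. ?e (s (g d)) = d" using g_inv by blast
    show "\<forall>d\<in>?D. g (?e (s d)) = d" using e(3) s(1,2) by (simp add: g_def)
  qed (use gD e(1) s(1) in auto)
  \<comment> \<open>The strand is traversed by alternately following an edge and passing a bivalent
    point. As \<open>s\<close> fixes the boundary points, the walk turns around there and is
    periodic; \<open>m\<close> below is its period.\<close>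
  define f where "f k = (g ^^ k) p" for k
  have f0: "f 0 = p" and fS: "f (Suc k) = g (f k)" for k by (simp_all add: f_def)
  have pD: "p \<in> ?D" using p ED by blast
  have fD: "f k \<in> ?D" for k by (induction k) (simp_all add: f0 fS pD gD)
  have "p \<in> orbit g p" using orbit_eq_conn[OF bij diagramD(1)[OF T] pD] by simp
  then have "\<exists>n>0. f n = p" by (auto simp: orbit_altdef f_def)
  then obtain m where m: "m > 0" "f m = p" and min: "\<And>k. 0 < k \<Longrightarrow> k < m \<Longrightarrow> f k \<noteq> p"
    using LeastI_ex[of "\<lambda>n. n > 0 \<and> f n = p"] not_less_Least[of _ "\<lambda>n. n > 0 \<and> f n = p"] by blast
  have g_eq: "g x = g y \<longleftrightarrow> x = y" if "x \<in> ?D" "y \<in> ?D" for x y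
    using g_inv[OF that(1)] g_inv[OF that(2)] by metis
  have dist: "f i \<noteq> f j" if "i < j" "j < m" for i j
    using that
  proof (induction i arbitrary: j)
    case 0
    then show ?case using min[of j] by (auto simp: f0)
  next
    case (Suc i)
    then obtain j' where "j = Suc j'" by (cases j) auto
    then show ?case using Suc g_eq[OF fD fD] by (simp add: fS)
  qed
  \<comment> \<open>In the dihedral picture \<open>s\<close> reflects the positions modulo
    \<open>m\<close> about 0, and by \<open>edge_f\<close> the edge involution reflects them about a
    half-integral point. The boundary points are the fixed positions of the first
    reflection.\<close>
  have refl: "s (f k) = f (m - k)" if "k \<le> m" for k
    using that
  proof (induction k)
    case 0
    then show ?case using m(2) p by (simp add: f0 s_def)
  next
    case (Suc k)
    then have "g (f (m - Suc k)) = f (m - k)" using fS[of "m - Suc k"] by (simp add: Suc_diff_Suc)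
    also have "\<dots> = s (f k)" using Suc by simp
    also have "\<dots> = g (?e (f k))" using e(3)[OF fD] by (simp add: g_def)
    finally have "f (m - Suc k) = ?e (f k)" using g_eq fD e(1) by blast
    then show ?case using s(2)[OF e(1)[OF fD]] by (simp add: fS g_def)
  qed
  have edge_f: "?e (f k) = f (m - Suc k)" if "k < m" for k
  proof -
    have "f (m - Suc k) = s (f (Suc k))" using refl[of "Suc k"] that by simp
    then show ?thesis using s(2)[OF e(1)[OF fD]] by (simp add: fS g_def)
  qed
  \<comment> \<open>For odd \<open>m\<close> the middle position would be fixed by
    \<open>edge\<close>.\<close>
  have "even m"
  proof (rule ccontr)
    assume "odd m"
    then obtain k where "m = Suc (2 * k)" by (metis oddE Suc_eq_plus1)
    then have "?e (f k) = f k" using edge_f[of k] by simp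
    then show False using e(2)[OF fD] by blast
  qed
  then obtain h where h: "m = 2 * h" by (elim evenE)
  have h0: "h > 0" using h m(1) by simp
  have end_iff: "f k \<in> ?E \<longleftrightarrow> k = 0 \<or> k = h" if "k < m" for k
  proof -
    have "f k \<in> ?E \<longleftrightarrow> f (m - k) = f k" using s(3)[OF fD[of k]] refl[of k] that by simp
    also have "\<dots> \<longleftrightarrow> k = 0 \<or> k = h"
    proof (cases "k = 0")
      case True
      then show ?thesis using m by (simp add: f0)
    next
      case False
      then have "m - k < m" using that by simp
      then have "f (m - k) = f k \<longleftrightarrow> m - k = k"
        using dist[of k "m - k"] dist[of "m - k" k] that by (metis linorder_neqE_nat)
      then show ?thesis using h False that by auto
    qed
    finally show ?thesis .
  qed
  have qE: "f h \<in> ?E" using end_iff[of h] h h0 by simp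
  have qp: "f h \<noteq> p" using min[of h] h h0 by simp
  have sj: "(d, s d) \<in> joined T" if "d \<in> ?D" for d using joined_step(2)[OF that] by (simp add: s_def)
  have fj: "(p, f k) \<in> joined T" for k
  proof (induction k)
    case (Suc k)
    have "(f k, ?e (f k)) \<in> joined T" by (rule joined_step(1)[OF fD])
    moreover have "(?e (f k), f (Suc k)) \<in> joined T" using sj[OF e(1)[OF fD]] by (simp add: fS g_def)
    ultimately show ?case using Suc joined_trans by metis
  qed (simp add: f0)
  have cls: "x \<in> f ` {..<m}" if "(p, x) \<in> joined T" for x
    using that
  proof (rule joined_closed)
    show "p \<in> f ` {..<m}" using m(1) f0 by force
    have E: "?e d \<in> f ` {..<m}" if "d \<in> f ` {..<m}" for d
    proof -
      obtain k where "k < m" "d = f k" using \<open>d \<in> f ` {..<m}\<close> by auto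
      then show ?thesis using edge_f[of k] by auto
    qed
    have R: "s d \<in> f ` {..<m}" if "d \<in> f ` {..<m}" for d
    proof -
      obtain k where k: "k < m" "d = f k" using \<open>d \<in> f ` {..<m}\<close> by auto
      then have sd: "s d = f (m - k)" using refl[of k] by simp
      show ?thesis
      proof (cases "k = 0")
        case True
        then have "s d = f 0" using sd m f0 by simp
        then show ?thesis using m(1) by blast
      next
        case False
        then show ?thesis using sd k(1) by auto
      qed
    qed
    show "?e d \<in> f ` {..<m} \<longleftrightarrow> d \<in> f ` {..<m}" if "d \<in> ?D" for d
      using E[of d] E[of "?e d"] e(3)[OF that] by auto
    show "rot T d \<in> f ` {..<m} \<longleftrightarrow> d \<in> f ` {..<m}" if "d \<in> ?D - ?E" for d
      using R[of d] R[of "s d"] s(2)[of d] that by (auto simp: s_def)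
  qed
  have uniq: "x = p \<or> x = f h" if "x \<in> ?E" "(p, x) \<in> joined T" for x
    using cls[OF that(2)] end_iff that(1) f0 by auto
  let ?M = "collapse S T"
  \<comment> \<open>Before the walk meets the other end it stays at bivalent points, where
    \<open>rot\<close> of the collapsed map agrees with \<open>s\<close>. So the first half of the
    walk follows one face, and its last edge arrives at \<open>q\<close>, from which the face
    continues with \<open>rot q\<close>.\<close>
  have face: "(p, f k) \<in> conn (gr (rot ?M \<circ> ?e) ?D)" if "k < h" for k
    using that
  proof (induction k)
    case (Suc k)
    have "m - Suc k < m" "m - Suc k \<noteq> 0" "m - Suc k \<noteq> h" using Suc.prems h by auto
    then have "?e (f k) \<notin> ?E" using edge_f[of k] end_iff[of "m - Suc k"] Suc.prems h by auto
    then have "(rot ?M \<circ> ?e) (f k) = f (Suc k)" by (simp add: fS g_def s_def)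
    then show ?case using gr_base[OF fD, of k "rot ?M \<circ> ?e"] Suc conn_trans by fastforce
  qed (simp add: f0)
  have "?e (f (h - 1)) = f h" using edge_f[of "h - 1"] h h0 by simp
  then have "(rot ?M \<circ> ?e) (f (h - 1)) = rot ?M (f h)" by simp
  then have "(f (h - 1), rot ?M (f h)) \<in> conn (gr (rot ?M \<circ> ?e) ?D)"
    using gr_base[OF fD, of "h - 1" "rot ?M \<circ> ?e"] by simp
  then have "(p, rot ?M (f h)) \<in> conn (gr (rot ?M \<circ> ?e) ?D)"
    using face[of "h - 1"] h0 conn_trans by fastforce
  then show thesis using that[OF qE qp fj uniq] by blast
qed

section \<open>Arcs do not cross\<close>

lemma conn_nth_chain:
  assumes "u \<le> v" "\<And>x. u \<le> x \<Longrightarrow> x < v \<Longrightarrow> (ps ! x, ps ! Suc x) \<in> conn G"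
  shows "(ps ! u, ps ! v) \<in> conn G"
  using assms by (induction v rule: dec_induct) (auto intro: conn_trans)

lemma cycle_of_list_nth:
  assumes "distinct ps" "x < length ps"
  shows "cycle_of_list ps (ps ! x) = ps ! (Suc x mod length ps)"
proof -
  have "map (cycle_of_list ps) ps = rotate1 ps"
    using cyclic_rotation[of ps 1] assms(1) by simp
  then have "cycle_of_list ps (ps ! x) = rotate1 ps ! x" using assms(2) by (metis nth_map)
  then show ?thesis using assms(2) by (simp add: nth_rotate1)
qed

text \<open>Both sides of an arc from \<open>p\<^sub>i\<close> to \<open>p\<^sub>k\<close> are faces, so the collapsed vertex can be split into
  one with the ends \<open>p\<^sub>i, \<dots>, p\<^sub>k\<close> and one with the other ends; as the map has genus zero, this
  disconnects it.\<close>

lemma no_crossing_arcs: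
  assumes tangle: "tangle S T" and cl: "crossings T = {}"
    and ps: "distinct ps" "set ps = set (ends T)"
      "\<And>d. d \<in> set ps \<Longrightarrow> rot (collapse S T) d = cycle_of_list ps d"
    and ijkl: "i < j" "j < k" "k < l" "l < length ps"
    and ik: "(ps ! i, ps ! k) \<in> joined T" and jl: "(ps ! j, ps ! l) \<in> joined T"
  shows False
proof -
  let ?N = "length ps" and ?M = "collapse S T"
  have T: "diagram T" and pl: "planar_map ?M" using tangle by (auto simp: tangle_def)
  have psD: "ps ! x \<in> darts T" if "x < ?N" for x using diagramD(3)[OF T] ps(2) that nth_mem by blast
  have eq: "ps ! x = ps ! y \<longleftrightarrow> x = y" if "x < ?N" "y < ?N" for x y
    using nth_eq_iff_index_eq[OF ps(1) that] .
  have rM: "rot ?M (ps ! x) = ps ! (Suc x mod ?N)" if "x < ?N" for x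
    using ps(3)[OF nth_mem[OF that]] cycle_of_list_nth[OF ps(1) that] by simp
  \<comment> \<open>The cyclic predecessor of position \<open>i\<close>. The face condition of
    \<open>planar_split\<close> concerns the successors of the two split darts, and the strand
    connects the face of \<open>ps ! i\<close> with that of the successor of \<open>ps ! k\<close>;
    so the split has to be made at \<open>ps ! u\<close> and \<open>ps ! k\<close>.\<close>
  define u where "u = (if i = 0 then ?N - 1 else i - 1)"
  have "Suc (?N - 1) = ?N" using ijkl by simp
  then have u: "u < ?N" "Suc u mod ?N = i" "u \<noteq> k" using ijkl by (auto simp: u_def)
  define a where "a = ps ! u"
  define b where "b = ps ! k"
  have ab: "a \<in> darts ?M" "b \<in> darts ?M" "a \<noteq> b" using psD u ijkl eq by (auto simp: a_def b_def)
  have ra: "rot ?M a = ps ! i" using rM[OF u(1)] u(2) by (simp add: a_def)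
  have rb: "rot ?M b = ps ! Suc k" using rM[of k] ijkl by (simp add: b_def)
  have chain: "(ps ! 0, ps ! x) \<in> conn (gr (rot ?M) (darts ?M))" if "x < ?N" for x
  proof (rule conn_nth_chain)
    show "(ps ! y, ps ! Suc y) \<in> conn (gr (rot ?M) (darts ?M))" if "0 \<le> y" "y < x" for y
      using gr_base[of "ps ! y" "darts ?M" "rot ?M"] rM[of y] psD[of y] that \<open>x < ?N\<close> by simp
  qed simp
  have same: "(a, b) \<in> conn (gr (rot ?M) (darts ?M))"
    using chain[OF u(1)] chain[of k] ijkl unfolding a_def b_def by (auto intro: conn_trans conn_sym)
  have iE: "ps ! i \<in> set (ends T)" and kE: "ps ! k \<in> set (ends T)" and "ps ! i \<noteq> ps ! k"
    using ps(2) nth_mem[of i ps] nth_mem[of k ps] ijkl eq[of i k] by auto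
  obtain q where q: "\<And>x. x \<in> set (ends T) \<Longrightarrow> (ps ! i, x) \<in> joined T \<Longrightarrow> x = ps ! i \<or> x = q"
    "(ps ! i, rot ?M q) \<in> conn (gr (rot ?M \<circ> edge T) (darts T))"
    using strand[OF T cl iE, where S = S] by metis
  have "q = ps ! k" using q(1)[OF kE ik] \<open>ps ! i \<noteq> ps ! k\<close> by auto
  then have "(rot ?M a, rot ?M b) \<in> conn (gr (rot ?M \<circ> edge ?M) (darts ?M))"
    using q(2) ra by (simp add: b_def)
  moreover define M' where "M' = ?M\<lparr>rot := rot ?M \<circ> transpose a b\<rparr>"
  ultimately have "(a, b) \<notin> joined M'"
    using planar_split(2)[OF combinatorial_map_collapse[OF T] pl ab same, of M'] by (simp add: M'_def)
  \<comment> \<open>The contradictory path starts at \<open>b\<close>, continues in its half of the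
    vertex from \<open>ps ! i\<close> to \<open>ps ! j\<close>, crosses to \<open>ps ! l\<close>
    along the second arc, and returns to \<open>a\<close> through \<open>ps ! Suc k\<close> in the
    other half.\<close>
  moreover have "(a, b) \<in> joined M'"
  proof -
    have M': "darts M' = darts T" "edge M' = edge T" "ends M' = []" by (simp_all add: M'_def)
    have jM: "joined M' = conn (gr (edge T) (darts T) \<union> gr (rot M') (darts T))"
      by (simp add: joined_eq_conn M')
    have r: "(d, rot M' d) \<in> joined M'" if "d \<in> darts T" for d
      using joined_step(2)[of d M'] that by (simp add: M')
    have rM': "rot M' (ps ! x) = ps ! Suc x" if "Suc x < ?N" "x \<noteq> u" "x \<noteq> k" for x
      using that rM[of x] eq[of x u] eq[of x k] u(1) ijkl by (simp add: M'_def a_def b_def transpose_def)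
    have "(b, ps ! i) \<in> joined M'" using r[of b] ab ra by (simp add: M'_def)
    moreover have "(ps ! i, ps ! j) \<in> joined M'"
      unfolding jM
    proof (rule conn_nth_chain)
      fix x assume x: "i \<le> x" "x < j"
      then have "x \<noteq> u" unfolding u_def using ijkl by (cases "i = 0") auto
      then have "rot M' (ps ! x) = ps ! Suc x" using rM'[of x] x ijkl by simp
      then show "(ps ! x, ps ! Suc x) \<in> conn (gr (edge T) (darts T) \<union> gr (rot M') (darts T))"
        using r[OF psD, of x] x ijkl unfolding jM by simp
    qed (use ijkl in simp)
    moreover have "(ps ! j, ps ! l) \<in> joined M'"
    proof -
      \<comment> \<open>Connections in \<open>T\<close> never turn at a boundary point, and the
        split affects only the rotation at boundary points, so they all persist.\<close>
      have "gr (edge T) (darts T) \<union> gr (rot T) (darts T - set (ends T)) \<subseteq> conn (gr (edge T) (darts T) \<union> gr (rot M') (darts T))"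
      proof (intro Un_least subsetI)
        fix z assume "z \<in> gr (rot T) (darts T - set (ends T))"
        then obtain d where d: "d \<in> darts T - set (ends T)" "z = (d, rot T d)" by (auto simp: gr_def)
        moreover have "d \<noteq> a" "d \<noteq> b"
          using d(1) ps(2) nth_mem[OF u(1)] kE by (auto simp: a_def b_def)
        then have "rot M' d = rot T d" using d(1) by (simp add: M'_def)
        ultimately show "z \<in> conn (gr (edge T) (darts T) \<union> gr (rot M') (darts T))"
          using r[of d] unfolding jM by simp
      qed (auto intro: conn_base)
      then show ?thesis using jl conn_least unfolding jM joined_eq_conn[of T] by blast
    qed
    moreover have "(a, ps ! Suc k) \<in> joined M'" using r[of a] ab rb by (simp add: M'_def)
    moreover have "(ps ! Suc k, ps ! l) \<in> joined M'"
      unfolding jM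
    proof (rule conn_nth_chain)
      fix x assume x: "Suc k \<le> x" "x < l"
      then have "x \<noteq> u" unfolding u_def using ijkl by (cases "i = 0") auto
      then have "rot M' (ps ! x) = ps ! Suc x" using rM'[of x] x ijkl by simp
      then show "(ps ! x, ps ! Suc x) \<in> conn (gr (edge T) (darts T) \<union> gr (rot M') (darts T))"
        using r[OF psD, of x] x ijkl unfolding jM by simp
    qed (use ijkl in simp)
    ultimately show ?thesis by (meson joined_sym joined_trans)
  qed
  ultimately show False by blast
qed

lemma arcs_partner:
  assumes "diagram T" "crossings T = {}" "p \<in> set (ends T)"
  obtains q where "q \<in> set (ends T)" "q \<noteq> p" "(p, q) \<in> joined T"
    "\<And>x. x \<in> set (ends T) \<Longrightarrow> (p, x) \<in> joined T \<Longrightarrow> x = p \<or> x = q"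
  using strand[OF assms, where S = Inside] by metis

lemma arcsI: "a \<in> set (ends T) \<Longrightarrow> b \<in> set (ends T) \<Longrightarrow> a \<noteq> b \<Longrightarrow> (a, b) \<in> joined T \<Longrightarrow> {a, b} \<in> arcs T"
  by (auto simp: arcs_def)

lemma arcsD:
  assumes "{a, b} \<in> arcs T"
  shows "a \<in> set (ends T)" "b \<in> set (ends T)" "a \<noteq> b" "(a, b) \<in> joined T"
proof -
  obtain c d where cd: "{a, b} = {c, d}" "c \<in> set (ends T)" "d \<in> set (ends T)" "c \<noteq> d" "(c, d) \<in> joined T"
    using assms by (auto simp: arcs_def)
  then have "a = c \<and> b = d \<or> a = d \<and> b = c" by (simp add: doubleton_eq_iff)
  then show "a \<in> set (ends T)" "b \<in> set (ends T)" "a \<noteq> b" "(a, b) \<in> joined T"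
    using cd joined_sym by auto
qed

text \<open>Each boundary point has exactly one partner, by following its strand, so the arcs form a
  partition into pairs. Crossing pairs are excluded by the genus argument.\<close>

lemma planar_matching_arcs:
  assumes tangle: "tangle S T" and cl: "crossings T = {}"
  shows "planar_matching (ends T) (arcs T)"
  unfolding planar_matching_def
proof (intro conjI)
  have T: "diagram T" using tangle by (simp add: tangle_def)
  show "partition_on (set (ends T)) (arcs T)"
  proof (rule partition_onI)
    show "\<Union> (arcs T) = set (ends T)"
    proof (intro equalityI subsetI)
      fix p assume p: "p \<in> set (ends T)"
      obtain q where "q \<in> set (ends T)" "q \<noteq> p" "(p, q) \<in> joined T"
        using arcs_partner[OF T cl p] by metis
      then have "{p, q} \<in> arcs T" using p by (intro arcsI) auto
      then show "p \<in> \<Union> (arcs T)" by blast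
    qed (auto simp: arcs_def)
    show "{} \<notin> arcs T" by (auto simp: arcs_def)
    fix X Y assume XY: "X \<in> arcs T" "Y \<in> arcs T" "X \<noteq> Y"
    show "disjnt X Y"
    proof (rule ccontr)
      assume "\<not> disjnt X Y"
      then obtain p where p: "p \<in> X" "p \<in> Y" by (auto simp: disjnt_def)
      obtain c d where cd: "X = {c, d}" using XY(1) by (auto simp: arcs_def)
      obtain c' d' where cd': "Y = {c', d'}" using XY(2) by (auto simp: arcs_def)
      obtain x where x: "X = {p, x}" using p(1) cd by auto
      obtain y where y: "Y = {p, y}" using p(2) cd' by auto
      have p': "p \<in> set (ends T)" using arcsD(1) XY(1) x by metis
      obtain q where q: "\<And>z. z \<in> set (ends T) \<Longrightarrow> (p, z) \<in> joined T \<Longrightarrow> z = p \<or> z = q"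
        using arcs_partner[OF T cl p'] by metis
      have "x = q" using arcsD[of p x T] XY(1) x q by metis
      moreover have "y = q" using arcsD[of p y T] XY(2) y q by metis
      ultimately show False using XY(3) x y by simp
    qed
  qed
  show "\<forall>b\<in>arcs T. card b = 2" by (auto simp: arcs_def)
  let ?es = "ends T"
  have dist: "distinct ?es" by (rule diagramD(2)[OF T])
  show "\<not> (\<exists>i j k l. i < j \<and> j < k \<and> k < l \<and> l < length ?es \<and>
          {?es ! i, ?es ! k} \<in> arcs T \<and> {?es ! j, ?es ! l} \<in> arcs T)"
  proof (intro notI, elim exE conjE)
    fix i j k l
    assume ijkl: "i < j" "j < k" "k < l" "l < length ?es"
      and "{?es ! i, ?es ! k} \<in> arcs T" "{?es ! j, ?es ! l} \<in> arcs T"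
    then have J: "(?es ! i, ?es ! k) \<in> joined T" "(?es ! j, ?es ! l) \<in> joined T"
      by (auto dest: arcsD(4))
    show False
    proof (cases S)
      case Outside
      then show False
        using no_crossing_arcs[OF tangle cl dist refl _ ijkl J] by (simp add: collapse_def)
    next
      case Inside
      \<comment> \<open>For a tangle outside, the points occur around the collapsed disc in reverse
        order. Reversal turns \<open>i < j < k < l\<close> into a chain of the same shape, with the
        roles of the two arcs exchanged.\<close>
      let ?r = "\<lambda>x. length ?es - Suc x"
      have nth: "rev ?es ! ?r x = ?es ! x" if "x < length ?es" for x
        using that by (simp add: rev_nth)
      have d: "distinct (rev ?es)" "set (rev ?es) = set ?es" using dist by simp_all
      have R: "rot (collapse S T) x = cycle_of_list (rev ?es) x" if "x \<in> set (rev ?es)" for x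
        using that Inside by (simp add: collapse_def)
      have "?r l < ?r k" "?r k < ?r j" "?r j < ?r i" "?r i < length (rev ?es)"
        using ijkl by auto
      moreover have "(rev ?es ! ?r l, rev ?es ! ?r j) \<in> joined T" "(rev ?es ! ?r k, rev ?es ! ?r i) \<in> joined T"
        using J nth ijkl by (simp_all add: joined_sym)
      ultimately show False using no_crossing_arcs[OF tangle cl d R] by blast
    qed
  qed
qed

section \<open>Closing a tangle by a matching\<close>

definition graph_of :: "'d diagram \<Rightarrow> ('d \<times> 'd) set" where
  "graph_of T = gr (edge T) (darts T) \<union> gr (rot T) (darts T - set (ends T))"

lemma joined_graph_of: "joined T = conn (graph_of T)"
  by (simp add: joined_eq_conn graph_of_def)

lemma graph_of_subset: "diagram T \<Longrightarrow> graph_of T \<subseteq> darts T \<times> darts T"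
  using diagramD(5)[of T] diagram_rot(1)[of T] by (auto simp: graph_of_def gr_def)

lemma planar_matchingD:
  assumes "planar_matching ps m"
  shows "partition_on (set ps) m" "b \<in> m \<Longrightarrow> card b = 2" "b \<in> m \<Longrightarrow> b \<subseteq> set ps"
proof -
  show 1: "partition_on (set ps) m" using assms by (simp add: planar_matching_def)
  show "b \<in> m \<Longrightarrow> card b = 2" using assms by (simp add: planar_matching_def)
  show "b \<in> m \<Longrightarrow> b \<subseteq> set ps" using partition_onD1[OF 1] by blast
qed

lemma block_eq_pair:
  assumes "planar_matching ps m" "b \<in> m" "p \<in> b" "q \<in> b" "p \<noteq> q"
  shows "b = {p, q}"
proof -
  have c: "card b = 2" using planar_matchingD(2)[OF assms(1,2)] .
  then have "finite b" using card.infinite by fastforce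
  moreover have "{p, q} \<subseteq> b" "card {p, q} = card b" using assms c by auto
  ultimately show ?thesis using card_subset_eq by metis
qed

lemma partner_unique:
  assumes m: "planar_matching ps m" and "{p, q} \<in> m" "{p, q'} \<in> m"
  shows "q' = q"
proof -
  have "{p, q} = {p, q'}"
    using partition_onD2[OF planar_matchingD(1)[OF m]] assms(2,3) by (auto dest: disjointD)
  moreover have "p \<noteq> q" "p \<noteq> q'" using planar_matchingD(2)[OF m] assms(2,3) by fastforce+
  ultimately show ?thesis by (auto simp: doubleton_eq_iff)
qed

lemma partner_exists:
  assumes m: "planar_matching ps m" and "p \<in> set ps"
  obtains q where "{p, q} \<in> m" "q \<noteq> p"
proof -
  obtain b where b: "b \<in> m" "p \<in> b"
    using partition_onD1[OF planar_matchingD(1)[OF m]] assms(2) by blast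
  have "card b = 2" using planar_matchingD(2)[OF m b(1)] .
  then have "\<not> b \<subseteq> {p}" using card_mono[of "{p}" b] by auto
  then obtain q where "q \<in> b" "q \<noteq> p" by blast
  then show thesis using block_eq_pair[OF m b(1) b(2), of q] b that by auto
qed

definition matching_rel :: "'p set set \<Rightarrow> ('p \<times> 'p) set" where
  "matching_rel m = {(p, q). {p, q} \<in> m}"

lemma glue_simps [simp]:
  "darts (glue T m) = darts T" "edge (glue T m) = edge T" "ends (glue T m) = []"
  "d \<notin> set (ends T) \<Longrightarrow> rot (glue T m) d = rot T d"
  by (simp_all add: glue_def)

text \<open>Every boundary point has a unique partner, so the definite description in
  \<open>glue\<close> can be traded for the relation of being matched, which \<open>conn\<close>
  handles directly.\<close>

lemma joined_glue:
  assumes T: "diagram T" and m: "planar_matching (ends T) m"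
  shows "joined (glue T m) = conn (graph_of T \<union> matching_rel m)"
proof -
  let ?E = "set (ends T)"
  have r: "rot (glue T m) p = q" if pq: "{p, q} \<in> m" for p q
  proof -
    have "p \<in> ?E" using planar_matchingD(3)[OF m pq] by auto
    then have "rot (glue T m) p = (THE q. {p, q} \<in> m)" by (simp add: glue_def)
    also have "\<dots> = q" by (rule the_equality[of "\<lambda>q. {p, q} \<in> m", OF pq]) (rule partner_unique[OF m pq])
    finally show ?thesis .
  qed
  have "gr (rot (glue T m)) ?E = matching_rel m"
  proof (intro equalityI subsetI)
    fix z assume "z \<in> gr (rot (glue T m)) ?E"
    then obtain p where p: "p \<in> ?E" "z = (p, rot (glue T m) p)" by (auto simp: gr_def)
    obtain q where "{p, q} \<in> m" using partner_exists[OF m p(1)] by metis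
    then show "z \<in> matching_rel m" using r p by (simp add: matching_rel_def)
  next
    fix z assume "z \<in> matching_rel m"
    then obtain p q where pq: "{p, q} \<in> m" "z = (p, q)" by (auto simp: matching_rel_def)
    moreover have "p \<in> ?E" using planar_matchingD(3)[OF m pq(1)] by auto
    ultimately show "z \<in> gr (rot (glue T m)) ?E" using r[of p q] by (auto simp: gr_def)
  qed
  moreover have "gr (rot (glue T m)) (darts T - ?E) = gr (rot T) (darts T - ?E)"
    by (rule gr_cong) simp
  moreover have "darts T = ?E \<union> (darts T - ?E)" using diagramD(3)[OF T] by auto
  ultimately have "gr (rot (glue T m)) (darts T) = matching_rel m \<union> gr (rot T) (darts T - ?E)"
    using gr_Un by metis
  then show ?thesis by (simp add: joined_eq_conn graph_of_def Un_ac)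
qed

definition curve_rel :: "'p cleaved \<Rightarrow> ('p \<times> 'p) set" where
  "curve_rel C = {(p, p'). \<exists>b\<in>inner C \<union> outer C. p \<in> b \<and> p' \<in> b}"

lemma curves_eq: "curves C = (\<lambda>p. (curve_rel C)\<^sup>* `` {p}) ` set (points C)"
  by (simp add: curves_def curve_rel_def quotient_eq_image)

text \<open>The curves of a cleaved link know only points on the equator, the circles of the glued
  diagram consist of darts. The two notions agree on the equator because a circle alternates between
  strands of \<open>T\<close> and pairs of \<open>m\<close>. Only the union of \<open>inner\<close>
  and \<open>outer\<close> enters, so both sides are covered.\<close>

lemma curve_class:
  assumes T: "diagram T" and m: "planar_matching (ends T) m"
    and C: "points C = ends T" "inner C \<union> outer C = arcs T \<union> m" and p: "p \<in> set (ends T)"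
  shows "(curve_rel C)\<^sup>* `` {p} = joined (glue T m) `` {p} \<inter> set (ends T)"
proof (intro equalityI subsetI)
  let ?E = "set (ends T)" and ?Q = "curve_rel C" and ?J = "conn (graph_of T \<union> matching_rel m)"
  have jT: "conn (graph_of T) \<subseteq> ?J" by (rule conn_mono) simp
  have Q: "y \<in> ?E \<and> z \<in> ?E \<and> (y, z) \<in> ?J" if yz: "(y, z) \<in> ?Q" for y z
  proof -
    obtain b where b: "b \<in> arcs T \<union> m" "y \<in> b" "z \<in> b" using yz C(2) by (auto simp: curve_rel_def)
    show ?thesis
    proof (cases "b \<in> arcs T")
      case True
      then obtain u v where "b = {u, v}" "{u, v} \<in> arcs T" by (auto simp: arcs_def)
      then have "u \<in> ?E" "v \<in> ?E" "(u, v) \<in> ?J"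
        using arcsD[of u v T] jT by (auto simp: joined_graph_of)
      then show ?thesis using b \<open>b = {u, v}\<close> by (auto intro: conn_sym)
    next
      case False
      then have bm: "b \<in> m" using b by blast
      have "(y, z) \<in> ?J"
      proof (cases "y = z")
        case False
        then have "{y, z} \<in> m" using block_eq_pair[OF m bm b(2,3)] bm by simp
        then show ?thesis by (intro conn_base) (simp add: matching_rel_def)
      qed simp
      then show ?thesis using planar_matchingD(3)[OF m bm] b by auto
    qed
  qed
  {
    fix x assume "x \<in> ?Q\<^sup>* `` {p}"
    then have "(p, x) \<in> ?Q\<^sup>*" by simp
    then have "x \<in> ?E \<and> (p, x) \<in> ?J"
    proof (induction rule: rtrancl_induct)
      case base
      then show ?case using p by simp
    next
      case (step y z)
      then show ?case using Q[of y z] conn_trans[of p y _ z] by blast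
    qed
    then show "x \<in> joined (glue T m) `` {p} \<inter> ?E" by (simp add: joined_glue[OF T m])
  }
  fix x assume x: "x \<in> joined (glue T m) `` {p} \<inter> ?E"
  have arc: "(y, z) \<in> ?Q\<^sup>*" if "y \<in> ?E" "z \<in> ?E" "(y, z) \<in> conn (graph_of T)" for y z
  proof (cases "y = z")
    case False
    then have "{y, z} \<in> arcs T" using that by (intro arcsI) (simp_all add: joined_graph_of)
    then have "(y, z) \<in> ?Q" using C(2) by (auto simp: curve_rel_def)
    then show ?thesis by blast
  qed simp
  have mate: "y \<in> ?E \<and> z \<in> ?E \<and> (y, z) \<in> ?Q \<and> (z, y) \<in> ?Q" if "(y, z) \<in> matching_rel m" for y z
  proof -
    have yz: "{y, z} \<in> m" using that by (simp add: matching_rel_def)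
    then show ?thesis using planar_matchingD(3)[OF m yz] C(2) by (auto simp: curve_rel_def)
  qed
  have "(p, x) \<in> ?J" using x by (simp add: joined_glue[OF T m])
  \<comment> \<open>Invariant along a path of darts: the current dart lies on the strand of some
    boundary point that the curve relation already reaches.\<close>
  then have "\<exists>p'\<in>?E. (p, p') \<in> ?Q\<^sup>* \<and> (p', x) \<in> conn (graph_of T)"
  proof (induction rule: conn_induct)
    case base
    then show ?case using p by auto
  next
    case (fwd y z)
    then obtain p' where p': "p' \<in> ?E" "(p, p') \<in> ?Q\<^sup>*" "(p', y) \<in> conn (graph_of T)" by blast
    from fwd(2) show ?case
    proof
      assume "(y, z) \<in> graph_of T"
      then show ?thesis using p' conn_trans[OF p'(3) conn_base] by blast
    next
      assume "(y, z) \<in> matching_rel m"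
      then have yz: "y \<in> ?E" "z \<in> ?E" "(y, z) \<in> ?Q" using mate by auto
      then have "(p, z) \<in> ?Q\<^sup>*" using p'(2) arc[OF p'(1) yz(1) p'(3)] by (meson rtrancl.rtrancl_into_rtrancl rtrancl_trans)
      then show ?thesis using yz(2) by auto
    qed
  next
    case (bwd y z)
    then obtain p' where p': "p' \<in> ?E" "(p, p') \<in> ?Q\<^sup>*" "(p', y) \<in> conn (graph_of T)" by blast
    from bwd(2) show ?case
    proof
      assume "(z, y) \<in> graph_of T"
      then show ?thesis using p' conn_trans[OF p'(3) conn_sym[OF conn_base]] by blast
    next
      assume "(z, y) \<in> matching_rel m"
      then have yz: "y \<in> ?E" "z \<in> ?E" "(y, z) \<in> ?Q" using mate by auto
      then have "(p, z) \<in> ?Q\<^sup>*" using p'(2) arc[OF p'(1) yz(1) p'(3)] by (meson rtrancl.rtrancl_into_rtrancl rtrancl_trans)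
      then show ?thesis using yz(2) by auto
    qed
  qed
  then obtain p' where "p' \<in> ?E" "(p, p') \<in> ?Q\<^sup>*" "(p', x) \<in> conn (graph_of T)" by blast
  then have "(p, x) \<in> ?Q\<^sup>*" using arc[of p' x] x by (meson IntD2 rtrancl_trans)
  then show "x \<in> ?Q\<^sup>* `` {p}" by simp
qed

lemma components_eq: "components T = (\<lambda>x. joined T `` {x}) ` darts T"
  by (simp add: components_def quotient_eq_image)

lemma component_eq:
  assumes "C \<in> components T" "x \<in> C"
  shows "C = joined T `` {x}"
proof -
  obtain y where y: "C = joined T `` {y}" using assms(1) by (auto simp: components_eq)
  then have "(y, x) \<in> joined T" using assms(2) by simp
  then show ?thesis unfolding y joined_graph_of by (simp add: conn_class_eq_iff)
qed

lemma components_eqI: "C \<in> components T \<Longrightarrow> C' \<in> components T \<Longrightarrow> x \<in> C \<Longrightarrow> x \<in> C' \<Longrightarrow> C = C'"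
  using component_eq[of C T x] component_eq[of C' T x] by simp

lemma component_nonempty: "C \<in> components T \<Longrightarrow> C \<noteq> {}"
proof -
  assume "C \<in> components T"
  then obtain x where "C = joined T `` {x}" unfolding components_eq by blast
  then have "x \<in> C" by simp
  then show ?thesis by blast
qed

lemma curves_glue:
  assumes T: "diagram T" and m: "planar_matching (ends T) m"
    and C: "points C = ends T" "inner C \<union> outer C = arcs T \<union> m"
  shows "curves C = (\<lambda>K. K \<inter> set (ends T)) ` {K \<in> components (glue T m). K \<inter> set (ends T) \<noteq> {}}"
proof -
  let ?E = "set (ends T)" and ?J = "joined (glue T m)"
  have "curves C = (\<lambda>p. ?J `` {p} \<inter> ?E) ` ?E"
    unfolding curves_eq C(1) by (intro image_cong refl curve_class[OF T m C])
  also have "\<dots> = (\<lambda>K. K \<inter> ?E) ` ((\<lambda>p. ?J `` {p}) ` ?E)" by (simp add: image_image)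
  also have "(\<lambda>p. ?J `` {p}) ` ?E = {K \<in> components (glue T m). K \<inter> ?E \<noteq> {}}"
  proof (intro equalityI subsetI)
    fix K assume "K \<in> (\<lambda>p. ?J `` {p}) ` ?E"
    then obtain p where p: "p \<in> ?E" "K = ?J `` {p}" by auto
    then have "p \<in> K" by simp
    then show "K \<in> {K \<in> components (glue T m). K \<inter> ?E \<noteq> {}}"
      using p diagramD(3)[OF T] by (auto simp: components_eq)
  next
    fix K assume "K \<in> {K \<in> components (glue T m). K \<inter> ?E \<noteq> {}}"
    then obtain p where p: "p \<in> ?E" "p \<in> K" "K \<in> components (glue T m)" by blast
    then have "K = ?J `` {p}" by (intro component_eq)
    then show "K \<in> (\<lambda>p. ?J `` {p}) ` ?E" using p(1) by blast
  qed
  finally show ?thesis .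
qed

section \<open>Decorated cleaved links of resolutions\<close>

text \<open>The representative whose class is \<open>boundary\<close>. Boundaries are compared
  through representatives, where matchings and signs are visible.\<close>

definition cleaved_of :: "side \<Rightarrow> 'd diagram \<Rightarrow> 'd resolution \<Rightarrow> 'd cleaved" where
  "cleaved_of S T = (\<lambda>(\<rho>, m, s).
     \<lparr>points = ends T,
      inner = (case S of Inside \<Rightarrow> arcs (resolve \<rho> T) | Outside \<Rightarrow> m),
      outer = (case S of Inside \<Rightarrow> m | Outside \<Rightarrow> arcs (resolve \<rho> T)),
      decoration = (\<lambda>c. if c \<in> (\<lambda>C. C \<inter> set (ends T)) ` cut_circles T \<rho> m
        then s (THE C. C \<in> cut_circles T \<rho> m \<and> C \<inter> set (ends T) = c) else None)\<rparr>)"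

lemma boundary_eq: "boundary S n T r = cleaved_class n (cleaved_of S T r)"
  by (cases r) (simp add: cleaved_of_def)

lemma decorated_resolutionsD:
  assumes "(\<rho>, m, s) \<in> decorated_resolutions T"
  shows "dom \<rho> = crossings T" "ran \<rho> \<subseteq> {0, 1}" "planar_matching (ends T) m"
    "dom s = circles T \<rho> m" "ran s \<subseteq> {1, - 1}"
  using assms by (auto simp: decorated_resolutions_def)

text \<open>Different circles are disjoint, so a cut circle is determined by its points on the
  equator and the definite description in the decoration is meaningful.\<close>

lemma decoration_cleaved_of:
  assumes "C \<in> cut_circles T \<rho> m"
  shows "decoration (cleaved_of S T (\<rho>, m, s)) (C \<inter> set (ends T)) = s C"
proof -
  have "(THE K. K \<in> cut_circles T \<rho> m \<and> K \<inter> set (ends T) = C \<inter> set (ends T)) = C"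
  proof (rule the_equality)
    fix K assume K: "K \<in> cut_circles T \<rho> m \<and> K \<inter> set (ends T) = C \<inter> set (ends T)"
    obtain x where "x \<in> C \<inter> set (ends T)" using assms by (auto simp: cut_circles_def)
    then show "K = C" using K assms components_eqI[of K _ C x] by (auto simp: cut_circles_def circles_def)
  qed (use assms in simp)
  then show ?thesis using assms by (auto simp: cleaved_of_def)
qed

lemma tangle_resolved:
  assumes "tangle S T" "dom \<rho> = crossings T"
  shows "tangle S (resolve \<rho> T)" "diagram (resolve \<rho> T)" "crossings (resolve \<rho> T) = {}"
    "planar_matching (ends T) (arcs (resolve \<rho> T))"
proof -
  have T: "diagram T" using assms(1) by (simp add: tangle_def)
  show 1: "tangle S (resolve \<rho> T)" using tangle_resolve[OF assms(1)] assms(2) by simp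
  then show "diagram (resolve \<rho> T)" by (simp add: tangle_def)
  show 2: "crossings (resolve \<rho> T) = {}" using crossings_resolve[OF T] assms(2) by simp
  show "planar_matching (ends T) (arcs (resolve \<rho> T))" using planar_matching_arcs[OF 1 2] by simp
qed

lemma curves_cleaved_of:
  assumes T: "tangle S T" and r: "(\<rho>, m, s) \<in> decorated_resolutions T"
  shows "curves (cleaved_of S T (\<rho>, m, s)) = (\<lambda>C. C \<inter> set (ends T)) ` cut_circles T \<rho> m"
proof -
  note D = decorated_resolutionsD[OF r]
  show ?thesis
    unfolding cut_circles_def circles_def
    using curves_glue[OF tangle_resolved(2)[OF T D(1)], of m "cleaved_of S T (\<rho>, m, s)"] D(3)
    by (cases S) (simp_all add: cleaved_of_def Un_commute)
qed

text \<open>Of the two matchings one is given as planar; the other consists of the arcs of the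
  resolved tangle and is planar by the genus argument. Membership in \<open>CL n\<close> and the
  comparison of classes both rest on this.\<close>

lemma cleaved_link_cleaved_of:
  assumes T: "tangle S T" and r: "r \<in> decorated_resolutions T" and n: "length (ends T) = 2 * n"
  shows "cleaved_link n (cleaved_of S T r)"
proof -
  obtain \<rho> m s where r': "r = (\<rho>, m, s)" by (cases r)
  note D = decorated_resolutionsD[OF r[unfolded r']]
  let ?C = "cleaved_of S T (\<rho>, m, s)" and ?E = "set (ends T)"
  have dT: "diagram T" using T by (simp add: tangle_def)
  have dec: "decoration ?C c = s K" if "K \<in> cut_circles T \<rho> m" "c = K \<inter> ?E" for c K
    using decoration_cleaved_of[OF that(1), where S = S and s = s] that(2) by simp
  have none: "decoration ?C c = None" if "c \<notin> (\<lambda>C. C \<inter> ?E) ` cut_circles T \<rho> m" for c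
    using that by (simp add: cleaved_of_def)
  have sK: "\<exists>v\<in>{1, - 1}. s K = Some v" if "K \<in> cut_circles T \<rho> m" for K
  proof -
    have "K \<in> dom s" using that D(4) by (simp add: cut_circles_def)
    then obtain v where "s K = Some v" by blast
    then show ?thesis using D(5) by (auto simp: ran_def)
  qed
  have "dom (decoration ?C) = (\<lambda>C. C \<inter> ?E) ` cut_circles T \<rho> m"
  proof (intro equalityI subsetI)
    fix c assume "c \<in> dom (decoration ?C)"
    then show "c \<in> (\<lambda>C. C \<inter> ?E) ` cut_circles T \<rho> m" using none by (metis domIff)
  next
    fix c assume "c \<in> (\<lambda>C. C \<inter> ?E) ` cut_circles T \<rho> m"
    then obtain K where K: "K \<in> cut_circles T \<rho> m" "c = K \<inter> ?E" by blast
    then show "c \<in> dom (decoration ?C)" using dec[OF K] sK[OF K(1)] by auto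
  qed
  moreover have "ran (decoration ?C) \<subseteq> {1, - 1}"
  proof
    fix v assume "v \<in> ran (decoration ?C)"
    then obtain c where c: "decoration ?C c = Some v" by (auto simp: ran_def)
    have "c \<in> (\<lambda>C. C \<inter> ?E) ` cut_circles T \<rho> m" by (rule ccontr) (use none[of c] c in simp)
    then obtain K where K: "K \<in> cut_circles T \<rho> m" "c = K \<inter> ?E" by blast
    then show "v \<in> {1, - 1}" using dec[OF K] sK[OF K(1)] c by auto
  qed
  moreover have "planar_matching (ends T) (arcs (resolve \<rho> T))" by (rule tangle_resolved(4)[OF T D(1)])
  then have "planar_matching (points ?C) (inner ?C)" "planar_matching (points ?C) (outer ?C)"
    using D(3) by (cases S; simp add: cleaved_of_def)+
  moreover have "points ?C = ends T" by (simp add: cleaved_of_def)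
  ultimately show ?thesis
    using curves_cleaved_of[OF T r[unfolded r']] n diagramD(2)[OF dT] by (simp add: cleaved_link_def r')
qed

section \<open>Equivalence of cleaved links\<close>

lemma cleaved_linkD:
  assumes "cleaved_link n C"
  shows "b \<in> inner C \<union> outer C \<Longrightarrow> b \<subseteq> set (points C)"
  using assms planar_matchingD(3) by (auto simp: cleaved_link_def)

lemma curve_subset:
  assumes C: "cleaved_link n C" and "c \<in> curves C"
  shows "c \<subseteq> set (points C)"
proof
  fix x assume "x \<in> c"
  then obtain p where p: "p \<in> set (points C)" "(p, x) \<in> (curve_rel C)\<^sup>*" using assms(2) by (auto simp: curves_eq)
  from p(2) show "x \<in> set (points C)"
  proof (induction rule: rtrancl_induct)
    case base
    then show ?case using p by simp
  next
    case (step y z)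
    then show ?case using cleaved_linkD[OF C] by (auto simp: curve_rel_def)
  qed
qed

text \<open>The decoration clause of \<open>cleaved_equiv\<close> ranges over the curves of the
  first link only. Symmetry and transitivity therefore need to know that the curves of the second
  link are their images.\<close>

lemma curves_map:
  assumes C: "cleaved_link n C" and f: "inj_on f (set (points C))" "points C' = map f (points C)"
    "inner C' = (`) f ` inner C" "outer C' = (`) f ` outer C"
  shows "curves C' = (`) f ` curves C"
proof -
  have "(curve_rel C')\<^sup>* `` {f p} = f ` ((curve_rel C)\<^sup>* `` {p})" if p: "p \<in> set (points C)" for p
  proof (intro equalityI subsetI)
    fix z assume "z \<in> (curve_rel C')\<^sup>* `` {f p}"
    then have "(f p, z) \<in> (curve_rel C')\<^sup>*" by simp
    then have "\<exists>x. z = f x \<and> x \<in> set (points C) \<and> (p, x) \<in> (curve_rel C)\<^sup>*"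
    proof (induction rule: rtrancl_induct)
      case base
      then show ?case using p by auto
    next
      case (step y z)
      then obtain x where x: "y = f x" "x \<in> set (points C)" "(p, x) \<in> (curve_rel C)\<^sup>*" by blast
      obtain b where b: "b \<in> inner C \<union> outer C" "f x \<in> f ` b" "z \<in> f ` b"
        using step(2) x(1) f(3,4) by (auto simp: curve_rel_def)
      then obtain x' where x': "x' \<in> b" "z = f x'" by auto
      have "x \<in> b" using b(2) inj_on_image_mem_iff[OF f(1) x(2) cleaved_linkD[OF C b(1)]] by simp
      then have "(x, x') \<in> curve_rel C" using b(1) x'(1) by (auto simp: curve_rel_def)
      then have "(p, x') \<in> (curve_rel C)\<^sup>*" using x(3) by (rule rtrancl.rtrancl_into_rtrancl[rotated])
      moreover have "x' \<in> set (points C)" using cleaved_linkD[OF C b(1)] x'(1) by blast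
      ultimately show ?case using x'(2) by blast
    qed
    then show "z \<in> f ` ((curve_rel C)\<^sup>* `` {p})" by blast
  next
    fix z assume "z \<in> f ` ((curve_rel C)\<^sup>* `` {p})"
    then obtain x where x: "(p, x) \<in> (curve_rel C)\<^sup>*" "z = f x" by auto
    from x(1) have "(f p, f x) \<in> (curve_rel C')\<^sup>*"
    proof (induction rule: rtrancl_induct)
      case (step y z)
      then obtain b where "b \<in> inner C \<union> outer C" "y \<in> b" "z \<in> b" by (auto simp: curve_rel_def)
      then have "(f y, f z) \<in> curve_rel C'" using f(3,4) by (auto simp: curve_rel_def)
      then show ?case using step(3) by (rule rtrancl.rtrancl_into_rtrancl[rotated])
    qed simp
    then show "z \<in> (curve_rel C')\<^sup>* `` {f p}" using x(2) by simp
  qed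
  then show ?thesis unfolding curves_eq f(2) by (simp add: image_image)
qed

lemma cleaved_equiv_refl: "cleaved_equiv C C"
  unfolding cleaved_equiv_def by (rule exI[of _ id]) simp

lemma cleaved_equiv_sym:
  assumes C: "cleaved_link n C" and "cleaved_equiv C C'"
  shows "cleaved_equiv C' C"
proof -
  obtain f where f: "inj_on f (set (points C))" "points C' = map f (points C)"
    "inner C' = (`) f ` inner C" "outer C' = (`) f ` outer C"
    and dec: "\<And>c. c \<in> curves C \<Longrightarrow> decoration C' (f ` c) = decoration C c"
    using assms(2) by (auto simp: cleaved_equiv_def)
  let ?g = "inv_into (set (points C)) f"
  have gf: "?g ` f ` b = b" if "b \<subseteq> set (points C)" for b
    using inv_into_image_cancel[OF f(1) that] .
  show ?thesis
    unfolding cleaved_equiv_def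
  proof (intro exI conjI ballI)
    show "inj_on ?g (set (points C'))" unfolding f(2) by (simp add: inj_on_inv_into)
    show "points C = map ?g (points C')"
      unfolding f(2) map_map by (rule sym, rule map_idI) (simp add: f(1))
    have "(`) ?g ` (`) f ` inner C = (\<lambda>b. b) ` inner C"
      unfolding image_image using cleaved_linkD[OF C] gf by (intro image_cong) (auto simp: image_image)
    then show "inner C = (`) ?g ` inner C'" unfolding f(3) by simp
    have "(`) ?g ` (`) f ` outer C = (\<lambda>b. b) ` outer C"
      unfolding image_image using cleaved_linkD[OF C] gf by (intro image_cong) (auto simp: image_image)
    then show "outer C = (`) ?g ` outer C'" unfolding f(4) by simp
    fix c' assume "c' \<in> curves C'"
    then obtain c where c: "c \<in> curves C" "c' = f ` c" using curves_map[OF C f] by blast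
    then show "decoration C (?g ` c') = decoration C' c'"
      using gf[OF curve_subset[OF C c(1)]] dec by simp
  qed
qed

lemma cleaved_equiv_trans:
  assumes C: "cleaved_link n C" and "cleaved_equiv C C'" "cleaved_equiv C' C''"
  shows "cleaved_equiv C C''"
proof -
  obtain f where f: "inj_on f (set (points C))" "points C' = map f (points C)"
    "inner C' = (`) f ` inner C" "outer C' = (`) f ` outer C"
    and decf: "\<And>c. c \<in> curves C \<Longrightarrow> decoration C' (f ` c) = decoration C c"
    using assms(2) by (auto simp: cleaved_equiv_def)
  obtain g where g: "inj_on g (set (points C'))" "points C'' = map g (points C')"
    "inner C'' = (`) g ` inner C'" "outer C'' = (`) g ` outer C'"
    and decg: "\<And>c. c \<in> curves C' \<Longrightarrow> decoration C'' (g ` c) = decoration C' c"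
    using assms(3) by (auto simp: cleaved_equiv_def)
  show ?thesis
    unfolding cleaved_equiv_def
  proof (intro exI[of _ "g \<circ> f"] conjI ballI)
    show "inj_on (g \<circ> f) (set (points C))" using f(1,2) g(1) by (simp add: comp_inj_on)
    show "points C'' = map (g \<circ> f) (points C)" using f(2) g(2) by simp
    show "inner C'' = (`) (g \<circ> f) ` inner C" "outer C'' = (`) (g \<circ> f) ` outer C"
      using f(3,4) g(3,4) by (simp_all add: image_image image_comp)
    fix c assume c: "c \<in> curves C"
    then have "f ` c \<in> curves C'" using curves_map[OF C f] by blast
    then have "decoration C'' (g ` f ` c) = decoration C c" using decf[OF c] decg by simp
    then show "decoration C'' ((g \<circ> f) ` c) = decoration C c" by (simp only: image_comp)
  qed
qed

lemma cleaved_class_eq_iff: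
  assumes C: "cleaved_link n C" and C': "cleaved_link n C'"
  shows "cleaved_class n C = cleaved_class n C' \<longleftrightarrow> cleaved_equiv C C'"
proof
  assume "cleaved_class n C = cleaved_class n C'"
  moreover have "C' \<in> cleaved_class n C'" using C' cleaved_equiv_refl by (simp add: cleaved_class_def)
  ultimately show "cleaved_equiv C C'" by (auto simp: cleaved_class_def)
next
  assume "cleaved_equiv C C'"
  then show "cleaved_class n C = cleaved_class n C'"
    unfolding cleaved_class_def
    using cleaved_equiv_trans[OF C] cleaved_equiv_trans[OF C'] cleaved_equiv_sym[OF C] by blast
qed

lemma planar_matching_map:
  assumes f: "inj_on f (set ps)" and m: "planar_matching ps m"
  shows "planar_matching (map f ps) ((`) f ` m)"
  unfolding planar_matching_def
proof (intro conjI)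
  note P = planar_matchingD[OF m]
  show "partition_on (set (map f ps)) ((`) f ` m)"
  proof (rule partition_onI)
    show "\<Union> ((`) f ` m) = set (map f ps)" using partition_onD1[OF P(1)] by auto
    show "{} \<notin> (`) f ` m" using partition_onD3[OF P(1)] by auto
    fix X Y assume XY: "X \<in> (`) f ` m" "Y \<in> (`) f ` m" "X \<noteq> Y"
    then obtain b b' where b: "b \<in> m" "b' \<in> m" "X = f ` b" "Y = f ` b'" "b \<noteq> b'" by blast
    have "b \<inter> b' = {}" using partition_onD2[OF P(1)] b by (auto dest: disjointD)
    then show "disjnt X Y"
      using inj_on_image_Int[OF f P(3)[OF b(1)] P(3)[OF b(2)]] b(3,4) by (simp add: disjnt_def)
  qed
  show "\<forall>b\<in>(`) f ` m. card b = 2"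
    using P(2,3) card_image[OF inj_on_subset[OF f]] by fastforce
  have pair: "{ps ! i, ps ! k} \<in> m"
    if "{map f ps ! i, map f ps ! k} \<in> (`) f ` m" "i < length ps" "k < length ps" for i k
  proof -
    have "f ` {ps ! i, ps ! k} \<in> (`) f ` m" using that by simp
    then obtain b where b: "b \<in> m" "f ` {ps ! i, ps ! k} = f ` b" by (elim imageE)
    have sub: "{ps ! i, ps ! k} \<subseteq> set ps" using that(2,3) by simp
    have "{ps ! i, ps ! k} = b"
      using inj_on_image_eq_iff[OF f sub P(3)[OF b(1)]] b(2) by simp
    then show ?thesis using b(1) by simp
  qed
  show "\<not> (\<exists>i j k l. i < j \<and> j < k \<and> k < l \<and> l < length (map f ps) \<and>
          {map f ps ! i, map f ps ! k} \<in> (`) f ` m \<and> {map f ps ! j, map f ps ! l} \<in> (`) f ` m)"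
  proof (intro notI, elim exE conjE)
    fix i j k l
    assume "i < j" "j < k" "k < l" "l < length (map f ps)"
      "{map f ps ! i, map f ps ! k} \<in> (`) f ` m" "{map f ps ! j, map f ps ! l} \<in> (`) f ` m"
    then have "i < j \<and> j < k \<and> k < l \<and> l < length ps \<and> {ps ! i, ps ! k} \<in> m \<and> {ps ! j, ps ! l} \<in> m"
      using pair[of i k] pair[of j l] by simp
    then show False using m unfolding planar_matching_def by blast
  qed
qed

section \<open>Gluing two crossingless tangles\<close>

text \<open>An excursion of a path into \<open>B\<close> enters and leaves through \<open>H\<close>,
  with a connection inside \<open>B\<close> in between; \<open>M\<close> consists of exactly these
  shortcuts. So connections between points of \<open>A\<close> can be realized without leaving
  \<open>A\<close>, and a path from \<open>A\<close> that ends in \<open>B\<close> has a last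
  bridge.\<close>

lemma conn_glue:
  assumes G: "GA \<subseteq> A \<times> A" "GB \<subseteq> B \<times> B" "A \<inter> B = {}" and H: "H \<subseteq> A \<times> B" and x: "x \<in> A"
  defines "M \<equiv> {(p, p'). \<exists>q q'. (p, q) \<in> H \<and> (p', q') \<in> H \<and> (q, q') \<in> conn GB}"
  shows "conn (GA \<union> M) `` {x} = conn (GA \<union> GB \<union> H) `` {x} \<inter> A"
    and "y \<in> B \<Longrightarrow> (x, y) \<in> conn (GA \<union> GB \<union> H) \<Longrightarrow>
      \<exists>p q. (p, q) \<in> H \<and> (x, p) \<in> conn (GA \<union> GB \<union> H) \<and> (q, y) \<in> conn GB"
proof -
  let ?J = "conn (GA \<union> GB \<union> H)" and ?K = "conn (GA \<union> M)"
  have B: "conn GB \<subseteq> ?J" by (rule conn_mono) auto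
  have MJ: "(p, p') \<in> ?J" if pM: "(p, p') \<in> M" for p p'
  proof -
    obtain q q' where q: "(p, q) \<in> H" "(p', q') \<in> H" "(q, q') \<in> conn GB" using pM unfolding M_def by blast
    have "(p, q) \<in> ?J" "(p', q') \<in> ?J" using q(1,2) by (auto intro: conn_base)
    moreover have "(q, q') \<in> ?J" using B q(3) by blast
    ultimately show ?thesis by (meson conn_sym conn_trans)
  qed
  have KJ: "?K \<subseteq> ?J"
  proof (rule conn_least)
    show "GA \<union> M \<subseteq> ?J" using MJ by (auto intro: conn_base)
  qed
  have MA: "M \<subseteq> A \<times> A" using H by (auto simp: M_def)
  have KA: "y \<in> A" if "(x, y) \<in> ?K" for y
    using conn_in[OF that _ x] G(1) MA by blast
  \<comment> \<open>The invariant remembers, for a point of \<open>B\<close>, the bridge by which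
    the path last came over; on return this bridge and the new one form a pair of
    \<open>M\<close>.\<close>
  define P where "P y \<longleftrightarrow> y \<in> A \<and> (x, y) \<in> ?K \<or>
      y \<in> B \<and> (\<exists>p q. (p, q) \<in> H \<and> (x, p) \<in> ?K \<and> (q, y) \<in> conn GB)" for y
  have stepA: "P z" if "P y" "(y, z) \<in> GA \<or> (z, y) \<in> GA" for y z
  proof -
    have yz: "y \<in> A" "z \<in> A" using that(2) G(1) by auto
    then have "(x, y) \<in> ?K" using that(1) G(3) by (auto simp: P_def)
    moreover have "(y, z) \<in> ?K" using that(2) by (auto intro: conn_base conn_sym)
    ultimately have "(x, z) \<in> ?K" by (rule conn_trans)
    then show ?thesis using yz by (simp add: P_def)
  qed
  have stepB: "P z" if Py: "P y" and that: "(y, z) \<in> GB \<or> (z, y) \<in> GB" for y z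
  proof -
    have yz: "y \<in> B" "z \<in> B" using that G(2) by auto
    then obtain p q where pq: "(p, q) \<in> H" "(x, p) \<in> ?K" "(q, y) \<in> conn GB"
      using Py G(3) unfolding P_def by blast
    moreover have "(y, z) \<in> conn GB" using that by (auto intro: conn_base conn_sym)
    ultimately have "(q, z) \<in> conn GB" by (meson conn_trans)
    then show ?thesis using yz pq by (auto simp: P_def)
  qed
  have stepH: "P z" if "P y" "(y, z) \<in> H" for y z
  proof -
    have "y \<in> A" "z \<in> B" using that(2) H by auto
    then have "(x, y) \<in> ?K" using that(1) G(3) by (auto simp: P_def)
    then show ?thesis using that(2) \<open>z \<in> B\<close> conn_refl[of z GB] unfolding P_def by blast
  qed
  have stepH': "P z" if Py: "P y" and that: "(z, y) \<in> H" for y z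
  proof -
    have yz: "y \<in> B" "z \<in> A" using that H by auto
    then obtain p q where pq: "(p, q) \<in> H" "(x, p) \<in> ?K" "(q, y) \<in> conn GB"
      using Py G(3) unfolding P_def by blast
    then have "(p, z) \<in> M" using that unfolding M_def by blast
    then have "(p, z) \<in> ?K" by (intro conn_base) simp
    then show ?thesis using pq(2) yz conn_trans[of x p _ z] by (simp add: P_def)
  qed
  have JP: "P y" if "(x, y) \<in> ?J" for y
    using that
  proof (induction rule: conn_induct)
    case base
    then show ?case using x by (simp add: P_def)
  next
    case (fwd y z)
    then show ?case using stepA stepB stepH by blast
  next
    case (bwd y z)
    then show ?case using stepA stepB stepH' by blast
  qed
  show "?K `` {x} = ?J `` {x} \<inter> A"
  proof (intro equalityI subsetI)
    fix y assume "y \<in> ?K `` {x}"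
    then show "y \<in> ?J `` {x} \<inter> A" using KJ KA by auto
  next
    fix y assume "y \<in> ?J `` {x} \<inter> A"
    then show "y \<in> ?K `` {x}" using JP[of y] G(3) by (auto simp: P_def)
  qed
  assume "y \<in> B" "(x, y) \<in> ?J"
  then have "P y" "y \<notin> A" using JP G(3) by auto
  then obtain p q where pq: "(p, q) \<in> H" "(x, p) \<in> ?K" "(q, y) \<in> conn GB" unfolding P_def by blast
  then show "\<exists>p q. (p, q) \<in> H \<and> (x, p) \<in> ?J \<and> (q, y) \<in> conn GB" using KJ by blast
qed

text \<open>Two pieces joined at bivalent points, whose two ends are exchanged by
  \<open>rot L\<close>. The setting is symmetric, so facts are proved for \<open>A\<close> and
  transferred to \<open>B\<close> by \<open>swap\<close>.\<close>

locale glued =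
  fixes L A B :: "'d diagram"
  assumes diagram_A: "diagram A" and diagram_B: "diagram B"
    and matching_A: "planar_matching (ends A) (arcs A)" and matching_B: "planar_matching (ends B) (arcs B)"
    and darts_L: "darts L = darts A \<union> darts B" and disj: "darts A \<inter> darts B = {}" and ends_L: "ends L = []"
    and edge_A: "\<And>d. d \<in> darts A \<Longrightarrow> edge L d = edge A d"
    and edge_B: "\<And>d. d \<in> darts B \<Longrightarrow> edge L d = edge B d"
    and rot_A: "\<And>d. d \<in> darts A - set (ends A) \<Longrightarrow> rot L d = rot A d"
    and rot_B: "\<And>d. d \<in> darts B - set (ends B) \<Longrightarrow> rot L d = rot B d"
    and ends_B: "ends B = map (rot L) (ends A)"
    and rot_rot: "\<And>p. p \<in> set (ends A) \<Longrightarrow> rot L (rot L p) = p"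
begin

lemma ends_A: "ends A = map (rot L) (ends B)"
  unfolding ends_B map_map by (rule sym, rule map_idI) (simp add: rot_rot)

lemma swap: "glued L B A"
proof (rule glued.intro)
  show "darts L = darts B \<union> darts A" using darts_L by (simp add: Un_commute)
  show "darts B \<inter> darts A = {}" using disj by (simp add: Int_commute)
  show "rot L (rot L p) = p" if "p \<in> set (ends B)" for p
  proof -
    obtain p' where "p' \<in> set (ends A)" "p = rot L p'" using \<open>p \<in> set (ends B)\<close> unfolding ends_B by auto
    then show ?thesis using rot_rot by simp
  qed
qed (fact diagram_A diagram_B matching_A matching_B ends_L edge_A edge_B rot_A rot_B ends_A)+

text \<open>The arcs of \<open>B\<close>, carried over to the boundary points of \<open>A\<close>:
  the closure of \<open>A\<close> that reproduces how \<open>L\<close> continues beyond the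
  equator.\<close>

definition matching :: "'d set set" where
  "matching = (`) (rot L) ` arcs B"

lemma inj_rot_B: "inj_on (rot L) (set (ends B))"
  by (rule inj_on_inverseI[of _ "rot L"]) (auto simp: ends_B rot_rot)

lemma planar_matching_matching: "planar_matching (ends A) matching"
  unfolding matching_def ends_A by (rule planar_matching_map[OF inj_rot_B matching_B])

definition "bridges = (\<lambda>p. (p, rot L p)) ` set (ends A)"

lemma joined_L: "joined L = conn (graph_of A \<union> graph_of B \<union> bridges)"
proof -
  let ?EA = "set (ends A)" and ?EB = "set (ends B)"
  have sub: "?EA \<subseteq> darts A" "?EB \<subseteq> darts B" using diagramD(3) diagram_A diagram_B by auto
  have e: "gr (edge L) (darts L) = gr (edge A) (darts A) \<union> gr (edge B) (darts B)"
    unfolding darts_L gr_Un using edge_A edge_B gr_cong[of "darts A" "edge L" "edge A"]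
      gr_cong[of "darts B" "edge L" "edge B"] by simp
  have "darts L = (darts A - ?EA) \<union> (darts B - ?EB) \<union> ?EA \<union> ?EB" using darts_L sub by auto
  then have "gr (rot L) (darts L) = gr (rot L) (darts A - ?EA) \<union> gr (rot L) (darts B - ?EB) \<union> gr (rot L) ?EA \<union> gr (rot L) ?EB"
    by (simp only: gr_Un)
  moreover have "gr (rot L) (darts A - ?EA) = gr (rot A) (darts A - ?EA)" by (rule gr_cong) (rule rot_A)
  moreover have "gr (rot L) (darts B - ?EB) = gr (rot B) (darts B - ?EB)" by (rule gr_cong) (rule rot_B)
  moreover have "gr (rot L) ?EA = bridges" by (auto simp: gr_def bridges_def)
  moreover have "gr (rot L) ?EB = bridges\<inverse>"
    by (auto simp: gr_def bridges_def ends_B rot_rot)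
  ultimately have "graph_of L = graph_of A \<union> graph_of B \<union> bridges \<union> bridges\<inverse>"
    using e ends_L by (auto simp: graph_of_def)
  then have "joined L = conn (graph_of A \<union> graph_of B \<union> bridges \<union> bridges\<inverse>)" by (simp add: joined_graph_of)
  also have "\<dots> = conn (graph_of A \<union> graph_of B \<union> bridges)"
    by (rule conn_eqI) (auto intro: conn_base conn_sym)
  finally show ?thesis .
qed

lemma bridges_subset: "bridges \<subseteq> darts A \<times> darts B"
proof -
  have "set (ends A) \<subseteq> darts A" "rot L ` set (ends A) \<subseteq> darts B"
    using diagramD(3)[OF diagram_A] diagramD(3)[OF diagram_B] by (simp_all add: ends_B)
  then show ?thesis by (auto simp: bridges_def)
qed

lemma joined_glue_matching:
  assumes x: "x \<in> darts A"
  shows "joined (glue A matching) `` {x} = joined L `` {x} \<inter> darts A"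
proof -
  define M where "M = {(p, p'). \<exists>q q'. (p, q) \<in> bridges \<and> (p', q') \<in> bridges \<and> (q, q') \<in> conn (graph_of B)}"
  have "joined (glue A matching) = conn (graph_of A \<union> matching_rel matching)"
    by (rule joined_glue[OF diagram_A planar_matching_matching])
  also have "\<dots> = conn (graph_of A \<union> M)"
  proof (rule conn_eqI)
    have "(p, p') \<in> M" if pp: "{p, p'} \<in> matching" for p p'
    proof -
      obtain q q' where q: "{q, q'} \<in> arcs B" "p = rot L q" "p' = rot L q'"
      proof -
        obtain b where b: "b \<in> arcs B" "{p, p'} = rot L ` b" using pp by (auto simp: matching_def)
        have "p \<in> rot L ` b" "p' \<in> rot L ` b" using b(2) by auto
        then obtain q q' where q: "q \<in> b" "q' \<in> b" "p = rot L q" "p' = rot L q'" by blast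
        have "p \<noteq> p'" using planar_matchingD(2)[OF planar_matching_matching pp] by auto
        then have "b = {q, q'}" using q by (intro block_eq_pair[OF matching_B b(1)]) auto
        then show thesis using that[of q q'] b(1) q by simp
      qed
      have "q \<in> set (ends B)" "q' \<in> set (ends B)" "(q, q') \<in> conn (graph_of B)"
        using arcsD[OF q(1)] by (simp_all add: joined_graph_of)
      moreover from this have "(p, q) \<in> bridges" "(p', q') \<in> bridges"
        using q(2,3) by (auto simp: bridges_def ends_B rot_rot)
      ultimately show ?thesis by (auto simp: M_def)
    qed
    then show "graph_of A \<union> matching_rel matching \<subseteq> conn (graph_of A \<union> M)"
      by (auto simp: matching_rel_def intro!: conn_base)
    \<comment> \<open>\<open>M\<close> also relates each boundary point to itself, which no matching
      does; such pairs are absorbed by reflexivity of \<open>conn\<close>.\<close>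
    have "(p, p') \<in> conn (matching_rel matching)" if "(p, p') \<in> M" for p p'
    proof (cases "p = p'")
      case False
      obtain q q' where q: "(p, q) \<in> bridges" "(p', q') \<in> bridges" "(q, q') \<in> conn (graph_of B)"
        using \<open>(p, p') \<in> M\<close> by (auto simp: M_def)
      then have r: "p \<in> set (ends A)" "p' \<in> set (ends A)" "q = rot L p" "q' = rot L p'" by (auto simp: bridges_def)
      then have "q \<in> set (ends B)" "q' \<in> set (ends B)" "rot L q = p" "rot L q' = p'" by (auto simp: ends_B rot_rot)
      moreover from this have "q \<noteq> q'" using False by auto
      ultimately have "{q, q'} \<in> arcs B" using q(3) by (intro arcsI) (simp_all add: joined_graph_of)
      then have "rot L ` {q, q'} \<in> matching" unfolding matching_def by blast
      then have "{p, p'} \<in> matching" using \<open>rot L q = p\<close> \<open>rot L q' = p'\<close> by simp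
      then show ?thesis by (intro conn_base) (simp add: matching_rel_def)
    qed simp
    moreover have "conn (matching_rel matching) \<subseteq> conn (graph_of A \<union> matching_rel matching)"
      by (rule conn_mono) simp
    ultimately show "graph_of A \<union> M \<subseteq> conn (graph_of A \<union> matching_rel matching)"
      by (auto intro: conn_base)
  qed
  finally show ?thesis
    using conn_glue(1)[OF graph_of_subset[OF diagram_A] graph_of_subset[OF diagram_B] disj bridges_subset x]
    by (simp add: M_def joined_L)
qed

lemma component_subset: "C \<in> components L \<Longrightarrow> C \<subseteq> darts L"
proof -
  assume "C \<in> components L"
  then obtain x where x: "x \<in> darts L" "C = conn (graph_of A \<union> graph_of B \<union> bridges) `` {x}"
    by (auto simp: components_eq joined_L)
  have "graph_of A \<union> graph_of B \<union> bridges \<subseteq> darts L \<times> darts L"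
    using graph_of_subset[OF diagram_A] graph_of_subset[OF diagram_B] bridges_subset darts_L by blast
  then show "C \<subseteq> darts L" using conn_in[of x _ "graph_of A \<union> graph_of B \<union> bridges" "darts L"] x by blast
qed

lemma components_glue_matching:
  "components (glue A matching) = (\<lambda>C. C \<inter> darts A) ` {C \<in> components L. C \<inter> darts A \<noteq> {}}"
proof -
  have "components (glue A matching) = (\<lambda>x. joined L `` {x} \<inter> darts A) ` darts A"
    unfolding components_eq glue_simps by (intro image_cong refl joined_glue_matching)
  also have "\<dots> = (\<lambda>C. C \<inter> darts A) ` (\<lambda>x. joined L `` {x}) ` darts A" by (simp add: image_image)
  also have "(\<lambda>x. joined L `` {x}) ` darts A = {C \<in> components L. C \<inter> darts A \<noteq> {}}"
  proof (intro equalityI subsetI)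
    fix C assume "C \<in> (\<lambda>x. joined L `` {x}) ` darts A"
    then obtain x where x: "x \<in> darts A" "C = joined L `` {x}" by auto
    then have "x \<in> C" by simp
    then show "C \<in> {C \<in> components L. C \<inter> darts A \<noteq> {}}" using x darts_L by (auto simp: components_eq)
  next
    fix C assume "C \<in> {C \<in> components L. C \<inter> darts A \<noteq> {}}"
    then obtain x where x: "C \<in> components L" "x \<in> darts A" "x \<in> C" by blast
    then have "C = joined L `` {x}" by (intro component_eq)
    then show "C \<in> (\<lambda>x. joined L `` {x}) ` darts A" using x(2) by blast
  qed
  finally show ?thesis .
qed

text \<open>A path between the two pieces has to use a bridge, and a bridge has both its ends in the
  same component.\<close>

lemma component_meets_ends:
  assumes C: "C \<in> components L"
  shows "C \<inter> set (ends A) \<noteq> {} \<longleftrightarrow> C \<inter> darts A \<noteq> {} \<and> C \<inter> darts B \<noteq> {}"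
    and "C \<inter> set (ends B) = rot L ` (C \<inter> set (ends A))"
proof -
  have br: "rot L p \<in> C \<longleftrightarrow> p \<in> C" if "p \<in> set (ends A)" for p
  proof -
    have "(p, rot L p) \<in> joined L" unfolding joined_L using that by (intro conn_base) (auto simp: bridges_def)
    then show ?thesis using C by (auto simp: components_eq intro: joined_trans joined_sym)
  qed
  have EA: "set (ends A) \<subseteq> darts A" and EB: "set (ends B) \<subseteq> darts B"
    using diagramD(3) diagram_A diagram_B by auto
  show "C \<inter> set (ends B) = rot L ` (C \<inter> set (ends A))" using br by (auto simp: ends_B)
  show "C \<inter> set (ends A) \<noteq> {} \<longleftrightarrow> C \<inter> darts A \<noteq> {} \<and> C \<inter> darts B \<noteq> {}"
  proof
    assume "C \<inter> set (ends A) \<noteq> {}"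
    then obtain p where p: "p \<in> C" "p \<in> set (ends A)" by blast
    then have "rot L p \<in> C" "rot L p \<in> set (ends B)" using br by (auto simp: ends_B)
    then show "C \<inter> darts A \<noteq> {} \<and> C \<inter> darts B \<noteq> {}" using p EA EB by blast
  next
    assume "C \<inter> darts A \<noteq> {} \<and> C \<inter> darts B \<noteq> {}"
    then obtain x y where xy: "x \<in> C" "x \<in> darts A" "y \<in> C" "y \<in> darts B" by blast
    have Cx: "C = joined L `` {x}" by (rule component_eq[OF C xy(1)])
    then have "(x, y) \<in> conn (graph_of A \<union> graph_of B \<union> bridges)" using xy(3) by (simp add: joined_L)
    then obtain p q where "(p, q) \<in> bridges" "(x, p) \<in> joined L"
      using conn_glue(2)[OF graph_of_subset[OF diagram_A] graph_of_subset[OF diagram_B] disj bridges_subset xy(2,4)]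
      by (auto simp: joined_L)
    then show "C \<inter> set (ends A) \<noteq> {}" using Cx by (auto simp: bridges_def)
  qed
qed

text \<open>Inverts the passage from a circle of \<open>L\<close> to its part in one disc, so that a
  decoration of the circles of \<open>L\<close> can be read off from the parts.\<close>

lemma component_recover:
  assumes "C \<in> components L" "C \<inter> Y \<noteq> {}"
  shows "joined L `` (C \<inter> Y) = C"
proof -
  have "joined L `` (C \<inter> Y) = (\<Union>y\<in>C \<inter> Y. joined L `` {y})" by auto
  also have "\<dots> = (\<Union>y\<in>C \<inter> Y. C)"
    by (intro SUP_cong refl) (use component_eq[OF assms(1)] in auto)
  also have "\<dots> = C" using assms(2) by simp
  finally show ?thesis .
qed

end

section \<open>Cutting a link diagram along an equator\<close>

locale cut_link =
  fixes L :: "'d diagram" and X :: "'d set" and es :: "'d list" and n :: nat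
  assumes link: "link_diagram L" and equator: "equator L X es" and length_es: "length es = 2 * n"
begin

abbreviation "T1 \<equiv> inside_part L X es"
abbreviation "T2 \<equiv> outside_part L X es"
abbreviation "Y \<equiv> darts L - X"

lemma part_simps [simp]:
  "darts T1 = X" "edge T1 = edge L" "rot T1 = rot L" "over T1 = over L \<inter> X" "ends T1 = es"
  "darts T2 = Y" "edge T2 = edge L" "rot T2 = rot L" "over T2 = over L - X" "ends T2 = map (rot L) es"
  by (simp_all add: inside_part_def outside_part_def)

lemma vertex_part [simp]: "vertex T1 d = vertex L d" "vertex T2 d = vertex L d"
  by (simp_all add: vertex_def)

lemma diagram_L: "diagram L" and ends_L: "ends L = []"
  using link by (simp_all add: link_diagram_def)

lemma tangles: "tangle Inside T1" "tangle Outside T2"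
  using equator by (simp_all add: equator_def)

lemma diagrams: "diagram T1" "diagram T2"
  using tangles by (simp_all add: tangle_def)

lemma X_subset: "X \<subseteq> darts L"
  using equator by (simp add: equator_def)

lemma es_subset: "set es \<subseteq> X" "rot L ` set es \<subseteq> Y"
  using diagramD(3)[OF diagrams(1)] diagramD(3)[OF diagrams(2)] by simp_all

lemma rot_rot_es: "p \<in> set es \<Longrightarrow> rot L (rot L p) = p"
  using equator by (simp add: equator_def)

lemma over_L: "over L = over T1 \<union> over T2"
  using diagramD(4)[OF diagram_L] by auto

lemma crossings_L: "crossings L = crossings T1 \<union> crossings T2"
  unfolding crossings_def by (subst over_L) (simp add: image_Un)

lemma crossing_darts: "c \<in> crossings T1 \<Longrightarrow> c \<subseteq> X" "c \<in> crossings T2 \<Longrightarrow> c \<subseteq> Y"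
  using crossing_subset[OF diagrams(1)] crossing_subset[OF diagrams(2)] by fastforce+

lemma crossings_disjoint: "crossings T1 \<inter> crossings T2 = {}"
proof (rule ccontr)
  assume "crossings T1 \<inter> crossings T2 \<noteq> {}"
  then obtain c where c: "c \<in> crossings T1" "c \<in> crossings T2" by blast
  then obtain x where "c = vertex T1 x" by (auto simp: crossings_def)
  then have "x \<in> c" by simp
  then show False using crossing_darts[of c] c by blast
qed

lemma finite_crossings_parts: "finite (crossings T1)" "finite (crossings T2)"
  using finite_crossings diagrams by blast+

lemma positive_part:
  "c \<in> crossings T1 \<Longrightarrow> positive tails T1 c \<longleftrightarrow> positive tails L c"
  "c \<in> crossings T2 \<Longrightarrow> positive tails T2 c \<longleftrightarrow> positive tails L c"
proof -
  assume "c \<in> crossings T1"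
  then have "c \<inter> over T1 = c \<inter> over L" using crossing_darts(1) by auto
  then show "positive tails T1 c \<longleftrightarrow> positive tails L c" unfolding positive_def by simp
next
  assume "c \<in> crossings T2"
  then have "c \<inter> over T2 = c \<inter> over L" using crossing_darts(2) by auto
  then show "positive tails T2 c \<longleftrightarrow> positive tails L c" unfolding positive_def by simp
qed

lemma card_crossings_parts:
  assumes "\<And>c. c \<in> crossings T1 \<Longrightarrow> P1 c \<longleftrightarrow> P c" "\<And>c. c \<in> crossings T2 \<Longrightarrow> P2 c \<longleftrightarrow> P c"
  shows "card {c \<in> crossings L. P c} = card {c \<in> crossings T1. P1 c} + card {c \<in> crossings T2. P2 c}"
proof -
  have "{c \<in> crossings L. P c} = {c \<in> crossings T1. P1 c} \<union> {c \<in> crossings T2. P2 c}"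
    unfolding crossings_L using assms by blast
  moreover have "{c \<in> crossings T1. P1 c} \<inter> {c \<in> crossings T2. P2 c} = {}" using crossings_disjoint by blast
  ultimately show ?thesis using finite_crossings_parts by (simp add: card_Un_disjoint)
qed

lemma n_plus_L: "n_plus tails L = n_plus tails T1 + n_plus tails T2"
  unfolding n_plus_def by (rule card_crossings_parts) (rule positive_part; assumption)+

lemma n_minus_L: "n_minus tails L = n_minus tails T1 + n_minus tails T2"
  unfolding n_minus_def by (rule card_crossings_parts) (simp_all add: positive_part)

abbreviation "left \<rho> \<equiv> \<rho> |` crossings T1"
abbreviation "right \<rho> \<equiv> \<rho> |` crossings T2"

text \<open>Crossings are recognized by \<open>rot\<close> alone, and \<open>rot\<close> is shared
  by \<open>L\<close> and its parts. Away from the equator the restricted resolution therefore looks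
  up the same value as the full one.\<close>

lemma rot_resolve_part:
  assumes \<rho>: "dom \<rho> \<subseteq> crossings L"
  shows "d \<in> X - set es \<Longrightarrow> rot (resolve (left \<rho>) T1) d = rot (resolve \<rho> L) d"
    and "d \<in> Y - rot L ` set es \<Longrightarrow> rot (resolve (right \<rho>) T2) d = rot (resolve \<rho> L) d"
proof -
  assume d: "d \<in> X - set es"
  have "vertex L d \<in> crossings T1 \<longleftrightarrow> vertex L d \<in> crossings L"
    using vertex_in_crossings_iff[OF diagrams(1), of d] vertex_in_crossings_iff[OF diagram_L, of d] d X_subset ends_L
    by auto
  moreover have "vertex L d \<notin> crossings L \<Longrightarrow> \<rho> (vertex L d) = None" using \<rho> by (meson domIff subsetD)
  ultimately have "(left \<rho>) (vertex L d) = \<rho> (vertex L d)" by (simp add: restrict_map_def)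
  then show "rot (resolve (left \<rho>) T1) d = rot (resolve \<rho> L) d"
    using d by (simp add: resolve_def split: option.split)
next
  assume d: "d \<in> Y - rot L ` set es"
  have "vertex L d \<in> crossings T2 \<longleftrightarrow> vertex L d \<in> crossings L"
    using vertex_in_crossings_iff[OF diagrams(2), of d] vertex_in_crossings_iff[OF diagram_L, of d] d ends_L
    by auto
  moreover have "vertex L d \<notin> crossings L \<Longrightarrow> \<rho> (vertex L d) = None" using \<rho> by (meson domIff subsetD)
  ultimately have "(right \<rho>) (vertex L d) = \<rho> (vertex L d)" by (simp add: restrict_map_def)
  then show "rot (resolve (right \<rho>) T2) d = rot (resolve \<rho> L) d"
    using d by (simp add: resolve_def split: option.split)
qed

lemma rot_resolve_es:
  assumes \<rho>: "dom \<rho> \<subseteq> crossings L" and p: "p \<in> set es"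
  shows "rot (resolve \<rho> L) p = rot L p" "rot (resolve \<rho> L) (rot L p) = p"
proof -
  have "rot (resolve \<rho> L) d = rot L d" if "rot L (rot L d) = d" for d
  proof (rule rot_resolve_None)
    have "vertex L d \<notin> crossings L" using vertex_in_crossings_iff[OF diagram_L, of d] that by simp
    then show "\<rho> (vertex L d) = None" using \<rho> by (meson domIff subsetD)
  qed
  then show "rot (resolve \<rho> L) p = rot L p" "rot (resolve \<rho> L) (rot L p) = p"
    using rot_rot_es[OF p] by simp_all
qed

text \<open>Resolving commutes with cutting: every crossing lies on one side, and the points of the
  equator are bivalent, so their rotation is not changed by the resolution.\<close>

lemma glued_resolve:
  assumes \<rho>: "dom \<rho> = crossings L"
  shows "glued (resolve \<rho> L) (resolve (left \<rho>) T1) (resolve (right \<rho>) T2)"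
proof -
  have d: "dom (left \<rho>) = crossings T1" "dom (right \<rho>) = crossings T2"
    using \<rho> crossings_L by auto
  have sub: "dom \<rho> \<subseteq> crossings L" using \<rho> by simp
  note R1 = tangle_resolved[OF tangles(1) d(1)] note R2 = tangle_resolved[OF tangles(2) d(2)]
  show ?thesis
  proof
    show "ends (resolve (right \<rho>) T2) =
        map (rot (resolve \<rho> L)) (ends (resolve (left \<rho>) T1))"
      using rot_resolve_es(1)[OF sub] by simp
    show "rot (resolve \<rho> L) d = rot (resolve (left \<rho>) T1) d"
      if "d \<in> darts (resolve (left \<rho>) T1) - set (ends (resolve (left \<rho>) T1))" for d
      using rot_resolve_part(1)[OF sub] that by simp
    show "rot (resolve \<rho> L) d = rot (resolve (right \<rho>) T2) d"
      if "d \<in> darts (resolve (right \<rho>) T2) - set (ends (resolve (right \<rho>) T2))" for d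
      using rot_resolve_part(2)[OF sub, of d] that by simp
    show "rot (resolve \<rho> L) (rot (resolve \<rho> L) p) = p"
      if "p \<in> set (ends (resolve (left \<rho>) T1))" for p
      using rot_resolve_es[OF sub, of p] that by simp
  qed (use R1 R2 X_subset ends_L in auto)
qed

section \<open>States and pairs of decorated resolutions\<close>

definition states :: "(('d set \<rightharpoonup> nat) \<times> ('d set \<rightharpoonup> int)) set" where
  "states = (SIGMA \<rho>:maps (crossings L) {0, 1}. maps (components (resolve \<rho> L)) {1, - 1})"

text \<open>Expanding the composition by linearity leaves one term for each such pair.\<close>

definition pairs :: "('d resolution \<times> 'd resolution) set" where
  "pairs = {(r1, r2). r1 \<in> decorated_resolutions T1 \<and> r2 \<in> decorated_resolutions T2 \<and>
     boundary Outside n T2 r2 = boundary Inside n T1 r1}"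

abbreviation "\<mu>1 \<rho> \<equiv> glued.matching (resolve \<rho> L) (resolve (right \<rho>) T2)"
abbreviation "\<mu>2 \<rho> \<equiv> glued.matching (resolve \<rho> L) (resolve (left \<rho>) T1)"

lemma circles_parts:
  assumes \<rho>: "dom \<rho> = crossings L"
  shows "circles T1 (left \<rho>) (\<mu>1 \<rho>) =
      (\<lambda>C. C \<inter> X) ` {C \<in> components (resolve \<rho> L). C \<inter> X \<noteq> {}}"
    and "circles T2 (right \<rho>) (\<mu>2 \<rho>) =
      (\<lambda>C. C \<inter> Y) ` {C \<in> components (resolve \<rho> L). C \<inter> Y \<noteq> {}}"
  using glued.components_glue_matching[OF glued_resolve[OF \<rho>]]
    glued.components_glue_matching[OF glued.swap[OF glued_resolve[OF \<rho>]]]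
  by (simp_all add: circles_def)

lemma component_cases:
  assumes \<rho>: "dom \<rho> = crossings L" and C: "C \<in> components (resolve \<rho> L)"
  shows "C \<inter> set es \<noteq> {} \<longleftrightarrow> C \<inter> X \<noteq> {} \<and> C \<inter> Y \<noteq> {}"
    and "C \<inter> rot L ` set es = rot L ` (C \<inter> set es)"
    and "C \<inter> X \<noteq> {} \<or> C \<inter> Y \<noteq> {}"
proof -
  have sub: "dom \<rho> \<subseteq> crossings L" using \<rho> by simp
  note G = glued_resolve[OF \<rho>]
  show "C \<inter> set es \<noteq> {} \<longleftrightarrow> C \<inter> X \<noteq> {} \<and> C \<inter> Y \<noteq> {}"
    using glued.component_meets_ends(1)[OF G C] by simp
  have "rot (resolve \<rho> L) ` (C \<inter> set es) = rot L ` (C \<inter> set es)"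
    by (intro image_cong refl rot_resolve_es(1)[OF sub]) simp
  then show "C \<inter> rot L ` set es = rot L ` (C \<inter> set es)"
    using glued.component_meets_ends(2)[OF G C] by simp
  show "C \<inter> X \<noteq> {} \<or> C \<inter> Y \<noteq> {}"
    using glued.component_subset[OF G C] component_nonempty[OF C] by auto
qed

text \<open>A circle that meets the equator has a part on either side and is cut in both closures.
  Any other circle lies on one side and is a free circle of that closure only.\<close>

lemma cut_free_parts:
  assumes \<rho>: "dom \<rho> = crossings L"
  defines "K \<equiv> components (resolve \<rho> L)"
  shows "cut_circles T1 (left \<rho>) (\<mu>1 \<rho>) = (\<lambda>C. C \<inter> X) ` {C \<in> K. C \<inter> set es \<noteq> {}}"
    and "cut_circles T2 (right \<rho>) (\<mu>2 \<rho>) = (\<lambda>C. C \<inter> Y) ` {C \<in> K. C \<inter> set es \<noteq> {}}"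
    and "free_circles T1 (left \<rho>) (\<mu>1 \<rho>) = (\<lambda>C. C \<inter> X) ` {C \<in> K. C \<inter> X \<noteq> {} \<and> C \<inter> set es = {}}"
    and "free_circles T2 (right \<rho>) (\<mu>2 \<rho>) = (\<lambda>C. C \<inter> Y) ` {C \<in> K. C \<inter> Y \<noteq> {} \<and> C \<inter> set es = {}}"
proof -
  have 1: "C \<inter> X \<inter> set es = C \<inter> set es" for C using es_subset(1) by blast
  have 2: "C \<inter> Y \<inter> rot L ` set es = {} \<longleftrightarrow> C \<inter> set es = {}" if "C \<in> K" for C
  proof -
    have "C \<inter> Y \<inter> rot L ` set es = C \<inter> rot L ` set es" using es_subset(2) by blast
    also have "\<dots> = rot L ` (C \<inter> set es)" using component_cases(2)[OF \<rho>] that by (simp add: K_def)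
    finally show ?thesis by simp
  qed
  have 3: "C \<inter> X \<noteq> {}" "C \<inter> Y \<noteq> {}" if "C \<in> K" "C \<inter> set es \<noteq> {}" for C
    using component_cases(1)[OF \<rho>] that by (simp_all add: K_def)
  note c = circles_parts[OF \<rho>, folded K_def]
  have image_filter: "{D \<in> f ` S. P D} = f ` {C \<in> S. P (f C)}" for f :: "'d set \<Rightarrow> 'd set" and S P
    by auto
  show "cut_circles T1 (left \<rho>) (\<mu>1 \<rho>) = (\<lambda>C. C \<inter> X) ` {C \<in> K. C \<inter> set es \<noteq> {}}"
    unfolding cut_circles_def c(1) image_filter
    by (rule arg_cong[where f = "image (\<lambda>C. C \<inter> X)"], rule Collect_cong) (use 1 3 in auto)
  show "cut_circles T2 (right \<rho>) (\<mu>2 \<rho>) = (\<lambda>C. C \<inter> Y) ` {C \<in> K. C \<inter> set es \<noteq> {}}"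
    unfolding cut_circles_def c(2) image_filter
    by (rule arg_cong[where f = "image (\<lambda>C. C \<inter> Y)"], rule Collect_cong) (use 2 3 in auto)
  show "free_circles T1 (left \<rho>) (\<mu>1 \<rho>) = (\<lambda>C. C \<inter> X) ` {C \<in> K. C \<inter> X \<noteq> {} \<and> C \<inter> set es = {}}"
    unfolding free_circles_def c(1) image_filter
    by (rule arg_cong[where f = "image (\<lambda>C. C \<inter> X)"], rule Collect_cong) (use 1 in auto)
  show "free_circles T2 (right \<rho>) (\<mu>2 \<rho>) = (\<lambda>C. C \<inter> Y) ` {C \<in> K. C \<inter> Y \<noteq> {} \<and> C \<inter> set es = {}}"
    unfolding free_circles_def c(2) image_filter
    by (rule arg_cong[where f = "image (\<lambda>C. C \<inter> Y)"], rule Collect_cong) (use 2 in auto)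
qed

text \<open>An equivalence has to carry the list of points of one boundary to that of the other,
  which leaves no choice but \<open>rot L\<close> on the equator. Comparing \<open>inner\<close>
  with \<open>inner\<close> and \<open>outer\<close> with \<open>outer\<close> then expresses each
  matching by the arcs of the other tangle, and the decoration clause compares the signs on cut
  circles.\<close>

lemma boundary_eq_iff:
  assumes r1: "(\<rho>1, m1, s1) \<in> decorated_resolutions T1" and r2: "(\<rho>2, m2, s2) \<in> decorated_resolutions T2"
    and \<rho>: "dom \<rho> = crossings L" "left \<rho> = \<rho>1" "right \<rho> = \<rho>2"
  shows "boundary Outside n T2 (\<rho>2, m2, s2) = boundary Inside n T1 (\<rho>1, m1, s1) \<longleftrightarrow>
    m1 = \<mu>1 \<rho> \<and> m2 = \<mu>2 \<rho> \<and>
    (\<forall>C\<in>components (resolve \<rho> L). C \<inter> set es \<noteq> {} \<longrightarrow> s1 (C \<inter> X) = s2 (C \<inter> Y))"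
proof -
  let ?A = "resolve \<rho>1 T1" and ?B = "resolve \<rho>2 T2" and ?K = "components (resolve \<rho> L)"
  let ?C1 = "cleaved_of Inside T1 (\<rho>1, m1, s1)" and ?C2 = "cleaved_of Outside T2 (\<rho>2, m2, s2)"
  note D1 = decorated_resolutionsD[OF r1] note D2 = decorated_resolutionsD[OF r2]
  have sub: "dom \<rho> \<subseteq> crossings L" using \<rho> by simp
  note R1 = tangle_resolved(4)[OF tangles(1) D1(1)] note R2 = tangle_resolved(4)[OF tangles(2) D2(1)]
  have link: "cleaved_link n ?C1" "cleaved_link n ?C2"
    using cleaved_link_cleaved_of[OF tangles(1) r1] cleaved_link_cleaved_of[OF tangles(2) r2] length_es by simp_all
  have rr: "rot L (rot L p) = p" if "p \<in> set es" for p using rot_rot_es[OF that] .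
  have inj: "inj_on (rot L) (set es)" by (rule inj_on_inverseI[of _ "rot L"]) (rule rr)
  have rrb: "rot L ` rot L ` b = b" if "b \<subseteq> set es \<or> b \<subseteq> rot L ` set es" for b
  proof -
    have "rot L (rot L x) = x" if "x \<in> b" for x
      using \<open>b \<subseteq> set es \<or> b \<subseteq> rot L ` set es\<close> that rr by auto
    then show ?thesis by (simp add: image_image)
  qed
  have blocks: "b \<subseteq> set es" if "b \<in> arcs ?A \<or> b \<in> m1" for b
    using planar_matchingD(3)[OF R1] planar_matchingD(3)[OF D1(3)] that by auto
  have blocks2: "b \<subseteq> rot L ` set es" if "b \<in> arcs ?B" for b
    using planar_matchingD(3)[OF R2] that by simp
  have \<mu>: "\<mu>1 \<rho> = (`) (rot L) ` arcs ?B" "\<mu>2 \<rho> = (`) (rot L) ` arcs ?A"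
  proof -
    have im: "rot (resolve \<rho> L) ` b = rot L ` b" if "b \<subseteq> set es" for b
      using that by (intro image_cong refl rot_resolve_es(1)[OF sub]) auto
    have "(`) (rot (resolve \<rho> L)) ` arcs ?A = (`) (rot L) ` arcs ?A"
      by (rule image_cong[OF refl im]) (rule blocks, simp)
    then show "\<mu>2 \<rho> = (`) (rot L) ` arcs ?A"
      using glued.matching_def[OF glued.swap[OF glued_resolve[OF \<rho>(1)]]] \<rho>(2) by simp
    have im2: "rot (resolve \<rho> L) ` b = rot L ` b" if b: "b \<subseteq> rot L ` set es" for b
    proof (intro image_cong refl)
      fix x assume "x \<in> b"
      then obtain p where "p \<in> set es" "x = rot L p" using b by blast
      then show "rot (resolve \<rho> L) x = rot L x" using rot_resolve_es(2)[OF sub] rr by simp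
    qed
    have "(`) (rot (resolve \<rho> L)) ` arcs ?B = (`) (rot L) ` arcs ?B"
      by (rule image_cong[OF refl im2]) (rule blocks2)
    then show "\<mu>1 \<rho> = (`) (rot L) ` arcs ?B"
      using glued.matching_def[OF glued_resolve[OF \<rho>(1)]] \<rho>(3) by simp
  qed
  \<comment> \<open>\<open>rot L\<close> is an involution on the points of the equator, so the
    equation between the outer matchings can be solved for \<open>m1\<close>.\<close>
  have m1: "arcs ?B = (`) (rot L) ` m1 \<longleftrightarrow> m1 = \<mu>1 \<rho>"
  proof -
    have "(`) (rot L) ` (`) (rot L) ` m1 = m1" using blocks rrb by (force simp: image_image)
    moreover have "(`) (rot L) ` (`) (rot L) ` arcs ?B = arcs ?B" using blocks2 rrb by (force simp: image_image)
    ultimately show ?thesis unfolding \<mu> by metis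
  qed
  have equiv: "cleaved_equiv ?C1 ?C2 \<longleftrightarrow> m2 = \<mu>2 \<rho> \<and> m1 = \<mu>1 \<rho> \<and>
      (\<forall>c\<in>curves ?C1. decoration ?C2 (rot L ` c) = decoration ?C1 c)"
  proof -
    \<comment> \<open>Equality of the mapped lists makes \<open>f\<close> and \<open>rot L\<close>
      agree on \<open>set es\<close>, and all blocks and curves lie in this set.\<close>
    have im: "f ` b = rot L ` b" if "map (rot L) es = map f es" "b \<subseteq> set es" for f b
      using that by (intro image_cong) auto
    have im2: "(`) f ` M = (`) (rot L) ` M" if "map (rot L) es = map f es" "\<And>b. b \<in> M \<Longrightarrow> b \<subseteq> set es" for f M
      by (rule image_cong[OF refl im]) (rule that; assumption)+
    have cu: "c \<subseteq> set es" if "c \<in> curves ?C1" for c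
      using curve_subset[OF link(1) that] by (simp add: cleaved_of_def)
    have E: "points ?C1 = es" "points ?C2 = map (rot L) es" "inner ?C1 = arcs ?A" "outer ?C1 = m1"
      "inner ?C2 = m2" "outer ?C2 = arcs ?B"
      by (simp_all add: cleaved_of_def)
    show ?thesis
    proof
      assume "cleaved_equiv ?C1 ?C2"
      then obtain f where f: "map (rot L) es = map f es" "m2 = (`) f ` arcs ?A" "arcs ?B = (`) f ` m1"
        "\<forall>c\<in>curves ?C1. decoration ?C2 (f ` c) = decoration ?C1 c"
        unfolding cleaved_equiv_def E by blast
      have "(`) f ` arcs ?A = (`) (rot L) ` arcs ?A" "(`) f ` m1 = (`) (rot L) ` m1"
        by (rule im2[OF f(1)]; simp add: blocks)+
      then have "m2 = \<mu>2 \<rho>" "arcs ?B = (`) (rot L) ` m1" using f(2,3) \<mu>(2) by simp_all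
      then show "m2 = \<mu>2 \<rho> \<and> m1 = \<mu>1 \<rho> \<and>
          (\<forall>c\<in>curves ?C1. decoration ?C2 (rot L ` c) = decoration ?C1 c)"
        using m1 f(4) im[OF f(1) cu] by metis
    next
      assume R: "m2 = \<mu>2 \<rho> \<and> m1 = \<mu>1 \<rho> \<and>
          (\<forall>c\<in>curves ?C1. decoration ?C2 (rot L ` c) = decoration ?C1 c)"
      show "cleaved_equiv ?C1 ?C2"
        unfolding cleaved_equiv_def E
        by (rule exI[of _ "rot L"]) (use R inj m1 \<mu>(2) in metis)
    qed
  qed
  have dec: "(\<forall>c\<in>curves ?C1. decoration ?C2 (rot L ` c) = decoration ?C1 c) \<longleftrightarrow>
      (\<forall>C\<in>?K. C \<inter> set es \<noteq> {} \<longrightarrow> s1 (C \<inter> X) = s2 (C \<inter> Y))"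
    if m: "m2 = \<mu>2 \<rho>" "m1 = \<mu>1 \<rho>"
  proof -
    have cut: "cut_circles T1 \<rho>1 m1 = (\<lambda>C. C \<inter> X) ` {C \<in> ?K. C \<inter> set es \<noteq> {}}"
      "cut_circles T2 \<rho>2 m2 = (\<lambda>C. C \<inter> Y) ` {C \<in> ?K. C \<inter> set es \<noteq> {}}"
      unfolding m \<rho>(2,3)[symmetric] by (rule cut_free_parts[OF \<rho>(1)])+
    have 1: "C \<inter> X \<inter> set es = C \<inter> set es" for C using es_subset(1) by blast
    have 2: "C \<inter> Y \<inter> rot L ` set es = rot L ` (C \<inter> set es)" if "C \<in> ?K" for C
      using es_subset(2) component_cases(2)[OF \<rho>(1) that] by blast
    have "curves ?C1 = (\<lambda>C. C \<inter> set es) ` {C \<in> ?K. C \<inter> set es \<noteq> {}}"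
      using curves_cleaved_of[OF tangles(1) r1] by (simp add: cut(1) image_image 1)
    moreover have "decoration ?C1 (C \<inter> set es) = s1 (C \<inter> X)" if "C \<in> ?K" "C \<inter> set es \<noteq> {}" for C
      using decoration_cleaved_of[of "C \<inter> X" T1 \<rho>1 m1 Inside s1] that cut(1) by (auto simp: 1)
    moreover have "decoration ?C2 (rot L ` (C \<inter> set es)) = s2 (C \<inter> Y)" if "C \<in> ?K" "C \<inter> set es \<noteq> {}" for C
      using decoration_cleaved_of[of "C \<inter> Y" T2 \<rho>2 m2 Outside s2] that cut(2) 2[OF that(1)] by auto
    ultimately show ?thesis by auto
  qed
  have B: "boundary Outside n T2 (\<rho>2, m2, s2) = boundary Inside n T1 (\<rho>1, m1, s1) \<longleftrightarrow> cleaved_equiv ?C1 ?C2"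
    unfolding boundary_eq using cleaved_class_eq_iff[OF link] by auto
  have "P \<longleftrightarrow> R1 \<and> R2 \<and> U" if "P \<longleftrightarrow> Q" "Q \<longleftrightarrow> R2 \<and> R1 \<and> V" "R2 \<Longrightarrow> R1 \<Longrightarrow> V \<longleftrightarrow> U" for P Q R1 R2 U V
    using that by blast
  from this[OF B equiv dec] show ?thesis .
qed

text \<open>On a cut circle both decorations are available, and they agree for pairs with the same
  boundary; the inside one is taken. The tangles share no crossing, so \<open>++\<close> overrides
  nothing.\<close>

definition merge_pair :: "'d resolution \<times> 'd resolution \<Rightarrow> ('d set \<rightharpoonup> nat) \<times> ('d set \<rightharpoonup> int)" where
  "merge_pair = (\<lambda>((\<rho>1, m1, s1), (\<rho>2, m2, s2)). (\<rho>1 ++ \<rho>2,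
     \<lambda>C. if C \<in> components (resolve (\<rho>1 ++ \<rho>2) L)
       then if C \<inter> X \<noteq> {} then s1 (C \<inter> X) else s2 (C \<inter> Y) else None))"

text \<open>A part \<open>K\<close> of a circle inherits the sign of the whole circle, which is
  recovered by saturating \<open>K\<close> in the resolved link. The value \<open>None\<close> off
  \<open>Z\<close> gives the exact domain that a decorated resolution requires.\<close>

definition restr :: "('d set \<rightharpoonup> nat) \<Rightarrow> ('d set \<rightharpoonup> int) \<Rightarrow> 'd set set \<Rightarrow> 'd set \<rightharpoonup> int" where
  "restr \<rho> s Z = (\<lambda>K. if K \<in> Z then s (joined (resolve \<rho> L) `` K) else None)"

definition cut_state :: "('d set \<rightharpoonup> nat) \<times> ('d set \<rightharpoonup> int) \<Rightarrow> 'd resolution \<times> 'd resolution" where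
  "cut_state = (\<lambda>(\<rho>, s).
     ((left \<rho>, \<mu>1 \<rho>, restr \<rho> s (circles T1 (left \<rho>) (\<mu>1 \<rho>))),
      (right \<rho>, \<mu>2 \<rho>, restr \<rho> s (circles T2 (right \<rho>) (\<mu>2 \<rho>)))))"

text \<open>Normal form of a pair with equal boundaries: the resolutions are the restrictions of one
  resolution of \<open>L\<close>, the matchings are forced by it, and both decorations come from a
  single decoration of the circles of \<open>L\<close>.\<close>

lemma pairsE:
  assumes "x \<in> pairs"
  obtains \<rho> s s1 s2 where
    "x = ((left \<rho>, \<mu>1 \<rho>, s1), (right \<rho>, \<mu>2 \<rho>, s2))" "merge_pair x = (\<rho>, s)"
    "\<rho> \<in> maps (crossings L) {0, 1}" "s \<in> maps (components (resolve \<rho> L)) {1, - 1}"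
    "dom s1 = circles T1 (left \<rho>) (\<mu>1 \<rho>)" "dom s2 = circles T2 (right \<rho>) (\<mu>2 \<rho>)"
    "\<And>C. C \<in> components (resolve \<rho> L) \<Longrightarrow> C \<inter> X \<noteq> {} \<Longrightarrow> s1 (C \<inter> X) = s C"
    "\<And>C. C \<in> components (resolve \<rho> L) \<Longrightarrow> C \<inter> Y \<noteq> {} \<Longrightarrow> s2 (C \<inter> Y) = s C"
proof -
  obtain \<rho>1 m1 s1 \<rho>2 m2 s2 where x: "x = ((\<rho>1, m1, s1), (\<rho>2, m2, s2))" by (metis surj_pair)
  have r: "(\<rho>1, m1, s1) \<in> decorated_resolutions T1" "(\<rho>2, m2, s2) \<in> decorated_resolutions T2"
    and b: "boundary Outside n T2 (\<rho>2, m2, s2) = boundary Inside n T1 (\<rho>1, m1, s1)"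
    using assms unfolding x pairs_def by blast+
  note D1 = decorated_resolutionsD[OF r(1)] note D2 = decorated_resolutionsD[OF r(2)]
  define \<rho> where "\<rho> = \<rho>1 ++ \<rho>2"
  define s where "s = (\<lambda>C. if C \<in> components (resolve \<rho> L)
       then if C \<inter> X \<noteq> {} then s1 (C \<inter> X) else s2 (C \<inter> Y) else None)"
  have dom: "dom \<rho> = crossings L" using D1(1) D2(1) crossings_L by (auto simp: \<rho>_def)
  have \<rho>1: "left \<rho> = \<rho>1"
  proof
    fix c
    have "c \<in> crossings T1 \<Longrightarrow> \<rho>2 c = None" using crossings_disjoint D2(1) by blast
    moreover have "c \<notin> crossings T1 \<Longrightarrow> \<rho>1 c = None" using D1(1) by blast
    ultimately show "(left \<rho>) c = \<rho>1 c"
      by (cases "c \<in> crossings T1") (simp_all add: \<rho>_def map_add_def)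
  qed
  have \<rho>2: "right \<rho> = \<rho>2"
  proof
    fix c
    have "c \<in> crossings T2 \<Longrightarrow> \<exists>k. \<rho>2 c = Some k" using D2(1) by blast
    moreover have "c \<notin> crossings T2 \<Longrightarrow> \<rho>2 c = None" using D2(1) by blast
    ultimately show "(right \<rho>) c = \<rho>2 c"
      by (cases "c \<in> crossings T2") (auto simp: \<rho>_def map_add_def)
  qed
  have bd: "m1 = \<mu>1 \<rho>" "m2 = \<mu>2 \<rho>"
    "\<And>C. C \<in> components (resolve \<rho> L) \<Longrightarrow> C \<inter> set es \<noteq> {} \<Longrightarrow> s1 (C \<inter> X) = s2 (C \<inter> Y)"
    using boundary_eq_iff[OF r dom \<rho>1 \<rho>2] b by blast+
  have ran: "ran \<rho> \<subseteq> {0, 1}"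
  proof
    fix v assume "v \<in> ran \<rho>"
    then obtain c where "\<rho> c = Some v" by (auto simp: ran_def)
    then have "v \<in> ran \<rho>1 \<or> v \<in> ran \<rho>2" unfolding \<rho>_def map_add_Some_iff by (auto intro: ranI)
    then show "v \<in> {0, 1}" using D1(2) D2(2) by blast
  qed
  have sX: "s1 (C \<inter> X) = s C" if "C \<in> components (resolve \<rho> L)" "C \<inter> X \<noteq> {}" for C
    using that by (simp add: s_def)
  have sY: "s2 (C \<inter> Y) = s C" if "C \<in> components (resolve \<rho> L)" "C \<inter> Y \<noteq> {}" for C
  proof (cases "C \<inter> X = {}")
    case False
    then show ?thesis using bd(3)[OF that(1)] component_cases(1)[OF dom that(1)] that by (simp add: s_def)
  qed (use that in \<open>simp add: s_def\<close>)
  have d1: "dom s1 = circles T1 (left \<rho>) (\<mu>1 \<rho>)"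
    and d2: "dom s2 = circles T2 (right \<rho>) (\<mu>2 \<rho>)"
    using D1(4) D2(4) bd(1,2) \<rho>1 \<rho>2 by simp_all
  have val: "\<exists>v\<in>{1, - 1}. s C = Some v" if C: "C \<in> components (resolve \<rho> L)" for C
    using component_cases(3)[OF dom C]
  proof
    assume "C \<inter> X \<noteq> {}"
    then have "C \<inter> X \<in> dom s1" unfolding d1 circles_parts[OF dom] using C by blast
    then obtain v where "s1 (C \<inter> X) = Some v" by blast
    then show ?thesis using D1(5) sX[OF C \<open>C \<inter> X \<noteq> {}\<close>] by (auto simp: ran_def)
  next
    assume "C \<inter> Y \<noteq> {}"
    then have "C \<inter> Y \<in> dom s2" unfolding d2 circles_parts[OF dom] using C by blast
    then obtain v where "s2 (C \<inter> Y) = Some v" by blast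
    then show ?thesis using D2(5) sY[OF C \<open>C \<inter> Y \<noteq> {}\<close>] by (auto simp: ran_def)
  qed
  have s_none: "s C = None" if "C \<notin> components (resolve \<rho> L)" for C using that by (simp add: s_def)
  have "s \<in> maps (components (resolve \<rho> L)) {1, - 1}"
    unfolding maps_def
  proof (intro CollectI conjI)
    show "dom s = components (resolve \<rho> L)"
    proof (intro equalityI subsetI)
      fix C assume "C \<in> dom s"
      then show "C \<in> components (resolve \<rho> L)" using s_none by (metis domIff)
    next
      fix C assume "C \<in> components (resolve \<rho> L)"
      then show "C \<in> dom s" using val by blast
    qed
    show "ran s \<subseteq> {1, - 1}"
    proof
      fix v assume "v \<in> ran s"
      then obtain C where C: "s C = Some v" by (auto simp: ran_def)
      then have "C \<in> components (resolve \<rho> L)" using s_none[of C] by fastforce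
      then show "v \<in> {1, - 1}" using val[of C] C by auto
    qed
  qed
  moreover have "merge_pair x = (\<rho>, s)" unfolding x merge_pair_def \<rho>_def s_def by simp
  moreover have "\<rho> \<in> maps (crossings L) {0, 1}" using dom ran by (simp add: maps_def)
  ultimately show thesis
    using that[of \<rho> s1 s2 s] x bd(1,2) \<rho>1 \<rho>2 sX sY d1 d2 by simp
qed

lemma restr_parts:
  assumes \<rho>: "dom \<rho> = crossings L" and C: "C \<in> components (resolve \<rho> L)"
  shows "C \<inter> X \<noteq> {} \<Longrightarrow> restr \<rho> s (circles T1 (left \<rho>) (\<mu>1 \<rho>)) (C \<inter> X) = s C"
    and "C \<inter> Y \<noteq> {} \<Longrightarrow> restr \<rho> s (circles T2 (right \<rho>) (\<mu>2 \<rho>)) (C \<inter> Y) = s C"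
proof -
  note rec = glued.component_recover[OF glued_resolve[OF \<rho>] C]
  assume "C \<inter> X \<noteq> {}"
  then show "restr \<rho> s (circles T1 (left \<rho>) (\<mu>1 \<rho>)) (C \<inter> X) = s C"
    unfolding restr_def circles_parts[OF \<rho>] using C rec by auto
next
  note rec = glued.component_recover[OF glued_resolve[OF \<rho>] C]
  assume "C \<inter> Y \<noteq> {}"
  then show "restr \<rho> s (circles T2 (right \<rho>) (\<mu>2 \<rho>)) (C \<inter> Y) = s C"
    unfolding restr_def circles_parts[OF \<rho>] using C rec by auto
qed

lemma cut_state_merge:
  assumes "x \<in> pairs"
  shows "cut_state (merge_pair x) = x" and "merge_pair x \<in> states"
proof -
  obtain \<rho> s s1 s2 where x:
    "x = ((left \<rho>, \<mu>1 \<rho>, s1), (right \<rho>, \<mu>2 \<rho>, s2))" "merge_pair x = (\<rho>, s)"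
    "\<rho> \<in> maps (crossings L) {0, 1}" "s \<in> maps (components (resolve \<rho> L)) {1, - 1}"
    "dom s1 = circles T1 (left \<rho>) (\<mu>1 \<rho>)" "dom s2 = circles T2 (right \<rho>) (\<mu>2 \<rho>)"
    "\<And>C. C \<in> components (resolve \<rho> L) \<Longrightarrow> C \<inter> X \<noteq> {} \<Longrightarrow> s1 (C \<inter> X) = s C"
    "\<And>C. C \<in> components (resolve \<rho> L) \<Longrightarrow> C \<inter> Y \<noteq> {} \<Longrightarrow> s2 (C \<inter> Y) = s C"
    by (rule pairsE[OF assms]) (rule that)
  show "merge_pair x \<in> states" using x(2-4) by (simp add: states_def)
  have dom: "dom \<rho> = crossings L" using x(3) by (simp add: maps_def)
  have "restr \<rho> s (circles T1 (left \<rho>) (\<mu>1 \<rho>)) = s1"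
  proof
    fix K
    show "restr \<rho> s (circles T1 (left \<rho>) (\<mu>1 \<rho>)) K = s1 K"
    proof (cases "K \<in> dom s1")
      case True
      then obtain C where C: "C \<in> components (resolve \<rho> L)" "C \<inter> X \<noteq> {}" "K = C \<inter> X"
        unfolding x(5) circles_parts[OF dom] by blast
      then show ?thesis using restr_parts(1)[OF dom C(1,2)] x(7)[OF C(1,2)] by simp
    next
      case False
      then have "s1 K = None" by (simp add: domIff)
      then show ?thesis using False x(5) by (simp add: restr_def)
    qed
  qed
  moreover have "restr \<rho> s (circles T2 (right \<rho>) (\<mu>2 \<rho>)) = s2"
  proof
    fix K
    show "restr \<rho> s (circles T2 (right \<rho>) (\<mu>2 \<rho>)) K = s2 K"
    proof (cases "K \<in> dom s2")
      case True
      then obtain C where C: "C \<in> components (resolve \<rho> L)" "C \<inter> Y \<noteq> {}" "K = C \<inter> Y"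
        unfolding x(6) circles_parts[OF dom] by blast
      then show ?thesis using restr_parts(2)[OF dom C(1,2)] x(8)[OF C(1,2)] by simp
    next
      case False
      then have "s2 K = None" by (simp add: domIff)
      then show ?thesis using False x(6) by (simp add: restr_def)
    qed
  qed
  ultimately show "cut_state (merge_pair x) = x" unfolding x(2) by (simp add: cut_state_def x(1))
qed

lemma restr_maps:
  assumes "\<And>K. K \<in> Z \<Longrightarrow> joined (resolve \<rho> L) `` K \<in> dom s" "ran s \<subseteq> V"
  shows "dom (restr \<rho> s Z) = Z" "ran (restr \<rho> s Z) \<subseteq> V"
proof -
  have "s (joined (resolve \<rho> L) `` K) \<noteq> None" if "K \<in> Z" for K
    using assms(1)[OF that] by (simp add: domIff)
  then show "dom (restr \<rho> s Z) = Z" unfolding dom_def restr_def by auto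
  show "ran (restr \<rho> s Z) \<subseteq> V"
  proof
    fix v assume "v \<in> ran (restr \<rho> s Z)"
    then obtain K where "restr \<rho> s Z K = Some v" by (auto simp: ran_def)
    then have "s (joined (resolve \<rho> L) `` K) = Some v" by (simp add: restr_def split: if_splits)
    then show "v \<in> V" using assms(2) by (auto simp: ran_def)
  qed
qed

lemma merge_cut_state:
  assumes "y \<in> states"
  shows "merge_pair (cut_state y) = y" and "cut_state y \<in> pairs"
proof -
  obtain \<rho> s where y: "y = (\<rho>, s)" "\<rho> \<in> maps (crossings L) {0, 1}" "s \<in> maps (components (resolve \<rho> L)) {1, - 1}"
    using assms by (auto simp: states_def)
  have dom: "dom \<rho> = crossings L" "ran \<rho> \<subseteq> {0, 1}" using y(2) by (auto simp: maps_def)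
  have s: "dom s = components (resolve \<rho> L)" "ran s \<subseteq> {1, - 1}" using y(3) by (auto simp: maps_def)
  let ?\<rho>1 = "left \<rho>" and ?\<rho>2 = "right \<rho>"
  let ?s1 = "restr \<rho> s (circles T1 ?\<rho>1 (\<mu>1 \<rho>))" and ?s2 = "restr \<rho> s (circles T2 ?\<rho>2 (\<mu>2 \<rho>))"
  note G = glued_resolve[OF dom(1)]
  have sp: "cut_state y = ((?\<rho>1, \<mu>1 \<rho>, ?s1), (?\<rho>2, \<mu>2 \<rho>, ?s2))" by (simp add: y cut_state_def)
  have add: "?\<rho>1 ++ ?\<rho>2 = \<rho>"
  proof
    fix c
    have "c \<notin> crossings T1 \<Longrightarrow> c \<notin> crossings T2 \<Longrightarrow> \<rho> c = None" using dom(1) crossings_L by blast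
    then show "(?\<rho>1 ++ ?\<rho>2) c = \<rho> c"
      by (auto simp: map_add_def restrict_map_def split: option.split)
  qed
  have sv: "(if C \<in> components (resolve \<rho> L) then if C \<inter> X \<noteq> {} then ?s1 (C \<inter> X) else ?s2 (C \<inter> Y) else None) = s C" for C
  proof (cases "C \<in> components (resolve \<rho> L)")
    case True
    show ?thesis
    proof (cases "C \<inter> X = {}")
      case F: True
      then have "C \<inter> Y \<noteq> {}" using component_cases(3)[OF dom(1) True] by simp
      then show ?thesis using restr_parts(2)[OF dom(1) True] True F by simp
    qed (use restr_parts(1)[OF dom(1) True] True in simp)
  next
    case False
    then have "C \<notin> dom s" using s(1) by simp
    then have "s C = None" by (simp add: domIff)
    then show ?thesis using False by simp
  qed
  show "merge_pair (cut_state y) = y" unfolding sp unfolding merge_pair_def y(1) by (simp add: add sv)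
  have rec: "joined (resolve \<rho> L) `` K \<in> dom s"
    if "K \<in> circles T1 ?\<rho>1 (\<mu>1 \<rho>) \<or> K \<in> circles T2 ?\<rho>2 (\<mu>2 \<rho>)" for K
    using that
  proof
    assume "K \<in> circles T1 ?\<rho>1 (\<mu>1 \<rho>)"
    then obtain C where C: "C \<in> components (resolve \<rho> L)" "C \<inter> X \<noteq> {}" "K = C \<inter> X"
      unfolding circles_parts[OF dom(1)] by blast
    then show ?thesis using glued.component_recover[OF G C(1,2)] s(1) by simp
  next
    assume "K \<in> circles T2 ?\<rho>2 (\<mu>2 \<rho>)"
    then obtain C where C: "C \<in> components (resolve \<rho> L)" "C \<inter> Y \<noteq> {}" "K = C \<inter> Y"
      unfolding circles_parts[OF dom(1)] by blast
    then show ?thesis using glued.component_recover[OF G C(1,2)] s(1) by simp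
  qed
  have d: "dom ?\<rho>1 = crossings T1" "dom ?\<rho>2 = crossings T2" using dom(1) crossings_L by auto
  have ran: "ran ?\<rho>1 \<subseteq> {0, 1}" "ran ?\<rho>2 \<subseteq> {0, 1}" using dom(2) by (auto simp: ran_def restrict_map_def)
  have r1: "(?\<rho>1, \<mu>1 \<rho>, ?s1) \<in> decorated_resolutions T1"
    unfolding decorated_resolutions_def
    using d(1) ran(1) glued.planar_matching_matching[OF G] restr_maps[of "circles T1 ?\<rho>1 (\<mu>1 \<rho>)" \<rho> s, OF _ s(2)] rec
    by simp
  have r2: "(?\<rho>2, \<mu>2 \<rho>, ?s2) \<in> decorated_resolutions T2"
    unfolding decorated_resolutions_def
    using d(2) ran(2) glued.planar_matching_matching[OF glued.swap[OF G]] restr_maps[of "circles T2 ?\<rho>2 (\<mu>2 \<rho>)" \<rho> s, OF _ s(2)] rec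
    by simp
  have "?s1 (C \<inter> X) = ?s2 (C \<inter> Y)" if "C \<in> components (resolve \<rho> L)" "C \<inter> set es \<noteq> {}" for C
    using restr_parts[OF dom(1) that(1)] component_cases(1)[OF dom(1) that(1)] that(2) by simp
  then show "cut_state y \<in> pairs"
    unfolding sp pairs_def using r1 r2 boundary_eq_iff[OF r1 r2 dom(1) refl refl] by blast
qed

lemma sum_parts:
  assumes \<rho>: "dom \<rho> = crossings L"
    and s1: "\<And>C. C \<in> components (resolve \<rho> L) \<Longrightarrow> C \<inter> X \<noteq> {} \<Longrightarrow> s1 (C \<inter> X) = s C"
    and s2: "\<And>C. C \<in> components (resolve \<rho> L) \<Longrightarrow> C \<inter> Y \<noteq> {} \<Longrightarrow> s2 (C \<inter> Y) = s C"
  defines "\<rho>1 \<equiv> left \<rho>" and "\<rho>2 \<equiv> right \<rho>"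
  shows "(\<Sum>C\<in>components (resolve \<rho> L). of_int (the (s C)) :: rat) =
    (\<Sum>C\<in>free_circles T1 \<rho>1 (\<mu>1 \<rho>). of_int (the (s1 C))) + 1 / 2 * (\<Sum>C\<in>cut_circles T1 \<rho>1 (\<mu>1 \<rho>). of_int (the (s1 C))) +
    ((\<Sum>C\<in>free_circles T2 \<rho>2 (\<mu>2 \<rho>). of_int (the (s2 C))) + 1 / 2 * (\<Sum>C\<in>cut_circles T2 \<rho>2 (\<mu>2 \<rho>). of_int (the (s2 C))))"
proof -
  define K where "K = components (resolve \<rho> L)"
  define K1 where "K1 = {C \<in> K. C \<inter> X \<noteq> {} \<and> C \<inter> set es = {}}"
  define K2 where "K2 = {C \<in> K. C \<inter> Y \<noteq> {} \<and> C \<inter> set es = {}}"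
  define Kc where "Kc = {C \<in> K. C \<inter> set es \<noteq> {}}"
  let ?w = "\<lambda>s C. of_int (the (s C)) :: rat"
  have cases: "C \<inter> set es \<noteq> {} \<longleftrightarrow> C \<inter> X \<noteq> {} \<and> C \<inter> Y \<noteq> {}" "C \<inter> X \<noteq> {} \<or> C \<inter> Y \<noteq> {}" if "C \<in> K" for C
    by (rule component_cases[OF \<rho> that[unfolded K_def]])+
  have inj: "inj_on (\<lambda>C. C \<inter> Z) A" if Z: "\<And>C. C \<in> A \<Longrightarrow> C \<in> K \<and> C \<inter> Z \<noteq> {}" for Z A
  proof (rule inj_onI)
    fix C C' assume *: "C \<in> A" "C' \<in> A" "C \<inter> Z = C' \<inter> Z"
    then obtain x where "x \<in> C" "x \<in> C'" using Z[OF *(1)] by blast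
    then show "C = C'" using components_eqI[of C "resolve \<rho> L" C'] Z *(1,2) by (simp add: K_def)
  qed
  have sums: "(\<Sum>C\<in>(\<lambda>C. C \<inter> X) ` K1. ?w s1 C) = (\<Sum>C\<in>K1. ?w s C)"
    "(\<Sum>C\<in>(\<lambda>C. C \<inter> X) ` Kc. ?w s1 C) = (\<Sum>C\<in>Kc. ?w s C)"
    "(\<Sum>C\<in>(\<lambda>C. C \<inter> Y) ` K2. ?w s2 C) = (\<Sum>C\<in>K2. ?w s C)"
    "(\<Sum>C\<in>(\<lambda>C. C \<inter> Y) ` Kc. ?w s2 C) = (\<Sum>C\<in>Kc. ?w s C)"
  proof -
    have 1: "C \<in> K \<and> C \<inter> X \<noteq> {}" if "C \<in> K1" for C using that by (simp add: K1_def)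
    have 2: "C \<in> K \<and> C \<inter> Y \<noteq> {}" if "C \<in> K2" for C using that by (simp add: K2_def)
    have 3: "C \<in> K \<and> C \<inter> X \<noteq> {}" "C \<in> K \<and> C \<inter> Y \<noteq> {}" if "C \<in> Kc" for C
    proof -
      have "C \<in> K" "C \<inter> set es \<noteq> {}" using that unfolding Kc_def by blast+
      then show "C \<in> K \<and> C \<inter> X \<noteq> {}" "C \<in> K \<and> C \<inter> Y \<noteq> {}" using cases(1)[of C] by blast+
    qed
    have ws: "?w s1 (C \<inter> X) = ?w s C" if "C \<in> K \<and> C \<inter> X \<noteq> {}" for C using s1 that by (simp add: K_def)
    have ws': "?w s2 (C \<inter> Y) = ?w s C" if "C \<in> K \<and> C \<inter> Y \<noteq> {}" for C using s2 that by (simp add: K_def)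
    show "(\<Sum>C\<in>(\<lambda>C. C \<inter> X) ` K1. ?w s1 C) = (\<Sum>C\<in>K1. ?w s C)"
      by (subst sum.reindex[OF inj]; (intro sum.cong refl)?) (simp_all only: 1 o_def ws not_False_eq_True)
    show "(\<Sum>C\<in>(\<lambda>C. C \<inter> X) ` Kc. ?w s1 C) = (\<Sum>C\<in>Kc. ?w s C)"
      by (subst sum.reindex[OF inj]; (intro sum.cong refl)?) (simp_all only: 3 o_def ws not_False_eq_True)
    show "(\<Sum>C\<in>(\<lambda>C. C \<inter> Y) ` K2. ?w s2 C) = (\<Sum>C\<in>K2. ?w s C)"
      by (subst sum.reindex[OF inj]; (intro sum.cong refl)?) (simp_all only: 2 o_def ws' not_False_eq_True)
    show "(\<Sum>C\<in>(\<lambda>C. C \<inter> Y) ` Kc. ?w s2 C) = (\<Sum>C\<in>Kc. ?w s C)"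
      by (subst sum.reindex[OF inj]; (intro sum.cong refl)?) (simp_all only: 3 o_def ws' not_False_eq_True)
  qed
  have "finite K" using diagramD(1)[OF diagram_L] by (simp add: K_def components_eq)
  then have fin: "finite K1" "finite K2" "finite Kc" by (simp_all add: K1_def K2_def Kc_def)
  \<comment> \<open>Circles inside, circles outside and cut circles. The last kind occurs in the
    sums of both tangles, each time with factor one half.\<close>
  have "K = K1 \<union> K2 \<union> Kc" using cases(2) by (auto simp: K1_def K2_def Kc_def)
  moreover have "K1 \<inter> K2 = {}" "(K1 \<union> K2) \<inter> Kc = {}"
    using cases(1) unfolding K1_def K2_def Kc_def by blast+
  ultimately have "(\<Sum>C\<in>K. ?w s C) = (\<Sum>C\<in>K1. ?w s C) + (\<Sum>C\<in>K2. ?w s C) + (\<Sum>C\<in>Kc. ?w s C)"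
    using fin by (simp add: sum.union_disjoint)
  moreover note c = cut_free_parts[OF \<rho>, folded K_def, folded K1_def K2_def Kc_def]
  ultimately show ?thesis unfolding \<rho>1_def \<rho>2_def c sums K_def[symmetric] by simp
qed

end

section \<open>Monomials and weights\<close>

lemma q_pow_0 [simp]: "q_pow 0 = 1"
  by (simp add: q_pow_def)

text \<open>\<open>q_pow\<close> rounds twice its argument down, so exponents do not add in general.
  An integer summand can be taken out of the floor, hence one half-integral exponent is
  enough.\<close>

lemma q_pow_add:
  assumes "2 * a = of_int k"
  shows "q_pow (a + b) = q_pow a * q_pow b"
proof -
  have "2 * (a + b) = of_int k + 2 * b" using assms by simp
  then have "\<lfloor>2 * (a + b)\<rfloor> = k + \<lfloor>2 * b\<rfloor>" by (simp only: int_add_floor)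
  then show ?thesis using assms by (simp add: q_pow_def mult_single)
qed

lemma q_pow_of_nat: "q_pow (of_nat k) = q_pow 1 ^ k"
proof (induction k)
  case (Suc k)
  have "q_pow (1 + of_nat k) = q_pow 1 * q_pow (of_nat k)" by (rule q_pow_add[of _ 2]) simp
  then show ?case using Suc by simp
qed simp

lemma sum_maps_q_pow:
  assumes "finite K"
  shows "(\<Sum>s\<in>maps K {1, - 1}. q_pow (\<Sum>C\<in>K. of_int (the (s C)))) = (q_pow 1 + q_pow (- 1)) ^ card K"
  using assms
proof (induction K rule: finite_induct)
  case (insert c K)
  have *: "q_pow (\<Sum>C\<in>insert c K. of_int (the ((s(c \<mapsto> v)) C))) = q_pow (of_int v) * q_pow (\<Sum>C\<in>K. of_int (the (s C)))"
    for s and v :: int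
  proof -
    have "(\<Sum>C\<in>K. of_int (the ((s(c \<mapsto> v)) C))) = (\<Sum>C\<in>K. of_int (the (s C)) :: rat)"
      by (rule sum.cong) (use insert.hyps(2) in auto)
    then have "(\<Sum>C\<in>insert c K. of_int (the ((s(c \<mapsto> v)) C))) = of_int v + (\<Sum>C\<in>K. of_int (the (s C)) :: rat)"
      unfolding sum.insert[OF insert.hyps] by simp
    then show ?thesis using q_pow_add[of "of_int v" "2 * v"] by simp
  qed
  have "(\<Sum>s\<in>maps (insert c K) {1, - 1}. q_pow (\<Sum>C\<in>insert c K. of_int (the (s C)))) =
      (\<Sum>s\<in>maps K {1, - 1}. q_pow 1 * q_pow (\<Sum>C\<in>K. of_int (the (s C))) + q_pow (- 1) * q_pow (\<Sum>C\<in>K. of_int (the (s C))))"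
    unfolding sum_maps_insert[OF insert.hyps, of "1 :: int" "- 1", simplified] * by simp
  also have "\<dots> = (q_pow 1 + q_pow (- 1)) * (\<Sum>s\<in>maps K {1, - 1}. q_pow (\<Sum>C\<in>K. of_int (the (s C))))"
    by (simp add: sum.distrib sum_distrib_left distrib_right)
  finally show ?case using insert by simp
qed simp

text \<open>Two occurrences of \<open>- n_minus\<close>, one from the homological grading and one
  from the final shift, combine to the exponent \<open>n_plus - 2 * n_minus\<close> of the Jones
  normalization. The sign is rewritten with a natural exponent, as a sum and a difference have the
  same parity. The second claim supplies the integrality for \<open>q_pow_add\<close>.\<close>

lemma weight_eq:
  fixes T :: "'d diagram" and tails :: "'d set"
  defines "S \<equiv> \<lambda>\<rho> m s. (\<Sum>C\<in>free_circles T \<rho> m. of_int (the (s C))) + 1 / 2 * (\<Sum>C\<in>cut_circles T \<rho> m. of_int (the (s C))) :: rat"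
  defines "I \<equiv> \<lambda>\<rho> m s. of_nat (\<Sum>c\<in>crossings T. the (\<rho> c)) + S \<rho> m s + (of_nat (n_plus tails T) - 2 * of_nat (n_minus tails T))"
  shows "weight tails T (\<rho>, m, s) = (- 1) ^ (n_minus tails T + (\<Sum>c\<in>crossings T. the (\<rho> c))) * q_pow (I \<rho> m s)"
    and "\<exists>k. 2 * I \<rho> m s = of_int k"
proof -
  let ?e = "\<Sum>c\<in>crossings T. the (\<rho> c)"
  have h: "h_grading tails T \<rho> = int ?e - int (n_minus tails T)" by (simp add: h_grading_def)
  have "even (h_grading tails T \<rho>) \<longleftrightarrow> even (n_minus tails T + ?e)"
    unfolding h by (metis even_add even_diff even_of_nat add.commute of_nat_add)
  moreover have "I_grading tails T (\<rho>, m, s) = I \<rho> m s" by (simp add: h I_def S_def)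
  ultimately show "weight tails T (\<rho>, m, s) = (- 1) ^ (n_minus tails T + ?e) * q_pow (I \<rho> m s)"
    by (simp del: I_grading.simps add: minus_one_power_iff)
  show "\<exists>k. 2 * I \<rho> m s = of_int k"
    by (rule exI[of _ "2 * int ?e + 2 * (\<Sum>C\<in>free_circles T \<rho> m. the (s C)) + (\<Sum>C\<in>cut_circles T \<rho> m. the (s C)) +
        2 * (int (n_plus tails T) - 2 * int (n_minus tails T))"])
      (simp add: I_def S_def algebra_simps)
qed

lemma finite_decorated_resolutions:
  assumes "diagram T"
  shows "finite (decorated_resolutions T)"
proof -
  have "finite (circles T \<rho> m)" for \<rho> m
    using diagramD(1)[OF assms] by (simp add: circles_def components_eq)
  then have "finite (SIGMA \<rho>:maps (crossings T) {0, 1}. SIGMA m:Pow (Pow (set (ends T))). maps (circles T \<rho> m) {1 :: int, - 1})"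
    using finite_crossings[OF assms] by (intro finite_SigmaI finite_maps) simp_all
  moreover have "decorated_resolutions T \<subseteq>
      (SIGMA \<rho>:maps (crossings T) {0, 1}. SIGMA m:Pow (Pow (set (ends T))). maps (circles T \<rho> m) {1, - 1})"
  proof
    fix r assume r: "r \<in> decorated_resolutions T"
    obtain \<rho> m s where r': "r = (\<rho>, m, s)" by (cases r)
    note D = decorated_resolutionsD[OF r[unfolded r']]
    have "m \<in> Pow (Pow (set (ends T)))" using planar_matchingD(3)[OF D(3)] by blast
    then show "r \<in> (SIGMA \<rho>:maps (crossings T) {0, 1}. SIGMA m:Pow (Pow (set (ends T))). maps (circles T \<rho> m) {1, - 1})"
      using D unfolding r' by (simp add: maps_def)
  qed
  ultimately show ?thesis by (rule rev_finite_subset)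
qed

context cut_link
begin

definition state_weight :: "'d set \<Rightarrow> ('d set \<rightharpoonup> nat) \<times> ('d set \<rightharpoonup> int) \<Rightarrow> laurent" where
  "state_weight tails = (\<lambda>(\<rho>, s). (- 1) ^ n_minus tails L * q_pow (of_nat (n_plus tails L) - 2 * of_nat (n_minus tails L)) *
     ((- q_pow 1) ^ (\<Sum>c\<in>crossings L. the (\<rho> c)) * q_pow (\<Sum>C\<in>components (resolve \<rho> L). of_int (the (s C)))))"

lemma weight_merge:
  assumes "x \<in> pairs"
  shows "state_weight tails (merge_pair x) = weight tails T1 (fst x) * weight tails T2 (snd x)"
proof -
  obtain \<rho> s s1 s2 where x:
    "x = ((left \<rho>, \<mu>1 \<rho>, s1), (right \<rho>, \<mu>2 \<rho>, s2))" "merge_pair x = (\<rho>, s)"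
    "\<rho> \<in> maps (crossings L) {0, 1}" "s \<in> maps (components (resolve \<rho> L)) {1, - 1}"
    "dom s1 = circles T1 (left \<rho>) (\<mu>1 \<rho>)" "dom s2 = circles T2 (right \<rho>) (\<mu>2 \<rho>)"
    and s: "\<And>C. C \<in> components (resolve \<rho> L) \<Longrightarrow> C \<inter> X \<noteq> {} \<Longrightarrow> s1 (C \<inter> X) = s C"
    "\<And>C. C \<in> components (resolve \<rho> L) \<Longrightarrow> C \<inter> Y \<noteq> {} \<Longrightarrow> s2 (C \<inter> Y) = s C"
    by (rule pairsE[OF assms]) (rule that)
  have dom: "dom \<rho> = crossings L" using x(3) by (simp add: maps_def)
  let ?\<rho>1 = "left \<rho>" and ?\<rho>2 = "right \<rho>"
  define e where "e = (\<Sum>c\<in>crossings L. the (\<rho> c))"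
  define e1 where "e1 = (\<Sum>c\<in>crossings T1. the (?\<rho>1 c))"
  define e2 where "e2 = (\<Sum>c\<in>crossings T2. the (?\<rho>2 c))"
  have e: "e = e1 + e2"
    unfolding e_def e1_def e2_def crossings_L
    using sum.union_disjoint[OF finite_crossings_parts crossings_disjoint, of "\<lambda>c. the (\<rho> c)"] by simp
  define S where "S = (\<Sum>C\<in>components (resolve \<rho> L). of_int (the (s C)) :: rat)"
  define S1 where "S1 = (\<Sum>C\<in>free_circles T1 ?\<rho>1 (\<mu>1 \<rho>). of_int (the (s1 C))) +
      1 / 2 * (\<Sum>C\<in>cut_circles T1 ?\<rho>1 (\<mu>1 \<rho>). of_int (the (s1 C))  :: rat)"
  define S2 where "S2 = (\<Sum>C\<in>free_circles T2 ?\<rho>2 (\<mu>2 \<rho>). of_int (the (s2 C))) +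
      1 / 2 * (\<Sum>C\<in>cut_circles T2 ?\<rho>2 (\<mu>2 \<rho>). of_int (the (s2 C))  :: rat)"
  have S: "S = S1 + S2"
    unfolding S_def S1_def S2_def by (rule sum_parts[OF dom]) (fact s)+
  define N1 where "N1 = (of_nat (n_plus tails T1) - 2 * of_nat (n_minus tails T1) :: rat)"
  define N2 where "N2 = (of_nat (n_plus tails T2) - 2 * of_nat (n_minus tails T2) :: rat)"
  define N where "N = (of_nat (n_plus tails L) - 2 * of_nat (n_minus tails L) :: rat)"
  have N: "N = N1 + N2" by (simp add: N_def N1_def N2_def n_plus_L n_minus_L)
  note w1 = weight_eq[where tails = tails and T = T1 and \<rho> = ?\<rho>1 and m = "\<mu>1 \<rho>" and s = s1,
      folded e1_def S1_def N1_def]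
  note w2 = weight_eq[where tails = tails and T = T2 and \<rho> = ?\<rho>2 and m = "\<mu>2 \<rho>" and s = s2,
      folded e2_def S2_def N2_def]
  \<comment> \<open>The cut circles may make this exponent half-integral. For the product of both
    weights it suffices that its double is an integer.\<close>
  obtain k where k: "2 * (of_nat e1 + S1 + N1) = of_int k" using w1(2) by blast
  have "q_pow (of_nat e1 + S1 + N1) * q_pow (of_nat e2 + S2 + N2) = q_pow (N + (of_nat e + S))"
    using q_pow_add[OF k, of "of_nat e2 + S2 + N2"] by (simp add: e S N algebra_simps)
  also have "\<dots> = q_pow N * (q_pow (of_nat e) * q_pow S)"
  proof -
    have "2 * N = of_int (2 * (int (n_plus tails L) - 2 * int (n_minus tails L)))" by (simp add: N_def)
    moreover have "2 * of_nat e = (of_int (2 * int e) :: rat)" by simp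
    ultimately show ?thesis using q_pow_add by metis
  qed
  finally have q: "q_pow (of_nat e1 + S1 + N1) * q_pow (of_nat e2 + S2 + N2) = q_pow N * (q_pow 1 ^ e * q_pow S)"
    by (simp add: q_pow_of_nat)
  have sign: "(- 1) ^ (n_minus tails T1 + e1) * (- 1) ^ (n_minus tails T2 + e2) = (- 1 :: laurent) ^ n_minus tails L * (- 1) ^ e"
    by (simp add: e n_minus_L power_add mult_ac)
  have "weight tails T1 (fst x) * weight tails T2 (snd x) =
      ((- 1) ^ (n_minus tails T1 + e1) * (- 1) ^ (n_minus tails T2 + e2)) *
      (q_pow (of_nat e1 + S1 + N1) * q_pow (of_nat e2 + S2 + N2))"
    unfolding x(1) fst_conv snd_conv w1(1) w2(1) by (simp only: mult_ac)
  also have "\<dots> = (- 1) ^ n_minus tails L * q_pow N * (((- 1) ^ e * q_pow 1 ^ e) * q_pow S)"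
    unfolding sign q by (simp only: mult_ac)
  also have "(- 1) ^ e * q_pow 1 ^ e = (- q_pow 1) ^ e" by (metis power_minus)
  finally show ?thesis by (simp add: x(2) state_weight_def e_def S_def N_def)
qed

theorem sum_pairs: "(\<Sum>x\<in>pairs. weight tails T1 (fst x) * weight tails T2 (snd x)) = jones tails L"
proof -
  let ?c = "(- 1) ^ n_minus tails L * q_pow (of_nat (n_plus tails L) - 2 * of_nat (n_minus tails L))"
  have fin: "finite (components (resolve \<rho> L))" for \<rho>
    using diagramD(1)[OF diagram_L] by (simp add: components_eq)
  \<comment> \<open>Cutting and merging are inverse to each other and respect the weights, so the
    terms of the composition are the decorated states of \<open>L\<close>.\<close>
  have "(\<Sum>x\<in>pairs. weight tails T1 (fst x) * weight tails T2 (snd x)) = (\<Sum>y\<in>states. state_weight tails y)"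
    by (rule sum.reindex_bij_witness[of _ cut_state merge_pair])
      (use cut_state_merge merge_cut_state weight_merge in blast)+
  also have "\<dots> = (\<Sum>\<rho>\<in>maps (crossings L) {0, 1}. \<Sum>s\<in>maps (components (resolve \<rho> L)) {1, - 1}. state_weight tails (\<rho>, s))"
    unfolding states_def
    by (subst sum.Sigma) (use fin finite_crossings[OF diagram_L] in \<open>auto intro!: finite_maps\<close>)
  also have "\<dots> = ?c * state_sum L"
    unfolding state_weight_def prod.case sum_distrib_left[symmetric] sum_maps_q_pow[OF fin] state_sum_def ..
  also have "\<dots> = jones tails L" by (simp add: jones_def unnormalized_jones_eq[OF link])
  finally show ?thesis .
qed

section \<open>Evaluation of the composition\<close>

lemma lookup_type_A:
  "Poly_Mapping.lookup (type_A tails n T1) x =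
     (\<Sum>r\<in>{r \<in> decorated_resolutions T1. boundary Inside n T1 r = x}. weight tails T1 r)"
  unfolding type_A_def lookup_sum lookup_single
  by (subst sum.inter_filter[OF finite_decorated_resolutions[OF diagrams(1)]]) (simp add: when_def)

lemma lookup_type_A_map:
  "Poly_Mapping.lookup (type_A_map tails n T1 f) x = f * Poly_Mapping.lookup (type_A tails n T1) x"
  by (simp add: type_A_map_def Poly_Mapping.map.rep_eq when_def)

lemma keys_type_A_map:
  "Poly_Mapping.keys (type_A_map tails n T1 f) \<subseteq> boundary Inside n T1 ` decorated_resolutions T1"
proof
  fix x assume "x \<in> Poly_Mapping.keys (type_A_map tails n T1 f)"
  then have "Poly_Mapping.lookup (type_A tails n T1) x \<noteq> 0"
    by (auto simp: in_keys_iff lookup_type_A_map)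
  then have "{r \<in> decorated_resolutions T1. boundary Inside n T1 r = x} \<noteq> {}"
    unfolding lookup_type_A by (metis sum.empty)
  then show "x \<in> boundary Inside n T1 ` decorated_resolutions T1" by blast
qed

lemma boundary_in_CL: "r \<in> decorated_resolutions T1 \<Longrightarrow> boundary Inside n T1 r \<in> CL n"
  using cleaved_link_cleaved_of[OF tangles(1), of r n] length_es by (simp add: CL_def boundary_eq)

lemma type_A_map_in_I_module: "type_A_map tails n T1 f \<in> I_module n"
  using keys_type_A_map boundary_in_CL by (fastforce simp: I_module_def)

lemma type_D_type_A: "type_D tails n T2 (type_A_map tails n T1 f) = jones tails L * f"
proof -
  let ?R1 = "decorated_resolutions T1" and ?R2 = "decorated_resolutions T2"
  let ?b1 = "boundary Inside n T1" and ?b2 = "boundary Outside n T2"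
  let ?A = "type_A_map tails n T1 f" and ?D = "type_D_basis tails n T2"
  have fin: "finite ?R1" "finite ?R2" using finite_decorated_resolutions diagrams by blast+
  \<comment> \<open>Contributions to one basis element may cancel, so the keys can form a proper
    subset of the occurring boundaries; the additional summands have coefficient 0.\<close>
  have "type_D tails n T2 ?A = (\<Sum>x\<in>?b1 ` ?R1. Poly_Mapping.lookup ?A x * ?D x)"
    unfolding type_D_def
    by (rule sum.mono_neutral_left) (use fin keys_type_A_map in \<open>auto simp: in_keys_iff\<close>)
  also have "\<dots> = (\<Sum>x\<in>?b1 ` ?R1. \<Sum>r\<in>{r \<in> ?R1. ?b1 r = x}. f * (weight tails T1 r * ?D (?b1 r)))"
    unfolding lookup_type_A_map lookup_type_A sum_distrib_left sum_distrib_right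
    by (intro sum.cong refl) (simp add: mult_ac)
  \<comment> \<open>The inner sums run over the fibres of the boundary map on the resolutions of
    \<open>T1\<close>, so together they form one sum over all these resolutions.\<close>
  also have "\<dots> = (\<Sum>r\<in>?R1. f * (weight tails T1 r * ?D (?b1 r)))"
    by (rule sum.image_gen[symmetric, OF fin(1)])
  also have "\<dots> = f * (\<Sum>r\<in>?R1. \<Sum>r'\<in>{r' \<in> ?R2. ?b2 r' = ?b1 r}. weight tails T1 r * weight tails T2 r')"
    unfolding type_D_basis_def sum_distrib_left ..
  also have "(\<Sum>r\<in>?R1. \<Sum>r'\<in>{r' \<in> ?R2. ?b2 r' = ?b1 r}. weight tails T1 r * weight tails T2 r') =
      (\<Sum>x\<in>pairs. weight tails T1 (fst x) * weight tails T2 (snd x))"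
  proof -
    have "pairs = (SIGMA r:?R1. {r' \<in> ?R2. ?b2 r' = ?b1 r})" unfolding pairs_def by blast
    then show ?thesis using fin by (simp add: sum.Sigma case_prod_unfold)
  qed
  finally show ?thesis by (simp add: sum_pairs mult.commute)
qed

end

theorem proposition19:
  fixes L T\<^sub>1 T\<^sub>2 :: "'d diagram" and tails inside :: "'d set" and es :: "'d list" and n :: nat
  assumes "link_diagram L"
    and "orientation L tails"
    and "equator L inside es"
    and "length es = 2 * n"
    and "T\<^sub>1 = inside_part L inside es"
    and "T\<^sub>2 = outside_part L inside es"
  shows "type_A_map tails n T\<^sub>1 \<in> UNIV \<rightarrow> I_module n \<and>
    type_D tails n T\<^sub>2 \<circ> type_A_map tails n T\<^sub>1 = (\<lambda>f. jones tails L * f)"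
proof -
  interpret cut_link L "inside" es n by unfold_locales (fact assms)+
  show ?thesis
    unfolding assms(5,6) using type_A_map_in_I_module type_D_type_A by (auto simp: fun_eq_iff)
qed

end
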